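(* Let $d\ge2$, $s_c=d/2-1$, $\alpha,\beta,\gamma\in\mathbb{R}\setminus\{0\}$, $\theta:=\alpha\beta\gamma\left(\frac1\alpha-\frac1\beta-\frac1\gamma\right)$ and $\kappa:=(\alpha-\beta)(\alpha-\gamma)(\beta+\gamma)$. Assume $\kappa\ne0$ if $d\ge4$, and $\theta>0$ if $d=2,3$. Let $r>0$ and the small-data global flow maps $S_\pm$ of the system $$(i\partial_t+\alpha\Delta)u=-(\nabla\cdot w)v,\quad (i\partial_t+\beta\Delta)v=-(\nabla\cdot\overline w)u,\quad (i\partial_t+\gamma\Delta)w=\nabla(u\cdot\overline v)$$ be as described in the context. (i) For every $(u_0,v_0,w_0)\in B_r(\dot H^{s_c}\times\dot H^{s_c}\times\dot H^{s_c})$ there exist $(u_\pm,v_\pm,w_\pm)\in\dot H^{s_c}\times\dot H^{s_c}\times\dot H^{s_c}$ such that $$S_\pm(u_0,v_0,w_0)(t)-(e^{it\alpha\Delta}u_\pm,\,e^{it\beta\Delta}v_\pm,\,e^{it\gamma\Delta}w_\pm)\to0\quad\text{in }\dot H^{s_c}\times\dot H^{s_c}\times\dot H^{s_c}\text{ as }t\to\pm\infty.$$ (ii) For every $s\ge s_c$ the statement in (i) remains valid if $\dot H^{s_c}$ is replaced by $H^s$ (with $r$ and $S_\pm$ the ones associated with $H^s$).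
   Context: Notation. $e^{it\sigma\Delta}$ is the Fourier multiplier with symbol $e^{-it\sigma|\xi|^2}$. $N$ denotes a dyadic number in $2^{\mathbb{Z}}$. Fix an even, non-negative $\chi\in C_0^\infty((-2,2))$ with $\chi=1$ on $[-1,1]$, $\psi(t)=\chi(t)-\chi(2t)$, $\psi_N(t)=\psi(N^{-1}t)$, $\widehat{P_Nf}(\xi)=\psi_N(|\xi|)\widehat f(\xi)$. Unknowns are $\mathbb{C}^d$-valued, $u\cdot\overline v=\sum_ju_j\overline{v_j}$. Norms: $\|f\|_{\dot H^s}=(\sum_NN^{2s}\|P_Nf\|_{L^2}^2)^{1/2}$, $\|f\|_{H^s}=\|f\|_{\dot H^0}+\|f\|_{\dot H^s}$ ($s\ge 0$). $B_r(H)=\{f\in H:\|f\|_H\le r\}$; product spaces carry the maximum norm. $U^2$. A $U^2$-atom is $a=\sum_{k=1}^K\mathbf 1_{[t_{k-1},t_k)}\phi_{k-1}$ with $-\infty<t_0<\dots<t_K\le\infty$, $\phi_k\in L^2(\mathbb{R}^d)$, $\sum_k\|\phi_k\|_{L^2}^2=1$. $U^2$ consists of $u=\sum_j\lambda_ja_j$ with atoms $a_j$ and $\sum|\lambda_j|<\infty$, normed by the infimum of $\sum|\lambda_j|$; $\|u\|_{U^2_\sigma}=\|e^{-it\sigma\Delta}u\|_{U^2}$. Spaces. $\dot Z^s_\sigma$: all $u\in C(\mathbb{R};\dot H^s)$ with $P_Nu\in U^2_\sigma$ for all $N$ and $\|u\|_{\dot Z^s_\sigma}=(\sum_NN^{2s}\|P_Nu\|_{U^2_\sigma}^2)^{1/2}<\infty$.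 $Z^s_\sigma$: same with $C(\mathbb{R};H^s)$ and norm $\|u\|_{\dot Z^0_\sigma}+\|u\|_{\dot Z^s_\sigma}$. $E(I)$ denotes restrictions of elements of $E$ to the interval $I$ with the infimum norm. $\dot X^s(I)=\dot Z^s_\alpha(I)\times\dot Z^s_\beta(I)\times\dot Z^s_\gamma(I)$, and $\dot X^s_r(I)$ is the subset where each of the three component norms is $\le2r$; $X^s(I),X^s_r(I)$ are the analogues with $Z$. The flow maps. Under the stated hypotheses there is $r>0$ such that for every $(u_0,v_0,w_0)\in B_r(\dot H^{s_c}\times\dot H^{s_c}\times\dot H^{s_c})$ the system has a solution in $\dot X^{s_c}([0,\infty))$ with initial data $(u_0,v_0,w_0)$, unique in $\dot X^{s_c}_r([0,\infty))$; it is denoted $S_+(u_0,v_0,w_0)$. Similarly for $s\ge s_c$ with $H^s$, $X^s([0,\infty))$, $X^s_r([0,\infty))$ (with some $r>0$). By time reversibility, the flow map on $(-\infty,0]$ is $S_-(u_0,v_0,w_0)(t)=\overline{S_+(\overline{u_0},\overline{v_0},\overline{w_0})(-t)}$, $t\le0$. Solution means solution of the Duhamel equations $u(t)=e^{it\alpha\Delta}u_0+i\int_0^te^{i(t-t')\alpha\Delta}(\nabla\cdot w)v\,dt'$, $v(t)=e^{it\beta\Delta}v_0+i\int_0^te^{i(t-t')\beta\Delta}(\nabla\cdot\overline w)u\,dt'$, $w(t)=e^{it\gamma\Delta}w_0-i\int_0^te^{i(t-t')\gamma\Delta}\nabla(u\cdot\overline v)\,dt'$, with bilinear terms understood through the Littlewood–Paley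 decomposition of the factors. *)

theory Defs
  imports "HOL-Analysis.Analysis"
begin

text \<open>
  Elements of function spaces are represented by Borel functions on \<open>real ^ 'n\<close>, where
  \<open>CARD('n)\<close> is the dimension $d$; equality of elements is equality almost everywhere.
  The unknowns are $C^d$-valued.
\<close>

type_synonym 'n sfield = "real ^ 'n \<Rightarrow> complex"
type_synonym 'n vfield = "real ^ 'n \<Rightarrow> complex ^ 'n"
type_synonym 'n traj = "real \<Rightarrow> 'n vfield"
type_synonym 'n data = "'n vfield \<times> 'n vfield \<times> 'n vfield"
type_synonym 'n sol = "'n traj \<times> 'n traj \<times> 'n traj"


subsection \<open>Fourier transform and Fourier multipliers\<close>

definition partial_deriv :: "'n::finite \<Rightarrow> 'n sfield \<Rightarrow> 'n sfield" where
  "partial_deriv j \<phi> x = frechet_derivative \<phi> (at x) (axis j 1)"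

definition schwartz :: "('n::finite) sfield \<Rightarrow> bool" where
  "schwartz \<phi> \<longleftrightarrow> (\<forall>js. \<forall>k::nat.
     (\<forall>x. foldr partial_deriv js \<phi> differentiable (at x)) \<and>
     bounded (range (\<lambda>x. (1 + norm x) ^ k *\<^sub>R foldr partial_deriv js \<phi> x)))"

definition fourier_int :: "('n::finite) sfield \<Rightarrow> 'n sfield" where
  "fourier_int \<phi> \<xi> = (\<integral>x. cis (- (x \<bullet> \<xi>)) * \<phi> x \<partial>lborel)"

definition tempered_fun :: "('n::finite) sfield \<Rightarrow> bool" where
  "tempered_fun f \<longleftrightarrow> f \<in> borel_measurable borel \<and>
     (\<exists>k::nat. integrable lborel (\<lambda>x. norm (f x) / (1 + norm x) ^ k))"

text \<open>\<open>g\<close> is the Fourier transform of \<open>f\<close> in the sense of tempered distributions. (The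
  normalisation of the Fourier transform plays no role for Fourier multipliers.)\<close>

definition has_fourier :: "('n::finite) sfield \<Rightarrow> 'n sfield \<Rightarrow> bool" where
  "has_fourier f g \<longleftrightarrow> tempered_fun f \<and> tempered_fun g \<and>
     (\<forall>\<phi>. schwartz \<phi> \<longrightarrow>
        (\<integral>x. f x * fourier_int \<phi> x \<partial>lborel) = (\<integral>\<xi>. g \<xi> * \<phi> \<xi> \<partial>lborel))"

definition has_multiplier :: "('n::finite) sfield \<Rightarrow> 'n sfield \<Rightarrow> 'n sfield \<Rightarrow> bool" where
  "has_multiplier m f h \<longleftrightarrow> (\<exists>g. has_fourier f g \<and> has_fourier h (\<lambda>\<xi>. m \<xi> * g \<xi>))"

text \<open>The Fourier multiplier with symbol \<open>m\<close>; the choice only concerns the representative,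
  since the result is determined almost everywhere whenever it exists.\<close>

definition fmult :: "('n::finite) sfield \<Rightarrow> 'n sfield \<Rightarrow> 'n sfield" where
  "fmult m f = (SOME h. has_multiplier m f h)"

definition fmult_vec :: "('n::finite) sfield \<Rightarrow> 'n vfield \<Rightarrow> 'n vfield" where
  "fmult_vec m f x = (\<chi> j. fmult m (\<lambda>y. f y $ j) x)"

definition propagator :: "real \<Rightarrow> real \<Rightarrow> ('n::finite) vfield \<Rightarrow> 'n vfield" where
  "propagator \<sigma> t = fmult_vec (\<lambda>\<xi>. cis (- (t * \<sigma> * (norm \<xi>)\<^sup>2)))"

definition deriv_dir :: "'n::finite \<Rightarrow> 'n sfield \<Rightarrow> 'n sfield" where
  "deriv_dir j = fmult (\<lambda>\<xi>. \<i> * complex_of_real (\<xi> $ j))"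

definition divergence :: "('n::finite) vfield \<Rightarrow> 'n sfield" where
  "divergence w x = (\<Sum>j\<in>UNIV. deriv_dir j (\<lambda>y. w y $ j) x)"

definition gradient :: "('n::finite) sfield \<Rightarrow> 'n vfield" where
  "gradient f x = (\<chi> j. deriv_dir j f x)"


subsection \<open>Littlewood--Paley projections\<close>

definition lp_cutoff :: "(real \<Rightarrow> real) \<Rightarrow> bool" where
  "lp_cutoff \<eta> \<longleftrightarrow>
     (\<forall>k t. (deriv ^^ k) \<eta> differentiable (at t)) \<and>
     (\<forall>t. \<eta> (- t) = \<eta> t) \<and> (\<forall>t. 0 \<le> \<eta> t) \<and>
     closure {t. \<eta> t \<noteq> 0} \<subseteq> {-2<..<2} \<and>
     (\<forall>t\<in>{-1..1}. \<eta> t = 1)"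

definition lp_psi :: "(real \<Rightarrow> real) \<Rightarrow> real \<Rightarrow> real" where
  "lp_psi \<eta> t = \<eta> t - \<eta> (2 * t)"

definition dyadic :: "real set" where
  "dyadic = range (\<lambda>k::int. 2 powi k)"

definition LP :: "(real \<Rightarrow> real) \<Rightarrow> real \<Rightarrow> ('n::finite) vfield \<Rightarrow> 'n vfield" where
  "LP \<eta> N = fmult_vec (\<lambda>\<xi>. complex_of_real (lp_psi \<eta> (norm \<xi> / N)))"


subsection \<open>Lebesgue and Sobolev spaces\<close>

definition L2 :: "('n::finite) vfield set" where
  "L2 = {f. f \<in> borel_measurable borel \<and> integrable lborel (\<lambda>x. (norm (f x))\<^sup>2)}"

definition L2_norm :: "('n::finite) vfield \<Rightarrow> real" where
  "L2_norm f = sqrt (\<integral>x. (norm (f x))\<^sup>2 \<partial>lborel)"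

definition Hdot_norm :: "(real \<Rightarrow> real) \<Rightarrow> real \<Rightarrow> ('n::finite) vfield \<Rightarrow> real" where
  "Hdot_norm \<eta> s f = sqrt (\<Sum>\<^sub>\<infinity>N\<in>dyadic. N powr (2 * s) * (L2_norm (LP \<eta> N f))\<^sup>2)"

text \<open>The usual realisation of the homogeneous space for \<open>0 \<le> s < d / 2\<close>, consisting of the
  tempered distributions whose Fourier transform is a locally integrable function and whose
  norm is finite: for these \<open>s\<close> they are functions, the sum of a bounded one and one
  in \<open>L2\<close>. In particular \<open>Hdot \<eta> 0\<close> is \<open>L2\<close>. For larger \<open>s\<close> only the intersection
  with \<open>Hdot \<eta> 0\<close> is used.\<close>

definition Hdot :: "(real \<Rightarrow> real) \<Rightarrow> real \<Rightarrow> ('n::finite) vfield set" where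
  "Hdot \<eta> s = {f. (\<forall>j. \<exists>g. has_fourier (\<lambda>x. f x $ j) g) \<and>
     (\<forall>N\<in>dyadic. LP \<eta> N f \<in> L2) \<and>
     (\<lambda>N. N powr (2 * s) * (L2_norm (LP \<eta> N f))\<^sup>2) summable_on dyadic}"

definition Hs :: "(real \<Rightarrow> real) \<Rightarrow> real \<Rightarrow> ('n::finite) vfield set" where
  "Hs \<eta> s = Hdot \<eta> 0 \<inter> Hdot \<eta> s"

definition Hs_norm :: "(real \<Rightarrow> real) \<Rightarrow> real \<Rightarrow> ('n::finite) vfield \<Rightarrow> real" where
  "Hs_norm \<eta> s f = Hdot_norm \<eta> 0 f + Hdot_norm \<eta> s f"

text \<open>Below, a normed function space is given by its set \<open>H\<close> of elements and its norm \<open>nrm\<close>.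
  Outside of \<open>H\<close> the value of \<open>nrm\<close> is meaningless, so convergence to zero includes
  eventual membership in \<open>H\<close>.\<close>

definition tends_to_zero ::
  "'n vfield set \<Rightarrow> ('n vfield \<Rightarrow> real) \<Rightarrow> ('a \<Rightarrow> ('n::finite) vfield) \<Rightarrow> 'a filter \<Rightarrow> bool" where
  "tends_to_zero H nrm f F \<longleftrightarrow> (\<forall>\<^sub>F a in F. f a \<in> H) \<and> ((\<lambda>a. nrm (f a)) \<longlongrightarrow> 0) F"

definition cont_traj ::
  "'n vfield set \<Rightarrow> ('n vfield \<Rightarrow> real) \<Rightarrow> ('n::finite) traj \<Rightarrow> bool" where
  "cont_traj H nrm u \<longleftrightarrow> (\<forall>t. u t \<in> H) \<and>
     (\<forall>t\<^sub>0. tends_to_zero H nrm (\<lambda>t x. u t x - u t\<^sub>0 x) (at t\<^sub>0))"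

text \<open>Product of three copies of a space, with the maximum norm.\<close>

definition prod3 :: "'n vfield set \<Rightarrow> ('n::finite) data set" where
  "prod3 H = H \<times> H \<times> H"

definition norm3 :: "('n vfield \<Rightarrow> real) \<Rightarrow> ('n::finite) data \<Rightarrow> real" where
  "norm3 nrm = (\<lambda>(f, g, h). max (nrm f) (max (nrm g) (nrm h)))"

definition ball3 ::
  "'n vfield set \<Rightarrow> ('n vfield \<Rightarrow> real) \<Rightarrow> real \<Rightarrow> ('n::finite) data set" where
  "ball3 H nrm r = {D \<in> prod3 H. norm3 nrm D \<le> r}"

definition tends_to_zero3 ::
  "'n vfield set \<Rightarrow> ('n vfield \<Rightarrow> real) \<Rightarrow> ('a \<Rightarrow> ('n::finite) data) \<Rightarrow> 'a filter \<Rightarrow> bool" where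
  "tends_to_zero3 H nrm f F \<longleftrightarrow>
     (\<forall>\<^sub>F a in F. f a \<in> prod3 H) \<and> ((\<lambda>a. norm3 nrm (f a)) \<longlongrightarrow> 0) F"

definition diff3 :: "('n::finite) data \<Rightarrow> 'n data \<Rightarrow> 'n data" where
  "diff3 = (\<lambda>(f, g, h) (f', g', h').
     ((\<lambda>x. f x - f' x), (\<lambda>x. g x - g' x), (\<lambda>x. h x - h' x)))"


subsection \<open>The space $U^2$\<close>

definition U2_atom :: "('n::finite) traj \<Rightarrow> bool" where
  "U2_atom a \<longleftrightarrow> (\<exists>(K::nat) (\<tau>::nat \<Rightarrow> ereal) \<phi>.
     1 \<le> K \<and> -\<infinity> < \<tau> 0 \<and> strict_mono_on {0..K} \<tau> \<and>
     (\<forall>k<K. \<phi> k \<in> L2) \<and> (\<Sum>k<K. (L2_norm (\<phi> k))\<^sup>2) = 1 \<and>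
     a = (\<lambda>t x. \<Sum>k=1..K. if \<tau> (k - 1) \<le> ereal t \<and> ereal t < \<tau> k then \<phi> (k - 1) x else 0))"

definition U2_repr ::
  "('n::finite) traj \<Rightarrow> (nat \<Rightarrow> complex) \<Rightarrow> (nat \<Rightarrow> 'n traj) \<Rightarrow> bool" where
  "U2_repr u c a \<longleftrightarrow> (\<forall>j. U2_atom (a j)) \<and> summable (\<lambda>j. norm (c j)) \<and>
     (\<forall>t. tends_to_zero L2 L2_norm (\<lambda>n x. u t x - (\<Sum>j<n. c j *s a j t x)) sequentially)"

definition U2 :: "('n::finite) traj set" where
  "U2 = {u. \<exists>c a. U2_repr u c a}"

definition U2_norm :: "('n::finite) traj \<Rightarrow> real" where
  "U2_norm u = Inf {\<Sum>j. norm (c j) |c a. U2_repr u c a}"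

definition U2\<sigma> :: "real \<Rightarrow> ('n::finite) traj set" where
  "U2\<sigma> \<sigma> = {u. (\<lambda>t. propagator \<sigma> (- t) (u t)) \<in> U2}"

definition U2\<sigma>_norm :: "real \<Rightarrow> ('n::finite) traj \<Rightarrow> real" where
  "U2\<sigma>_norm \<sigma> u = U2_norm (\<lambda>t. propagator \<sigma> (- t) (u t))"


subsection \<open>The spaces $Z$ and $X$\<close>

definition Zdot_norm :: "(real \<Rightarrow> real) \<Rightarrow> real \<Rightarrow> real \<Rightarrow> ('n::finite) traj \<Rightarrow> real" where
  "Zdot_norm \<eta> s \<sigma> u =
     sqrt (\<Sum>\<^sub>\<infinity>N\<in>dyadic. N powr (2 * s) * (U2\<sigma>_norm \<sigma> (\<lambda>t. LP \<eta> N (u t)))\<^sup>2)"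

definition Zdot_finite :: "(real \<Rightarrow> real) \<Rightarrow> real \<Rightarrow> real \<Rightarrow> ('n::finite) traj \<Rightarrow> bool" where
  "Zdot_finite \<eta> s \<sigma> u \<longleftrightarrow>
     (\<lambda>N. N powr (2 * s) * (U2\<sigma>_norm \<sigma> (\<lambda>t. LP \<eta> N (u t)))\<^sup>2) summable_on dyadic"

definition Zdot :: "(real \<Rightarrow> real) \<Rightarrow> real \<Rightarrow> real \<Rightarrow> ('n::finite) traj set" where
  "Zdot \<eta> s \<sigma> = {u. cont_traj (Hdot \<eta> s) (Hdot_norm \<eta> s) u \<and>
     (\<forall>N\<in>dyadic. (\<lambda>t. LP \<eta> N (u t)) \<in> U2\<sigma> \<sigma>) \<and> Zdot_finite \<eta> s \<sigma> u}"

definition Zs :: "(real \<Rightarrow> real) \<Rightarrow> real \<Rightarrow> real \<Rightarrow> ('n::finite) traj set" where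
  "Zs \<eta> s \<sigma> = {u. cont_traj (Hs \<eta> s) (Hs_norm \<eta> s) u \<and>
     (\<forall>N\<in>dyadic. (\<lambda>t. LP \<eta> N (u t)) \<in> U2\<sigma> \<sigma>) \<and>
     Zdot_finite \<eta> 0 \<sigma> u \<and> Zdot_finite \<eta> s \<sigma> u}"

definition Zs_norm :: "(real \<Rightarrow> real) \<Rightarrow> real \<Rightarrow> real \<Rightarrow> ('n::finite) traj \<Rightarrow> real" where
  "Zs_norm \<eta> s \<sigma> u = Zdot_norm \<eta> 0 \<sigma> u + Zdot_norm \<eta> s \<sigma> u"

definition agree_on :: "real set \<Rightarrow> ('n::finite) traj \<Rightarrow> 'n traj \<Rightarrow> bool" where
  "agree_on I u v \<longleftrightarrow> (\<forall>t\<in>I. AE x in lborel. u t x = v t x)"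

text \<open>Restrictions of the elements of \<open>E\<close> to \<open>I\<close>. The values outside of \<open>I\<close> of a member of
  \<open>restr I E\<close> are irrelevant.\<close>

definition restr :: "real set \<Rightarrow> 'n traj set \<Rightarrow> ('n::finite) traj set" where
  "restr I E = {u. (\<forall>t\<in>I. u t \<in> borel_measurable borel) \<and> (\<exists>v\<in>E. agree_on I u v)}"

definition restr_norm ::
  "real set \<Rightarrow> 'n traj set \<Rightarrow> ('n traj \<Rightarrow> real) \<Rightarrow> ('n::finite) traj \<Rightarrow> real" where
  "restr_norm I E nrm u = Inf {nrm v |v. v \<in> E \<and> agree_on I u v}"

text \<open>The arguments \<open>Z\<close> and \<open>znorm\<close> are the families, indexed by \<open>\<sigma>\<close>, of the
  spaces \<open>Zdot \<eta> s \<sigma>\<close> or \<open>Zs \<eta> s \<sigma>\<close> and of their norms.\<close>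

definition Xspace ::
  "(real \<Rightarrow> 'n traj set) \<Rightarrow> real \<Rightarrow> real \<Rightarrow> real \<Rightarrow> real set \<Rightarrow> ('n::finite) sol set" where
  "Xspace Z \<alpha> \<beta> \<gamma> I = restr I (Z \<alpha>) \<times> restr I (Z \<beta>) \<times> restr I (Z \<gamma>)"

definition Xball ::
  "(real \<Rightarrow> 'n traj set) \<Rightarrow> (real \<Rightarrow> 'n traj \<Rightarrow> real) \<Rightarrow> real \<Rightarrow> real \<Rightarrow> real \<Rightarrow> real \<Rightarrow> real set
     \<Rightarrow> ('n::finite) sol set" where
  "Xball Z znorm \<alpha> \<beta> \<gamma> r I = {(u, v, w) \<in> Xspace Z \<alpha> \<beta> \<gamma> I.
     restr_norm I (Z \<alpha>) (znorm \<alpha>) u \<le> 2 * r \<and>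
     restr_norm I (Z \<beta>) (znorm \<beta>) v \<le> 2 * r \<and>
     restr_norm I (Z \<gamma>) (znorm \<gamma>) w \<le> 2 * r}"


subsection \<open>The Duhamel equations\<close>

definition cdot :: "('n::finite) vfield \<Rightarrow> 'n vfield \<Rightarrow> 'n sfield" where
  "cdot f g x = (\<Sum>j\<in>UNIV. f x $ j * cnj (g x $ j))"

definition vcnj :: "('n::finite) vfield \<Rightarrow> 'n vfield" where
  "vcnj f x = (\<chi> j. cnj (f x $ j))"

definition L2_inner :: "('n::finite) vfield \<Rightarrow> 'n vfield \<Rightarrow> complex" where
  "L2_inner f g = (\<integral>x. cdot f g x \<partial>lborel)"

text \<open>\<open>J\<close> is the \<open>L2\<close>-valued (weak) integral of $e^{i(t-t')\sigma\Delta}F(t')$ over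
  $0\le t'\le t$.\<close>

definition has_duhamel_integral ::
  "real \<Rightarrow> ('n::finite) traj \<Rightarrow> real \<Rightarrow> 'n vfield \<Rightarrow> bool" where
  "has_duhamel_integral \<sigma> F t J \<longleftrightarrow> (\<forall>t'\<in>{0..t}. F t' \<in> L2) \<and> J \<in> L2 \<and>
     (\<forall>\<phi>\<in>L2.
        set_integrable lborel {0..t} (\<lambda>t'. L2_inner (propagator \<sigma> (t - t') (F t')) \<phi>) \<and>
        L2_inner J \<phi> =
          (LINT t':{0..t}|lborel. L2_inner (propagator \<sigma> (t - t') (F t')) \<phi>))"

text \<open>
  The equation $f(t) = e^{it\sigma\Delta}f_0 + c\int_0^t e^{i(t-t')\sigma\Delta}B(t')\,dt'$ for
  \<open>t \<ge> 0\<close>, where \<open>B\<close> is bilinear in two factors and \<open>B N\<^sub>1 N\<^sub>2\<close> is obtained from it by applying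
  the projections \<open>LP \<eta> N\<^sub>1\<close> and \<open>LP \<eta> N\<^sub>2\<close> to the factors. The latter pieces take values in
  \<open>L2\<close>; the integral of \<open>B\<close> is the limit in \<open>H\<close>, as \<open>n\<close> tends to infinity, of the sums of the
  integrals of the pieces with $2^{-n}\le N_1,N_2\le 2^n$.
\<close>

definition duhamel_eq ::
  "'n vfield set \<Rightarrow> ('n vfield \<Rightarrow> real) \<Rightarrow> real \<Rightarrow> complex \<Rightarrow> (real \<Rightarrow> real \<Rightarrow> 'n traj)
     \<Rightarrow> 'n vfield \<Rightarrow> ('n::finite) traj \<Rightarrow> bool" where
  "duhamel_eq H nrm \<sigma> c B f\<^sub>0 f \<longleftrightarrow> (\<forall>t\<ge>0. \<exists>J::int \<Rightarrow> int \<Rightarrow> 'n vfield.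
     (\<forall>j k. has_duhamel_integral \<sigma> (B (2 powi j) (2 powi k)) t (J j k)) \<and>
     tends_to_zero H nrm
       (\<lambda>(n::nat) x. f t x - (propagator \<sigma> t f\<^sub>0 x +
          c *s (\<Sum>j\<in>{-int n..int n}. \<Sum>k\<in>{-int n..int n}. J j k x)))
       sequentially)"

definition is_solution ::
  "(real \<Rightarrow> real) \<Rightarrow> 'n vfield set \<Rightarrow> ('n vfield \<Rightarrow> real) \<Rightarrow> real \<Rightarrow> real \<Rightarrow> real
     \<Rightarrow> 'n data \<Rightarrow> ('n::finite) sol \<Rightarrow> bool" where
  "is_solution \<eta> H nrm \<alpha> \<beta> \<gamma> = (\<lambda>(u\<^sub>0, v\<^sub>0, w\<^sub>0) (u, v, w).
     duhamel_eq H nrm \<alpha> \<i>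
       (\<lambda>N\<^sub>1 N\<^sub>2 t x. divergence (LP \<eta> N\<^sub>1 (w t)) x *s LP \<eta> N\<^sub>2 (v t) x) u\<^sub>0 u \<and>
     duhamel_eq H nrm \<beta> \<i>
       (\<lambda>N\<^sub>1 N\<^sub>2 t x. divergence (LP \<eta> N\<^sub>1 (vcnj (w t))) x *s LP \<eta> N\<^sub>2 (u t) x) v\<^sub>0 v \<and>
     duhamel_eq H nrm \<gamma> (- \<i>)
       (\<lambda>N\<^sub>1 N\<^sub>2 t. gradient (cdot (LP \<eta> N\<^sub>1 (u t)) (LP \<eta> N\<^sub>2 (v t)))) w\<^sub>0 w)"


subsection \<open>The flow maps\<close>

text \<open>\<open>S\<close> assigns to all data in the ball of radius \<open>r\<close> the solution on \<open>[0,\<infinity>)\<close> with these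
  data that is unique in \<open>Xball\<close>.\<close>

definition flow_map ::
  "(real \<Rightarrow> real) \<Rightarrow> 'n vfield set \<Rightarrow> ('n vfield \<Rightarrow> real) \<Rightarrow>
     (real \<Rightarrow> 'n traj set) \<Rightarrow> (real \<Rightarrow> 'n traj \<Rightarrow> real) \<Rightarrow>
     real \<Rightarrow> real \<Rightarrow> real \<Rightarrow> real \<Rightarrow> ('n::finite data \<Rightarrow> 'n sol) \<Rightarrow> bool" where
  "flow_map \<eta> H nrm Z znorm \<alpha> \<beta> \<gamma> r S \<longleftrightarrow> (\<forall>D\<in>ball3 H nrm r.
     S D \<in> Xball Z znorm \<alpha> \<beta> \<gamma> r {0..} \<and> is_solution \<eta> H nrm \<alpha> \<beta> \<gamma> D (S D) \<and>
     (\<forall>(u, v, w)\<in>Xball Z znorm \<alpha> \<beta> \<gamma> r {0..}. is_solution \<eta> H nrm \<alpha> \<beta> \<gamma> D (u, v, w) \<longrightarrow>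
        (case S D of (u', v', w') \<Rightarrow>
           agree_on {0..} u u' \<and> agree_on {0..} v v' \<and> agree_on {0..} w w')))"

definition Hdot_flow_map ::
  "(real \<Rightarrow> real) \<Rightarrow> real \<Rightarrow> real \<Rightarrow> real \<Rightarrow> real \<Rightarrow> real
     \<Rightarrow> ('n::finite data \<Rightarrow> 'n sol) \<Rightarrow> bool" where
  "Hdot_flow_map \<eta> s = flow_map \<eta> (Hdot \<eta> s) (Hdot_norm \<eta> s) (Zdot \<eta> s) (Zdot_norm \<eta> s)"

definition Hs_flow_map ::
  "(real \<Rightarrow> real) \<Rightarrow> real \<Rightarrow> real \<Rightarrow> real \<Rightarrow> real \<Rightarrow> real
     \<Rightarrow> ('n::finite data \<Rightarrow> 'n sol) \<Rightarrow> bool" where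
  "Hs_flow_map \<eta> s = flow_map \<eta> (Hs \<eta> s) (Hs_norm \<eta> s) (Zs \<eta> s) (Zs_norm \<eta> s)"

definition eval_sol :: "('n::finite) sol \<Rightarrow> real \<Rightarrow> 'n data" where
  "eval_sol = (\<lambda>(u, v, w) t. (u t, v t, w t))"

definition cnj3 :: "('n::finite) data \<Rightarrow> 'n data" where
  "cnj3 = (\<lambda>(f, g, h). (vcnj f, vcnj g, vcnj h))"

text \<open>Values at time \<open>t\<close> of the flow maps: \<open>S_plus S D t\<close> for \<open>t \<ge> 0\<close>, and \<open>S_minus S D t\<close>
  for \<open>t \<le> 0\<close>, obtained from the former by time reversal.\<close>

definition S_plus :: "('n::finite data \<Rightarrow> 'n sol) \<Rightarrow> 'n data \<Rightarrow> real \<Rightarrow> 'n data" where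
  "S_plus S D t = eval_sol (S D) t"

definition S_minus :: "('n::finite data \<Rightarrow> 'n sol) \<Rightarrow> 'n data \<Rightarrow> real \<Rightarrow> 'n data" where
  "S_minus S D t = cnj3 (S_plus S (cnj3 D) (- t))"

definition free_evolution ::
  "real \<Rightarrow> real \<Rightarrow> real \<Rightarrow> ('n::finite) data \<Rightarrow> real \<Rightarrow> 'n data" where
  "free_evolution \<alpha> \<beta> \<gamma> = (\<lambda>(f, g, h) t.
     (propagator \<alpha> t f, propagator \<beta> t g, propagator \<gamma> t h))"

end

theory Submission
  imports Defs "HOL-Probability.Probability"
begin

text \<open>
  Scattering is read off from the space in which the solutions live. A component of the flow is on
  $[0,\infty)$ the restriction of some \<open>v\<close> in a $Z$ space, so for every dyadic $N$ the profile
  $e^{-it\sigma\Delta}P_Nv(t)$ belongs to $U^2$. Atoms are constant for large times, and the $L^2$ norm at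
  any time is at most the $U^2$ norm. Therefore every function in $U^2$ has a limit in $L^2$ at infinity
  (\<open>U2_Cauchy_at_infinity\<close>). The $U^2$ norms of the profiles are square summable over $N$ with the
  Sobolev weights, so dominated convergence for series sums up these limits: the profile
  $e^{-it\sigma\Delta}v(t)$ is Cauchy in the Sobolev norm as $t\to\infty$. Its limit is the
  scattering state, because the propagator is an isometry (\<open>Z_scattering\<close>).
  
  The argument takes place on the Fourier side. There the homogeneous Sobolev norm is a weighted $L^2$ norm
  with weight $\sum_NN^{2s}\psi_N^2$ (\<open>Hdot_iff_weighted\<close>), weighted $L^2$ spaces are complete, and the
  propagator is multiplication by a function of modulus one. For the passage between the two
  sides, three properties of the distributional Fourier transform are required.
  First, a tempered function and its transform determine each other almost everywhere
  (\<open>has_fourier_unique_left\<close>, \<open>has_fourier_unique_right\<close>); this makes the operators that are defined by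
  choosing a representative computable. Second, Plancherel's theorem (\<open>Plancherel\<close>). Third, the limit in the
  weighted space is the transform of a function (\<open>weighted_inv_fourier_exists\<close>): for
  $0\le s<d/2$ its low frequencies are integrable and its high frequencies are square integrable. All three
  rest on one identity for Fourier integrals damped by a Gaussian (\<open>fourier_gauss_regularisation\<close>).
  
  Both parts of the theorem are cases of a statement about $\dot H^{s_1}\cap\dot H^{s_2}$
  (\<open>flow_scattering\<close>), namely $s_1=s_2=s_c$ and $s_1=0$, $s_2=s$. The limit $t\to-\infty$ is reduced to
  $t\to\infty$ by time reversal, since complex conjugation turns the propagator at time $t$ into the one at
  time $-t$ (\<open>propagator_vcnj\<close>).
\<close>

section \<open>Lebesgue integrals on Euclidean space\<close>

lemma nn_integral_lborel_affine:
  fixes t :: "'a::euclidean_space"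
  assumes [measurable]: "f \<in> borel_measurable borel" and c: "c \<noteq> 0"
  shows "(\<integral>\<^sup>+x. f x \<partial>lborel) = ennreal (\<bar>c\<bar> ^ DIM('a)) * (\<integral>\<^sup>+x. f (t + c *\<^sub>R x) \<partial>lborel)"
  by (subst lborel_affine[OF c, of t])
     (simp add: nn_integral_density nn_integral_distr nn_integral_cmult)

lemma integrable_lborel_affine:
  fixes f :: "'a::euclidean_space \<Rightarrow> 'b::{banach, second_countable_topology}"
  assumes f: "integrable lborel f" and c: "c \<noteq> 0"
  shows "integrable lborel (\<lambda>x. f (t + c *\<^sub>R x))"
proof -
  have [measurable]: "f \<in> borel_measurable borel"
    using f by auto
  have "(\<integral>\<^sup>+x. ennreal (norm (f x)) \<partial>lborel) < \<infinity>"
    using f by (simp add: integrable_iff_bounded)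
  then show ?thesis
    unfolding integrable_iff_bounded using c
    by (subst (asm) nn_integral_lborel_affine[OF _ c, of _ t])
       (auto simp: ennreal_mult_less_top ennreal_zero_less_mult_iff)
qed

lemma integral_lborel_affine:
  fixes f :: "'a::euclidean_space \<Rightarrow> 'b::{banach, second_countable_topology}"
  assumes [measurable]: "f \<in> borel_measurable borel" and c: "c \<noteq> 0"
  shows "(\<integral>x. f x \<partial>lborel) = \<bar>c\<bar> ^ DIM('a) *\<^sub>R (\<integral>x. f (t + c *\<^sub>R x) \<partial>lborel)"
  by (subst lborel_affine[OF c, of t]) (simp add: integral_density integral_distr)

lemma integrable_lborel_shift:
  fixes f :: "'a::euclidean_space \<Rightarrow> 'b::{banach, second_countable_topology}"
  assumes "integrable lborel f"
  shows "integrable lborel (\<lambda>x. f (x + t))"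
  using integrable_lborel_affine[OF assms, of 1 t] by (simp add: add.commute)

lemma integral_lborel_shift:
  fixes f :: "'a::euclidean_space \<Rightarrow> 'b::{banach, second_countable_topology}"
  assumes "f \<in> borel_measurable borel"
  shows "(\<integral>x. f (x + t) \<partial>lborel) = (\<integral>x. f x \<partial>lborel)"
  using integral_lborel_affine[OF assms, of 1 t] by (simp add: add.commute)

lemma integrable_lborel_uminus:
  fixes f :: "'a::euclidean_space \<Rightarrow> 'b::{banach, second_countable_topology}"
  assumes "integrable lborel f"
  shows "integrable lborel (\<lambda>x. f (- x))"
  using integrable_lborel_affine[OF assms, of "-1" 0] by simp

lemma integral_lborel_uminus:
  fixes f :: "'a::euclidean_space \<Rightarrow> 'b::{banach, second_countable_topology}"
  assumes "f \<in> borel_measurable borel"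
  shows "(\<integral>x. f (- x) \<partial>lborel) = (\<integral>x. f x \<partial>lborel)"
  using integral_lborel_affine[OF assms, of "-1" 0] by simp

lemma vec_prod_Basis:
  fixes x :: "real ^ 'n::finite" and f :: "'n \<Rightarrow> real \<Rightarrow> 'b::comm_monoid_mult"
  shows "(\<Prod>j\<in>UNIV. f j (x $ j)) = (\<Prod>b\<in>Basis. f (THE j. b = axis j 1) (x \<bullet> b))"
proof -
  have B: "(Basis :: (real ^ 'n) set) = range (\<lambda>j. axis j 1)"
    by (auto simp: Basis_vec_def)
  have inj: "inj (\<lambda>j::'n. axis j (1::real))"
    by (auto simp: inj_on_def axis_eq_axis)
  show ?thesis
    unfolding B prod.reindex[OF inj] by (simp add: axis_eq_axis inner_axis)
qed

lemma
  fixes f :: "'n::finite \<Rightarrow> real \<Rightarrow> 'b::{real_normed_field, banach, second_countable_topology}"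
  assumes f: "\<And>j. integrable lborel (f j)"
  shows integrable_lborel_vec_prod: "integrable lborel (\<lambda>x::real^'n. \<Prod>j\<in>UNIV. f j (x $ j))"
    and integral_lborel_vec_prod:
      "(\<integral>x. (\<Prod>j\<in>UNIV. f j ((x::real^'n) $ j)) \<partial>lborel) = (\<Prod>j\<in>UNIV. \<integral>x. f j x \<partial>lborel)"
proof -
  interpret product_sigma_finite "\<lambda>_::real^'n. lborel :: real measure"
    by standard
  let ?F = "\<lambda>x::real^'n. \<Prod>b\<in>Basis. f (THE j. b = axis j 1) (x \<bullet> b)"
  let ?T = "\<lambda>y::(real^'n) \<Rightarrow> real. \<Sum>b\<in>Basis. y b *\<^sub>R b"
  have [measurable]: "f j \<in> borel_measurable borel" for j
    using f[of j] by auto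
  have T: "?T \<in> measurable (\<Pi>\<^sub>M b\<in>Basis. lborel) borel"
    by measurable
  have FT: "?F (?T y) = (\<Prod>b\<in>Basis. f (THE j. b = axis j 1) (y b))" for y
    by (intro prod.cong refl) simp
  have "integrable (\<Pi>\<^sub>M b\<in>Basis. lborel) (\<lambda>y. ?F (?T y))"
    unfolding FT by (rule product_integrable_prod) (auto intro: f)
  then have "integrable (distr (\<Pi>\<^sub>M b\<in>Basis. lborel) borel ?T) ?F"
    by (subst integrable_distr_eq[OF T]) auto
  then show "integrable lborel (\<lambda>x::real^'n. \<Prod>j\<in>UNIV. f j (x $ j))"
    unfolding vec_prod_Basis lborel_eq[symmetric] .
  have "integral\<^sup>L lborel ?F = (\<integral>y. ?F (?T y) \<partial>(\<Pi>\<^sub>M b\<in>Basis. lborel))"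
    by (subst lborel_eq, subst integral_distr[OF T]) auto
  also have "\<dots> = (\<Prod>b\<in>(Basis :: (real^'n) set). \<integral>x. f (THE j. b = axis j 1) x \<partial>lborel)"
    unfolding FT using f
    by (intro product_integral_prod[where f="\<lambda>b. f (THE j. b = axis j 1)"]) auto
  also have "\<dots> = (\<Prod>j\<in>UNIV. \<integral>x. f j x \<partial>lborel)"
    using vec_prod_Basis[of "\<lambda>j _. integral\<^sup>L lborel (f j)" "0::real^'n"] by simp
  finally show "(\<integral>x. (\<Prod>j\<in>UNIV. f j ((x::real^'n) $ j)) \<partial>lborel) = (\<Prod>j\<in>UNIV. \<integral>x. f j x \<partial>lborel)"
    unfolding vec_prod_Basis .
qed

section \<open>Gaussians\<close>

definition gauss :: "real ^ 'n::finite \<Rightarrow> real" where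
  "gauss x = exp (- (norm x)\<^sup>2 / 2)"

lemma gauss_pos: "0 < gauss x" and gauss_le_1: "gauss x \<le> 1"
  by (auto simp: gauss_def)

lemma gauss_measurable [measurable]: "gauss \<in> borel_measurable borel"
  unfolding gauss_def by measurable

lemma gauss_uminus [simp]: "gauss (- x) = gauss x"
  by (simp add: gauss_def)

lemma norm_vec_square: "(norm (x :: real ^ 'n::finite))\<^sup>2 = (\<Sum>j\<in>UNIV. (x $ j)\<^sup>2)"
  by (simp add: norm_vec_def L2_set_def sum_nonneg)

lemma gauss_eq_prod: "gauss (x :: real ^ 'n::finite) = (\<Prod>j\<in>UNIV. exp (- (x $ j)\<^sup>2 / 2))"
  by (simp add: gauss_def norm_vec_square exp_sum[symmetric] sum_negf sum_divide_distrib)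

lemma cis_sum: "finite A \<Longrightarrow> cis (\<Sum>j\<in>A. f j) = (\<Prod>j\<in>A. cis (f j))"
  by (induction A rule: finite_induct) (auto simp: cis_mult[symmetric])

lemma cis_inner_eq_prod: "cis (x \<bullet> (y :: real ^ 'n::finite)) = (\<Prod>j\<in>UNIV. cis (x $ j * y $ j))"
  by (simp add: inner_vec_def cis_sum)

lemma cis_measurable [measurable (raw)]:
  "f \<in> borel_measurable M \<Longrightarrow> (\<lambda>x. cis (f x)) \<in> borel_measurable M"
  by (rule measurable_compose[OF _ borel_measurable_continuous_onI])
     (auto intro!: continuous_intros simp: cis_conv_exp)

lemma
  shows integrable_gauss_real: "integrable lborel (\<lambda>x::real. exp (- x\<^sup>2 / 2))"
    and integrable_cis_gauss_real: "integrable lborel (\<lambda>x::real. cis (x * t) * complex_of_real (exp (- x\<^sup>2 / 2)))"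
    and integral_cis_gauss_real: "(\<integral>x. cis (x * t) * complex_of_real (exp (- x\<^sup>2 / 2)) \<partial>lborel)
       = complex_of_real (sqrt (2 * pi) * exp (- t\<^sup>2 / 2))"
proof -
  have n: "exp (- x\<^sup>2 / 2) = sqrt (2 * pi) * std_normal_density x" for x
    by (simp add: normal_density_def)
  show I: "integrable lborel (\<lambda>x::real. exp (- x\<^sup>2 / 2))"
    unfolding n by (intro integrable_mult_right) simp
  show "integrable lborel (\<lambda>x::real. cis (x * t) * complex_of_real (exp (- x\<^sup>2 / 2)))"
    by (rule Bochner_Integration.integrable_bound[OF I]) (auto simp: norm_mult)
  have "complex_of_real (exp (- t\<^sup>2 / 2)) = char std_normal_distribution t"
    by (simp add: char_std_normal_distribution)
  also have "\<dots> = (\<integral>x. std_normal_density x *\<^sub>R iexp (t * x) \<partial>lborel)"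
    unfolding char_def by (subst integral_density) (auto simp: normal_density_nonneg)
  finally have "complex_of_real (sqrt (2 * pi)) * complex_of_real (exp (- t\<^sup>2 / 2)) =
     (\<integral>x. complex_of_real (sqrt (2 * pi)) * (std_normal_density x *\<^sub>R iexp (t * x)) \<partial>lborel)"
    by (simp only: integral_mult_right_zero)
  also have "\<dots> = (\<integral>x. cis (x * t) * complex_of_real (exp (- x\<^sup>2 / 2)) \<partial>lborel)"
    unfolding n by (intro Bochner_Integration.integral_cong)
      (auto simp: cis_conv_exp scaleR_conv_of_real mult_ac)
  finally show "(\<integral>x. cis (x * t) * complex_of_real (exp (- x\<^sup>2 / 2)) \<partial>lborel)
       = complex_of_real (sqrt (2 * pi) * exp (- t\<^sup>2 / 2))"
    by simp
qed

text \<open>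
  The total mass $(2\pi)^{d/2}$ of \<open>gauss\<close>. The Fourier transform \<open>fourier_int\<close> carries no factor, so
  the square of this number is the constant in the inversion formula.
\<close>

definition gauss_mass :: "'n::finite itself \<Rightarrow> real" where
  "gauss_mass _ = sqrt (2 * pi) ^ CARD('n)"

lemma gauss_mass_pos [simp]: "0 < gauss_mass TYPE('n::finite)"
  by (simp add: gauss_mass_def)

lemma gauss_mass_neq_0 [simp]: "gauss_mass TYPE('n::finite) \<noteq> 0"
  using gauss_mass_pos[where 'n='n] by (metis less_irrefl)

lemma integrable_gauss: "integrable lborel (gauss :: real ^ 'n::finite \<Rightarrow> real)"
  unfolding gauss_eq_prod[abs_def]
  by (rule integrable_lborel_vec_prod) (rule integrable_gauss_real)

lemma integral_cis_gauss:
  "(\<integral>x. cis (x \<bullet> t) * complex_of_real (gauss x) \<partial>lborel)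
     = complex_of_real (gauss_mass TYPE('n) * gauss (t :: real ^ 'n::finite))"
proof -
  have "(\<integral>x. cis (x \<bullet> t) * complex_of_real (gauss x) \<partial>lborel) =
    (\<integral>x. (\<Prod>j\<in>UNIV. cis ((x::real^'n) $ j * t $ j) * complex_of_real (exp (- (x $ j)\<^sup>2 / 2))) \<partial>lborel)"
    by (simp add: gauss_eq_prod cis_inner_eq_prod prod.distrib)
  also have "\<dots> = (\<Prod>j\<in>UNIV. \<integral>x. cis (x * t $ j) * complex_of_real (exp (- x\<^sup>2 / 2)) \<partial>lborel)"
    by (rule integral_lborel_vec_prod) (rule integrable_cis_gauss_real)
  also have "\<dots> = complex_of_real (gauss_mass TYPE('n) * gauss t)"
    unfolding integral_cis_gauss_real by (simp add: gauss_mass_def gauss_eq_prod prod.distrib)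
  finally show ?thesis .
qed

lemma integral_gauss: "(\<integral>x. gauss (x::real^'n::finite) \<partial>lborel) = gauss_mass TYPE('n)"
proof -
  have "complex_of_real (\<integral>x. gauss (x::real^'n) \<partial>lborel) = complex_of_real (gauss_mass TYPE('n))"
    using integral_cis_gauss[of "0::real^'n"] by (simp add: gauss_def)
  then show ?thesis
    by (simp only: of_real_eq_iff)
qed

text \<open>
  Since $1+|x|$ dominates each $\sqrt{1+x_j^2}$, the function is at most a product of functions of one variable.
\<close>

lemma integrable_inverse_power:
  "integrable lborel (\<lambda>x::real^'n::finite. 1 / (1 + norm x) ^ (2 * CARD('n)))"
proof -
  have 1: "integrable lborel (\<lambda>x::real. inverse (1 + x\<^sup>2))"
    using integrable_inverse_1_plus_square by (simp add: set_integrable_def)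
  have I: "integrable lborel (\<lambda>x::real^'n. \<Prod>j\<in>UNIV. inverse (1 + (x $ j)\<^sup>2))"
    by (rule integrable_lborel_vec_prod) (rule 1)
  show ?thesis
  proof (rule Bochner_Integration.integrable_bound[OF I])
    show "AE x in lborel. norm (1 / (1 + norm (x::real^'n)) ^ (2 * CARD('n)))
        \<le> norm (\<Prod>j\<in>UNIV. inverse (1 + (x $ j)\<^sup>2))"
    proof (rule AE_I2)
      fix x :: "real^'n"
      have "(\<Prod>j\<in>(UNIV::'n set). 1 / (1 + norm x)\<^sup>2) \<le> (\<Prod>j\<in>UNIV. inverse (1 + (x $ j)\<^sup>2))"
      proof (intro prod_mono conjI)
        fix j
        have "\<bar>x $ j\<bar>\<^sup>2 \<le> (norm x)\<^sup>2"
          by (rule power_mono) (use component_le_norm_cart[of x j] in auto)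
        then have le: "1 + (x $ j)\<^sup>2 \<le> (1 + norm x)\<^sup>2"
          using norm_ge_zero[of x] by (simp only: power2_sum power2_abs power_one mult_1_right)
        have "0 < 1 + (x $ j)\<^sup>2" by (simp add: add_pos_nonneg)
        then show "1 / (1 + norm x)\<^sup>2 \<le> inverse (1 + (x $ j)\<^sup>2)"
          using le_imp_inverse_le[OF le] by (simp add: inverse_eq_divide)
      qed simp
      then show "norm (1 / (1 + norm x) ^ (2 * CARD('n))) \<le> norm (\<Prod>j\<in>UNIV. inverse (1 + (x $ j)\<^sup>2))"
        by (simp add: power_mult power_one_over prod_nonneg)
    qed
  qed auto
qed

section \<open>Fourier integrals of integrable functions\<close>

lemma fourier_int_measurable [measurable]:
  fixes h :: "'n::finite sfield"
  assumes [measurable]: "h \<in> borel_measurable borel"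
  shows "fourier_int h \<in> borel_measurable borel"
  unfolding fourier_int_def[abs_def]
  by (rule lborel.borel_measurable_lebesgue_integral) measurable

lemma cnj_measurable [measurable (raw)]:
  "f \<in> borel_measurable M \<Longrightarrow> (\<lambda>x. cnj (f x)) \<in> borel_measurable M"
  by (rule measurable_compose[OF _ borel_measurable_continuous_onI])
     (auto intro!: continuous_intros)

lemma integrable_cis_mult:
  fixes h :: "'n::finite sfield"
  assumes "integrable lborel h" and [measurable]: "a \<in> borel_measurable borel"
  shows "integrable lborel (\<lambda>x. cis (a x) * h x)"
  by (rule Bochner_Integration.integrable_bound[OF assms(1)])
     (use assms in \<open>auto simp: norm_mult\<close>)

lemma norm_fourier_int_le:
  fixes h :: "'n::finite sfield"
  shows "norm (fourier_int h \<xi>) \<le> (\<integral>x. norm (h x) \<partial>lborel)"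
  unfolding fourier_int_def
  by (rule order_trans[OF integral_norm_bound]) (simp add: norm_mult)

lemma integrable_bounded_mult:
  fixes f g :: "'a \<Rightarrow> complex"
  assumes "integrable M f" and "g \<in> borel_measurable M" and "\<And>x. norm (g x) \<le> B"
  shows "integrable M (\<lambda>x. g x * f x)"
proof (rule Bochner_Integration.integrable_bound)
  show "integrable M (\<lambda>x. B * norm (f x))"
    using assms by simp
  show "AE x in M. norm (g x * f x) \<le> norm (B * norm (f x))"
  proof (rule AE_I2)
    fix x
    have "0 \<le> B" using norm_ge_zero assms(3) by (rule order_trans)
    then show "norm (g x * f x) \<le> norm (B * norm (f x))"
      using assms(3)[of x] by (simp add: norm_mult mult_right_mono)
  qed
qed (use assms in auto)

text \<open>
  Fubini's theorem in the form in which it is applied to the Fourier kernels $e^{\pm ix\cdot\xi}$.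
\<close>

lemma integral_kernel_commute:
  fixes f g :: "real ^ 'n::finite \<Rightarrow> complex"
  assumes f: "integrable lborel f" and g: "integrable lborel g"
    and k: "(\<lambda>(x, y). k x y) \<in> borel_measurable (borel \<Otimes>\<^sub>M borel)" "\<And>x y. norm (k x y) \<le> 1"
  shows "(\<integral>x. f x * (\<integral>y. k x y * g y \<partial>lborel) \<partial>lborel)
       = (\<integral>y. g y * (\<integral>x. k x y * f x \<partial>lborel) \<partial>lborel)"
proof -
  have [measurable]: "f \<in> borel_measurable borel" "g \<in> borel_measurable borel"
    using f g by auto
  have [measurable]: "(\<lambda>p. k (fst p) (snd p)) \<in> borel_measurable (borel \<Otimes>\<^sub>M borel)"
    using k(1) by (simp add: split_beta')
  have I: "integrable (lborel \<Otimes>\<^sub>M lborel) (\<lambda>p. f (fst p) * g (snd p))"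
  proof (rule lborel_pair.Fubini_integrable)
    show "integrable lborel (\<lambda>x. \<integral>y. norm (f (fst (x, y)) * g (snd (x, y))) \<partial>lborel)"
      using f by (simp add: norm_mult)
    show "AE x in lborel. integrable lborel (\<lambda>y. f (fst (x, y)) * g (snd (x, y)))"
      using g by simp
  qed measurable
  have J: "integrable (lborel \<Otimes>\<^sub>M lborel) (\<lambda>(x, y). f x * (k x y * g y))"
  proof (rule Bochner_Integration.integrable_bound[OF I])
    show "(\<lambda>(x, y). f x * (k x y * g y)) \<in> borel_measurable (lborel \<Otimes>\<^sub>M lborel)"
      unfolding split_beta' by measurable
    show "AE p in lborel \<Otimes>\<^sub>M lborel. norm (case p of (x, y) \<Rightarrow> f x * (k x y * g y))
        \<le> norm (f (fst p) * g (snd p))"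
    proof (rule AE_I2)
      fix p
      have "norm (k (fst p) (snd p)) * norm (f (fst p) * g (snd p)) \<le> 1 * norm (f (fst p) * g (snd p))"
        by (rule mult_right_mono[OF k(2)]) simp
      then show "norm (case p of (x, y) \<Rightarrow> f x * (k x y * g y)) \<le> norm (f (fst p) * g (snd p))"
        by (simp add: split_beta' norm_mult mult_ac)
    qed
  qed
  have "(\<integral>x. f x * (\<integral>y. k x y * g y \<partial>lborel) \<partial>lborel) = (\<integral>x. (\<integral>y. f x * (k x y * g y) \<partial>lborel) \<partial>lborel)"
    by simp
  also have "\<dots> = (\<integral>y. (\<integral>x. f x * (k x y * g y) \<partial>lborel) \<partial>lborel)"
    by (rule lborel_pair.Fubini_integral[symmetric]) (rule J)
  also have "\<dots> = (\<integral>y. (\<integral>x. g y * (k x y * f x) \<partial>lborel) \<partial>lborel)"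
    by (simp add: mult_ac)
  finally show ?thesis
    by simp
qed

lemma fourier_int_swap:
  fixes f g :: "'n::finite sfield"
  assumes "integrable lborel f" "integrable lborel g"
  shows "(\<integral>x. f x * fourier_int g x \<partial>lborel) = (\<integral>x. fourier_int f x * g x \<partial>lborel)"
proof -
  have "(\<integral>x. f x * (\<integral>y. cis (- (y \<bullet> x)) * g y \<partial>lborel) \<partial>lborel)
     = (\<integral>y. g y * (\<integral>x. cis (- (y \<bullet> x)) * f x \<partial>lborel) \<partial>lborel)"
    by (rule integral_kernel_commute) (use assms in auto)
  then show ?thesis
    by (simp add: fourier_int_def inner_commute mult.commute)
qed

lemma integrable_gauss_scaled:
  assumes "e \<noteq> 0"
  shows "integrable lborel (\<lambda>x::real^'n::finite. complex_of_real (gauss (e *\<^sub>R x)))"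
  using integrable_lborel_affine[OF integrable_gauss[where 'n='n] assms, of 0]
  by (simp add: complex_of_real_integrable_eq)

lemma integral_cis_gauss_scaled:
  fixes z :: "real^'n::finite"
  assumes e: "0 < e"
  shows "(\<integral>\<xi>. cis (z \<bullet> \<xi>) * complex_of_real (gauss (e *\<^sub>R \<xi>)) \<partial>lborel)
    = complex_of_real (gauss_mass TYPE('n) * gauss ((1 / e) *\<^sub>R z) / e ^ CARD('n))"
proof -
  have "(\<integral>\<xi>. cis (z \<bullet> \<xi>) * complex_of_real (gauss (e *\<^sub>R \<xi>)) \<partial>lborel) =
    \<bar>1 / e\<bar> ^ DIM(real^'n) *\<^sub>R
      (\<integral>\<xi>. cis (z \<bullet> (0 + (1 / e) *\<^sub>R \<xi>)) * complex_of_real (gauss (e *\<^sub>R (0 + (1 / e) *\<^sub>R \<xi>))) \<partial>lborel)"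
    by (rule integral_lborel_affine) (use e in auto)
  also have "\<dots> = \<bar>1 / e\<bar> ^ CARD('n) *\<^sub>R (\<integral>\<xi>. cis (\<xi> \<bullet> ((1 / e) *\<^sub>R z)) * complex_of_real (gauss \<xi>) \<partial>lborel)"
    using e by (simp add: inner_commute)
  also have "\<dots> = complex_of_real (gauss_mass TYPE('n) * gauss ((1 / e) *\<^sub>R z) / e ^ CARD('n))"
    unfolding integral_cis_gauss using e by (simp add: scaleR_conv_of_real power_one_over field_simps)
  finally show ?thesis .
qed

text \<open>
  The Gaussian factor makes the inversion integral of an arbitrary integrable function converge absolutely.
  Moving the Fourier transform onto the factor $e^{ix\cdot\xi}e^{-|e\xi|^2/2}$, where it produces a Gaussian
  centred at \<open>x\<close> of width \<open>e\<close>, turns the integral into an average of \<open>h\<close> near \<open>x\<close>.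
\<close>

lemma fourier_gauss_regularisation:
  fixes h :: "'n::finite sfield"
  assumes h: "integrable lborel h" and e: "0 < e"
  shows "(\<integral>\<xi>. fourier_int h \<xi> * (cis (x \<bullet> \<xi>) * complex_of_real (gauss (e *\<^sub>R \<xi>))) \<partial>lborel)
    = complex_of_real (gauss_mass TYPE('n)) * (\<integral>y. h (x + e *\<^sub>R y) * complex_of_real (gauss y) \<partial>lborel)"
proof -
  let ?T = "gauss_mass TYPE('n)"
  let ?G = "\<lambda>\<xi>::real^'n. cis (x \<bullet> \<xi>) * complex_of_real (gauss (e *\<^sub>R \<xi>))"
  have [measurable]: "h \<in> borel_measurable borel" using h by auto
  have G: "integrable lborel ?G"
    by (rule integrable_cis_mult[OF integrable_gauss_scaled]) (use e in auto)
  have "(\<integral>\<xi>. fourier_int h \<xi> * ?G \<xi> \<partial>lborel) = (\<integral>y. h y * fourier_int ?G y \<partial>lborel)"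
    by (rule fourier_int_swap[symmetric]) (use h G in auto)
  also have "\<dots> = (\<integral>y. h y * complex_of_real (?T * gauss ((1 / e) *\<^sub>R (x - y)) / e ^ CARD('n)) \<partial>lborel)"
  proof (rule arg_cong[where f="\<lambda>k. integral\<^sup>L lborel k"], rule ext)
    fix y
    have "fourier_int ?G y = (\<integral>\<xi>. cis ((x - y) \<bullet> \<xi>) * complex_of_real (gauss (e *\<^sub>R \<xi>)) \<partial>lborel)"
      unfolding fourier_int_def
      by (simp add: inner_diff_left inner_diff_right inner_commute mult.assoc[symmetric] cis_mult)
    then show "h y * fourier_int ?G y = h y * complex_of_real (?T * gauss ((1 / e) *\<^sub>R (x - y)) / e ^ CARD('n))"
      by (simp only: integral_cis_gauss_scaled[OF e])
  qed
  also have "\<dots> = \<bar>e\<bar> ^ DIM(real^'n) *\<^sub>R (\<integral>y. h (x + e *\<^sub>R y) *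
      complex_of_real (?T * gauss ((1 / e) *\<^sub>R (x - (x + e *\<^sub>R y))) / e ^ CARD('n)) \<partial>lborel)"
    by (rule integral_lborel_affine) (use e in auto)
  also have "\<dots> = \<bar>e\<bar> ^ CARD('n) *\<^sub>R (\<integral>y. complex_of_real (?T / e ^ CARD('n)) *
     (h (x + e *\<^sub>R y) * complex_of_real (gauss y)) \<partial>lborel)"
    using e by (simp add: mult_ac)
  also have "\<dots> = complex_of_real (?T) * (\<integral>y. h (x + e *\<^sub>R y) * complex_of_real (gauss y) \<partial>lborel)"
    using e by (simp only: integral_mult_right_zero) (simp add: scaleR_conv_of_real)
  finally show ?thesis .
qed

lemma gauss_average_tendsto:
  fixes c :: "'n::finite sfield"
  assumes [measurable]: "c \<in> borel_measurable borel" and B: "\<And>x. norm (c x) \<le> B" and x: "isCont c x"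
  shows "(\<lambda>n. \<integral>y. c (x + (1 / real (Suc n)) *\<^sub>R y) * complex_of_real (gauss y) \<partial>lborel)
     \<longlonglongrightarrow> c x * complex_of_real (gauss_mass TYPE('n))"
proof -
  have "(\<lambda>n. \<integral>y. c (x + (1 / real (Suc n)) *\<^sub>R y) * complex_of_real (gauss y) \<partial>lborel)
     \<longlonglongrightarrow> (\<integral>y. c x * complex_of_real (gauss (y::real^'n)) \<partial>lborel)"
  proof (rule integral_dominated_convergence[where w="\<lambda>y. B * gauss y"])
    show "integrable lborel (\<lambda>y::real^'n. B * gauss y)"
      by (simp add: integrable_gauss)
    show "AE y in lborel. (\<lambda>n. c (x + (1 / real (Suc n)) *\<^sub>R y) * complex_of_real (gauss y))
        \<longlonglongrightarrow> c x * complex_of_real (gauss y)"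
    proof (rule AE_I2)
      fix y :: "real^'n"
      have "(\<lambda>n. x + (1 / real (Suc n)) *\<^sub>R y) \<longlonglongrightarrow> x + 0 *\<^sub>R y"
        by (intro tendsto_intros LIMSEQ_Suc lim_1_over_n)
      then have "(\<lambda>n. c (x + (1 / real (Suc n)) *\<^sub>R y)) \<longlonglongrightarrow> c x"
        using isCont_tendsto_compose[OF x] by simp
      then show "(\<lambda>n. c (x + (1 / real (Suc n)) *\<^sub>R y) * complex_of_real (gauss y))
        \<longlonglongrightarrow> c x * complex_of_real (gauss y)"
        by (intro tendsto_intros)
    qed
    show "AE y in lborel. norm (c (x + (1 / real (Suc n)) *\<^sub>R y) * complex_of_real (gauss y)) \<le> B * gauss y" for n
      by (auto simp: norm_mult gauss_pos less_imp_le abs_of_pos intro!: mult_right_mono B)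
  qed measurable
  also have "(\<integral>y. c x * complex_of_real (gauss (y::real^'n)) \<partial>lborel) = c x * complex_of_real (gauss_mass TYPE('n))"
    by (simp add: integral_gauss)
  finally show ?thesis .
qed

text \<open>
  In the regularised formula the damping tends to one on the left, while on the right the averages of \<open>h\<close>
  concentrate at \<open>x\<close>.
\<close>

theorem fourier_inversion:
  fixes h :: "'n::finite sfield"
  assumes h: "integrable lborel h" and fh: "integrable lborel (fourier_int h)"
    and B: "\<And>x. norm (h x) \<le> B" and x: "isCont h x"
  shows "(\<integral>\<xi>. fourier_int h \<xi> * cis (x \<bullet> \<xi>) \<partial>lborel) = complex_of_real ((gauss_mass TYPE('n))\<^sup>2) * h x"
proof (rule LIMSEQ_unique)
  let ?e = "\<lambda>n. 1 / real (Suc n)"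
  let ?L = "\<lambda>n. (\<integral>\<xi>. fourier_int h \<xi> * (cis (x \<bullet> \<xi>) * complex_of_real (gauss (?e n *\<^sub>R \<xi>))) \<partial>lborel)"
  have [measurable]: "h \<in> borel_measurable borel" using h by auto
  show "?L \<longlonglongrightarrow> (\<integral>\<xi>. fourier_int h \<xi> * cis (x \<bullet> \<xi>) \<partial>lborel)"
  proof (rule integral_dominated_convergence[where w="\<lambda>\<xi>. norm (fourier_int h \<xi>)"])
    show "AE \<xi> in lborel. (\<lambda>n. fourier_int h \<xi> * (cis (x \<bullet> \<xi>) * complex_of_real (gauss (?e n *\<^sub>R \<xi>))))
        \<longlonglongrightarrow> fourier_int h \<xi> * cis (x \<bullet> \<xi>)"
    proof (rule AE_I2)
      fix \<xi> :: "real^'n"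
      have "(\<lambda>n. gauss (?e n *\<^sub>R \<xi>)) \<longlonglongrightarrow> exp (- (norm (0 *\<^sub>R \<xi>))\<^sup>2 / 2)"
        unfolding gauss_def by (intro tendsto_intros LIMSEQ_Suc lim_1_over_n) auto
      then have "(\<lambda>n. complex_of_real (gauss (?e n *\<^sub>R \<xi>))) \<longlonglongrightarrow> complex_of_real 1"
        by (intro tendsto_of_real) simp
      then have "(\<lambda>n. fourier_int h \<xi> * (cis (x \<bullet> \<xi>) * complex_of_real (gauss (?e n *\<^sub>R \<xi>))))
        \<longlonglongrightarrow> fourier_int h \<xi> * (cis (x \<bullet> \<xi>) * complex_of_real 1)"
        by (intro tendsto_mult tendsto_const)
      then show "(\<lambda>n. fourier_int h \<xi> * (cis (x \<bullet> \<xi>) * complex_of_real (gauss (?e n *\<^sub>R \<xi>))))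
        \<longlonglongrightarrow> fourier_int h \<xi> * cis (x \<bullet> \<xi>)"
        by simp
    qed
    show "AE \<xi> in lborel. norm (fourier_int h \<xi> * (cis (x \<bullet> \<xi>) * complex_of_real (gauss (?e n *\<^sub>R \<xi>))))
        \<le> norm (fourier_int h \<xi>)" for n
      by (auto simp: norm_mult abs_of_pos[OF gauss_pos] gauss_le_1 intro!: mult_left_le)
  qed (use fh in auto)
  have "?L = (\<lambda>n. complex_of_real (gauss_mass TYPE('n)) * (\<integral>y. h (x + ?e n *\<^sub>R y) * complex_of_real (gauss y) \<partial>lborel))"
    by (intro ext fourier_gauss_regularisation[OF h]) simp
  also have "\<dots> \<longlonglongrightarrow> complex_of_real (gauss_mass TYPE('n)) * (h x * complex_of_real (gauss_mass TYPE('n)))"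
    by (intro tendsto_mult tendsto_const gauss_average_tendsto[OF _ B x]) measurable
  finally show "?L \<longlonglongrightarrow> complex_of_real ((gauss_mass TYPE('n))\<^sup>2) * h x"
    by (simp add: power2_eq_square mult_ac)
qed

lemma gauss_average_pairing:
  fixes c h :: "'n::finite sfield"
  assumes [measurable]: "c \<in> borel_measurable borel" "h \<in> borel_measurable borel"
    and I: "\<And>z. integrable lborel (\<lambda>x. c x * h (x + z))"
    and M: "\<And>z. (\<integral>x. norm (c x * h (x + z)) \<partial>lborel) \<le> M"
  shows "(\<integral>x. c x * (\<integral>y. h (x + e *\<^sub>R y) * complex_of_real (gauss y) \<partial>lborel) \<partial>lborel)
    = (\<integral>y. complex_of_real (gauss y) * (\<integral>x. c x * h (x + e *\<^sub>R y) \<partial>lborel) \<partial>lborel)"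
proof -
  let ?F = "\<lambda>y x. complex_of_real (gauss y) * (c x * h (x + e *\<^sub>R y))"
  have J: "integrable (lborel \<Otimes>\<^sub>M lborel) (\<lambda>(y, x). ?F y x)"
  proof (rule lborel_pair.Fubini_integrable)
    show "(\<lambda>(y, x). ?F y x) \<in> borel_measurable (lborel \<Otimes>\<^sub>M lborel)"
      unfolding split_beta' by measurable
    have "integrable lborel (\<lambda>y. \<integral>x. norm (?F y x) \<partial>lborel)"
    proof (rule Bochner_Integration.integrable_bound)
      show "integrable lborel (\<lambda>y::real^'n. gauss y * M)"
        by (simp add: integrable_gauss)
      show "(\<lambda>y. \<integral>x. norm (?F y x) \<partial>lborel) \<in> borel_measurable lborel"
        by (rule lborel.borel_measurable_lebesgue_integral) measurable
      show "AE y in lborel. norm (\<integral>x. norm (?F y x) \<partial>lborel) \<le> norm (gauss y * M)"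
      proof (rule AE_I2)
        fix y
        have "(\<integral>x. norm (?F y x) \<partial>lborel) = gauss y * (\<integral>x. norm (c x * h (x + e *\<^sub>R y)) \<partial>lborel)"
          by (simp add: norm_mult gauss_pos abs_of_pos)
        moreover have "\<dots> \<le> gauss y * M"
          using M[of "e *\<^sub>R y"] gauss_pos[of y] by simp
        moreover have "0 \<le> (\<integral>x. norm (?F y x) \<partial>lborel)" by simp
        ultimately show "norm (\<integral>x. norm (?F y x) \<partial>lborel) \<le> norm (gauss y * M)"
          unfolding real_norm_def by linarith
      qed
    qed
    then show "integrable lborel (\<lambda>y. \<integral>x. norm (case (y, x) of (y, x) \<Rightarrow> ?F y x) \<partial>lborel)"
      by simp
    show "AE y in lborel. integrable lborel (\<lambda>x. case (y, x) of (y, x) \<Rightarrow> ?F y x)"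
      using I by simp
  qed
  have "(\<integral>x. c x * (\<integral>y. h (x + e *\<^sub>R y) * complex_of_real (gauss y) \<partial>lborel) \<partial>lborel)
    = (\<integral>x. (\<integral>y. c x * (h (x + e *\<^sub>R y) * complex_of_real (gauss y)) \<partial>lborel) \<partial>lborel)"
    by (simp only: integral_mult_right_zero)
  also have "\<dots> = (\<integral>x. (\<integral>y. ?F y x \<partial>lborel) \<partial>lborel)"
    by (simp add: mult_ac)
  also have "\<dots> = (\<integral>y. (\<integral>x. ?F y x \<partial>lborel) \<partial>lborel)"
    by (rule lborel_pair.Fubini_integral) (rule J)
  finally show ?thesis
    by (simp only: integral_mult_right_zero)
qed

lemma integrable_square_imp_product:
  fixes f g :: "'a \<Rightarrow> 'b::{real_normed_field, banach, second_countable_topology}"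
  assumes [measurable]: "f \<in> borel_measurable M" "g \<in> borel_measurable M"
    and f: "integrable M (\<lambda>x. (norm (f x))\<^sup>2)" and g: "integrable M (\<lambda>x. (norm (g x))\<^sup>2)"
  shows "integrable M (\<lambda>x. f x * g x)"
    and "(\<integral>x. norm (f x * g x) \<partial>M) \<le> ((\<integral>x. (norm (f x))\<^sup>2 \<partial>M) + (\<integral>x. (norm (g x))\<^sup>2 \<partial>M)) / 2"
proof -
  let ?w = "\<lambda>x. ((norm (f x))\<^sup>2 + (norm (g x))\<^sup>2) / 2"
  have w: "integrable M ?w" using f g by simp
  have le: "norm (f x * g x) \<le> ?w x" for x
    using sum_squares_bound[of "norm (f x)" "norm (g x)"] by (simp add: norm_mult)
  show I: "integrable M (\<lambda>x. f x * g x)"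
    by (rule Bochner_Integration.integrable_bound[OF w]) (use le in \<open>auto intro: order_trans\<close>)
  have "(\<integral>x. norm (f x * g x) \<partial>M) \<le> (\<integral>x. ?w x \<partial>M)"
    by (rule integral_mono) (use I w le in auto)
  then show "(\<integral>x. norm (f x * g x) \<partial>M) \<le> ((\<integral>x. (norm (f x))\<^sup>2 \<partial>M) + (\<integral>x. (norm (g x))\<^sup>2 \<partial>M)) / 2"
    using f g by simp
qed

text \<open>
  Write $|\hat h|^2$ as $\hat h$ times its conjugate, and insert the Gaussian factor. The regularised
  inversion formula then expresses the integral as a Gaussian average, over $z$, of the correlations
  $\int\overline{h(x)}h(x+z)\,dx$, each of which is at most $\int|h|^2$. Fatou's lemma removes the factor.
  The constant is sharp; this is what lets \<open>Plancherel\<close> below deduce an equality from the bounds for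
  the transform and its inverse.
\<close>

theorem fourier_int_L2_bound:
  fixes h :: "'n::finite sfield"
  assumes h: "integrable lborel h" and h2: "integrable lborel (\<lambda>x. (norm (h x))\<^sup>2)"
  shows "integrable lborel (\<lambda>\<xi>. (norm (fourier_int h \<xi>))\<^sup>2)"
    and "(\<integral>\<xi>. (norm (fourier_int h \<xi>))\<^sup>2 \<partial>lborel) \<le> (gauss_mass TYPE('n))\<^sup>2 * (\<integral>x. (norm (h x))\<^sup>2 \<partial>lborel)"
proof -
  let ?T = "gauss_mass TYPE('n)"
  let ?N = "\<integral>x. (norm (h x))\<^sup>2 \<partial>lborel"
  let ?e = "\<lambda>n. 1 / real (Suc n)"
  have [measurable]: "h \<in> borel_measurable borel" using h by auto
  have shift2: "integrable lborel (\<lambda>x. (norm (h (x + z)))\<^sup>2)" for z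
    using integrable_lborel_shift[OF h2] .
  have prod: "integrable lborel (\<lambda>x. cnj (h x) * h (x + z))"
    "(\<integral>x. norm (cnj (h x) * h (x + z)) \<partial>lborel) \<le> ?N" for z
  proof -
    show "integrable lborel (\<lambda>x. cnj (h x) * h (x + z))"
      by (rule integrable_square_imp_product) (use h2 shift2 in auto)
    have "(\<integral>x. norm (cnj (h x) * h (x + z)) \<partial>lborel) \<le>
       ((\<integral>x. (norm (cnj (h x)))\<^sup>2 \<partial>lborel) + (\<integral>x. (norm (h (x + z)))\<^sup>2 \<partial>lborel)) / 2"
      by (rule integrable_square_imp_product) (use h2 shift2 in auto)
    also have "(\<integral>x. (norm (h (x + z)))\<^sup>2 \<partial>lborel) = ?N"
      by (rule integral_lborel_shift) measurable
    finally show "(\<integral>x. norm (cnj (h x) * h (x + z)) \<partial>lborel) \<le> ?N"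
      by simp
  qed
  have bound: "(\<integral>\<^sup>+\<xi>. ennreal ((norm (fourier_int h \<xi>))\<^sup>2 * gauss (?e n *\<^sub>R \<xi>)) \<partial>lborel) \<le> ennreal (?T\<^sup>2 * ?N)" for n
  proof -
    let ?f = "\<lambda>\<xi>. fourier_int h \<xi> * complex_of_real (gauss (?e n *\<^sub>R \<xi>))"
    have f: "integrable lborel ?f"
      by (rule integrable_bounded_mult[OF integrable_gauss_scaled _ norm_fourier_int_le]) auto
    have cf: "integrable lborel (\<lambda>\<xi>. ?f \<xi> * cnj (fourier_int h \<xi>))"
      by (subst mult.commute, rule integrable_bounded_mult[OF f, where B="\<integral>x. norm (h x) \<partial>lborel"])
         (auto simp: norm_fourier_int_le)
    have eq: "?f \<xi> * cnj (fourier_int h \<xi>) = complex_of_real ((norm (fourier_int h \<xi>))\<^sup>2 * gauss (?e n *\<^sub>R \<xi>))" for \<xi>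
      by (simp add: complex_norm_square mult_ac del: of_real_power)
    have int: "integrable lborel (\<lambda>\<xi>. (norm (fourier_int h \<xi>))\<^sup>2 * gauss (?e n *\<^sub>R \<xi>))"
      using cf unfolding eq by (simp only: complex_of_real_integrable_eq)
    have cnj: "cnj (fourier_int h \<xi>) = (\<integral>x. cis (x \<bullet> \<xi>) * cnj (h x) \<partial>lborel)" for \<xi>
      unfolding fourier_int_def by (subst Bochner_Integration.integral_cnj[symmetric]) (simp add: cis_cnj)
    have "complex_of_real (\<integral>\<xi>. (norm (fourier_int h \<xi>))\<^sup>2 * gauss (?e n *\<^sub>R \<xi>) \<partial>lborel)
      = (\<integral>\<xi>. ?f \<xi> * cnj (fourier_int h \<xi>) \<partial>lborel)"
      unfolding eq by (rule integral_complex_of_real[symmetric])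
    also have "\<dots> = (\<integral>x. cnj (h x) * (\<integral>\<xi>. cis (x \<bullet> \<xi>) * ?f \<xi> \<partial>lborel) \<partial>lborel)"
      unfolding cnj by (rule integral_kernel_commute) (use h f in auto)
    also have "\<dots> = (\<integral>x. complex_of_real ?T * (cnj (h x) *
         (\<integral>y. h (x + ?e n *\<^sub>R y) * complex_of_real (gauss y) \<partial>lborel)) \<partial>lborel)"
    proof (rule arg_cong[where f="\<lambda>k. integral\<^sup>L lborel k"], rule ext)
      fix x
      have "(\<integral>\<xi>. cis (x \<bullet> \<xi>) * ?f \<xi> \<partial>lborel) =
        (\<integral>\<xi>. fourier_int h \<xi> * (cis (x \<bullet> \<xi>) * complex_of_real (gauss (?e n *\<^sub>R \<xi>))) \<partial>lborel)"
        by (simp add: mult_ac)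
      also have "\<dots> = complex_of_real ?T * (\<integral>y. h (x + ?e n *\<^sub>R y) * complex_of_real (gauss y) \<partial>lborel)"
        by (rule fourier_gauss_regularisation[OF h]) simp
      finally show "cnj (h x) * (\<integral>\<xi>. cis (x \<bullet> \<xi>) * ?f \<xi> \<partial>lborel) =
         complex_of_real ?T * (cnj (h x) * (\<integral>y. h (x + ?e n *\<^sub>R y) * complex_of_real (gauss y) \<partial>lborel))"
        by (simp only: mult_ac)
    qed
    also have "\<dots> = complex_of_real ?T * (\<integral>x. cnj (h x) *
         (\<integral>y. h (x + ?e n *\<^sub>R y) * complex_of_real (gauss y) \<partial>lborel) \<partial>lborel)"
      by (rule integral_mult_right_zero)
    also have "\<dots> = complex_of_real ?T *
        (\<integral>y. complex_of_real (gauss y) * (\<integral>x. cnj (h x) * h (x + ?e n *\<^sub>R y) \<partial>lborel) \<partial>lborel)"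
      by (subst gauss_average_pairing[where M="?N"]) (use prod in auto)
    finally have main: "complex_of_real (\<integral>\<xi>. (norm (fourier_int h \<xi>))\<^sup>2 * gauss (?e n *\<^sub>R \<xi>) \<partial>lborel) = \<dots>" .
    have "(\<integral>\<xi>. (norm (fourier_int h \<xi>))\<^sup>2 * gauss (?e n *\<^sub>R \<xi>) \<partial>lborel)
      \<le> norm (complex_of_real (\<integral>\<xi>. (norm (fourier_int h \<xi>))\<^sup>2 * gauss (?e n *\<^sub>R \<xi>) \<partial>lborel))"
      by simp
    also have "\<dots> = ?T * norm (\<integral>y. complex_of_real (gauss y) * (\<integral>x. cnj (h x) * h (x + ?e n *\<^sub>R y) \<partial>lborel) \<partial>lborel)"
      unfolding main by (simp add: norm_mult less_imp_le)
    also have "\<dots> \<le> ?T * (\<integral>y. gauss (y::real^'n) * ?N \<partial>lborel)"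
    proof -
      let ?q = "\<lambda>y::real^'n. complex_of_real (gauss y) * (\<integral>x. cnj (h x) * h (x + ?e n *\<^sub>R y) \<partial>lborel)"
      have le: "norm (?q y) \<le> gauss y * ?N" for y
      proof -
        have "norm (\<integral>x. cnj (h x) * h (x + ?e n *\<^sub>R y) \<partial>lborel) \<le> ?N"
          by (rule order_trans[OF integral_norm_bound prod(2)])
        then show ?thesis
          using gauss_pos[of y] by (simp add: norm_mult abs_of_pos)
      qed
      have *: "integrable lborel (\<lambda>y::real^'n. gauss y * ?N)"
        by (simp add: integrable_gauss)
      have q: "integrable lborel ?q"
      proof (rule Bochner_Integration.integrable_bound[OF *])
        show "?q \<in> borel_measurable lborel"
          by (intro borel_measurable_times lborel.borel_measurable_lebesgue_integral) measurable
        show "AE y in lborel. norm (?q y) \<le> norm (gauss y * ?N)"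
          by (intro AE_I2 order_trans[OF le]) simp
      qed
      have "norm (integral\<^sup>L lborel ?q) \<le> (\<integral>y. gauss (y::real^'n) * ?N \<partial>lborel)"
        by (rule Bochner_Integration.integral_norm_bound_integral[OF q * le])
      then show ?thesis
        by (rule mult_left_mono) (simp add: less_imp_le)
    qed
    also have "\<dots> = ?T\<^sup>2 * ?N"
      by (simp add: integral_gauss power2_eq_square)
    finally have "(\<integral>\<xi>. (norm (fourier_int h \<xi>))\<^sup>2 * gauss (?e n *\<^sub>R \<xi>) \<partial>lborel) \<le> ?T\<^sup>2 * ?N" .
    then show ?thesis
      by (subst nn_integral_eq_integral[OF int]) (auto simp: gauss_pos less_imp_le intro: ennreal_leI)
  qed
  have lim: "(\<lambda>n. ennreal ((norm (fourier_int h \<xi>))\<^sup>2 * gauss (?e n *\<^sub>R \<xi>))) \<longlonglongrightarrow> ennreal ((norm (fourier_int h \<xi>))\<^sup>2)" for \<xi>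
  proof -
    have "(\<lambda>n. gauss (?e n *\<^sub>R \<xi>)) \<longlonglongrightarrow> exp (- (norm (0 *\<^sub>R \<xi>))\<^sup>2 / 2)"
      unfolding gauss_def by (intro tendsto_intros LIMSEQ_Suc lim_1_over_n) auto
    then have "(\<lambda>n. (norm (fourier_int h \<xi>))\<^sup>2 * gauss (?e n *\<^sub>R \<xi>)) \<longlonglongrightarrow> (norm (fourier_int h \<xi>))\<^sup>2 * exp (- (norm (0 *\<^sub>R \<xi>))\<^sup>2 / 2)"
      by (intro tendsto_intros)
    then show ?thesis
      by (intro tendsto_ennrealI) simp
  qed
  have le: "(\<integral>\<^sup>+\<xi>. ennreal ((norm (fourier_int h \<xi>))\<^sup>2) \<partial>lborel) \<le> ennreal (?T\<^sup>2 * ?N)"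
  proof -
    have "(\<integral>\<^sup>+\<xi>. ennreal ((norm (fourier_int h \<xi>))\<^sup>2) \<partial>lborel)
      = (\<integral>\<^sup>+\<xi>. liminf (\<lambda>n. ennreal ((norm (fourier_int h \<xi>))\<^sup>2 * gauss (?e n *\<^sub>R \<xi>))) \<partial>lborel)"
      by (intro nn_integral_cong) (simp only: lim_imp_Liminf[OF _ lim] trivial_limit_sequentially not_False_eq_True)
    also have "\<dots> \<le> liminf (\<lambda>n. \<integral>\<^sup>+\<xi>. ennreal ((norm (fourier_int h \<xi>))\<^sup>2 * gauss (?e n *\<^sub>R \<xi>)) \<partial>lborel)"
      by (rule nn_integral_liminf) measurable
    also have "\<dots> \<le> liminf (\<lambda>n::nat. ennreal (?T\<^sup>2 * ?N))"
      by (intro Liminf_mono always_eventually allI bound)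
    finally show ?thesis
      by (simp add: Liminf_const)
  qed
  show I: "integrable lborel (\<lambda>\<xi>. (norm (fourier_int h \<xi>))\<^sup>2)"
    by (rule integrableI_bounded) (use le in \<open>auto simp: top_unique less_top[symmetric]\<close>)
  show "(\<integral>\<xi>. (norm (fourier_int h \<xi>))\<^sup>2 \<partial>lborel) \<le> ?T\<^sup>2 * ?N"
    using le by (subst (asm) nn_integral_eq_integral[OF I]) auto
qed

text \<open>
  Indicators of closed sets are bounded limits of continuous functions, and closed sets generate the Borel
  sets, so \<open>h\<close> has integral zero over every Borel set.
\<close>

lemma integral_continuous_zero_imp_AE_zero:
  fixes h :: "'n::finite sfield"
  assumes h: "integrable lborel h"
    and zero: "\<And>c::real^'n \<Rightarrow> real. continuous_on UNIV c \<Longrightarrow> (\<And>x. \<bar>c x\<bar> \<le> 1) \<Longrightarrow>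
       (\<integral>x. complex_of_real (c x) * h x \<partial>lborel) = 0"
  shows "AE x in lborel. h x = 0"
proof (rule sigma_finite_measure.density_zero[OF lborel.sigma_finite_measure_axioms h])
  have [measurable]: "h \<in> borel_measurable borel" using h by auto
  have I: "integrable lborel (\<lambda>x. indicat_real A x *\<^sub>R h x)" if "A \<in> sets borel" for A
    by (rule integrable_mult_indicator) (use h that in auto)
  have closed: "(\<integral>x. indicat_real F x *\<^sub>R h x \<partial>lborel) = 0" if F: "closed F" for F
  proof (cases "F = {}")
    case False
    let ?c = "\<lambda>n x. max 0 (1 - real n * infdist x F)"
    have [measurable]: "F \<in> sets borel" using F by auto
    have cm: "continuous_on UNIV (?c n)" for n
      by (intro continuous_intros)
    have [measurable]: "?c n \<in> borel_measurable borel" for n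
      by (rule borel_measurable_continuous_onI[OF cm])
    have c1: "\<bar>?c n x\<bar> \<le> 1" for n x
      by (simp add: infdist_nonneg)
    have "(\<lambda>n. \<integral>x. complex_of_real (?c n x) * h x \<partial>lborel) \<longlonglongrightarrow> (\<integral>x. indicat_real F x *\<^sub>R h x \<partial>lborel)"
    proof (rule integral_dominated_convergence[where w="\<lambda>x. norm (h x)"])
      show "AE x in lborel. (\<lambda>n. complex_of_real (?c n x) * h x) \<longlonglongrightarrow> indicat_real F x *\<^sub>R h x"
      proof (rule AE_I2)
        fix x
        have "(\<lambda>n. ?c n x) \<longlonglongrightarrow> indicat_real F x"
        proof (cases "x \<in> F")
          case True then show ?thesis by simp
        next
          case x: False
          then have pos: "0 < infdist x F"
            using F False by (metis in_closed_iff_infdist_zero infdist_nonneg order_le_less)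
          obtain n0 where n0: "1 / infdist x F < real n0" using reals_Archimedean2 by blast
          have "?c n x = 0" if "n0 \<le> n" for n
          proof -
            have "1 / infdist x F < real n" using n0 that by linarith
            then have "1 < real n * infdist x F" using pos by (simp add: field_simps)
            then show ?thesis by simp
          qed
          then have "eventually (\<lambda>n. ?c n x = 0) sequentially"
            by (auto simp: eventually_sequentially)
          then show ?thesis using x by (simp add: tendsto_eventually)
        qed
        then have "(\<lambda>n. complex_of_real (?c n x) * h x) \<longlonglongrightarrow> complex_of_real (indicat_real F x) * h x"
          by (intro tendsto_intros)
        then show "(\<lambda>n. complex_of_real (?c n x) * h x) \<longlonglongrightarrow> indicat_real F x *\<^sub>R h x"
          by (simp only: scaleR_conv_of_real)
      qed
      show "AE x in lborel. norm (complex_of_real (?c n x) * h x) \<le> norm (h x)" for n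
      proof (rule AE_I2)
        fix x
        have "\<bar>?c n x\<bar> * norm (h x) \<le> 1 * norm (h x)"
          by (rule mult_right_mono[OF c1]) simp
        then show "norm (complex_of_real (?c n x) * h x) \<le> norm (h x)"
          by (simp only: norm_mult norm_of_real mult_1)
      qed
    qed (use h in auto)
    then have "(\<lambda>n. 0) \<longlonglongrightarrow> (\<integral>x. indicat_real F x *\<^sub>R h x \<partial>lborel)"
      by (simp only: zero[OF cm c1])
    then show ?thesis
      by (simp add: LIMSEQ_const_iff)
  qed simp
  fix A :: "(real^'n) set" assume "A \<in> sets lborel"
  then have A: "A \<in> sigma_sets UNIV (Collect closed)"
    by (simp add: borel_eq_closed)
  have G: "Int_stable (Collect (closed :: (real^'n) set \<Rightarrow> bool))" "Collect (closed :: (real^'n) set \<Rightarrow> bool) \<subseteq> Pow UNIV"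
    by (auto simp: Int_stable_def)
  from G A have "(\<integral>x. indicat_real A x *\<^sub>R h x \<partial>lborel) = 0 \<and> A \<in> sets borel"
  proof (induction rule: sigma_sets_induct_disjoint)
    case (basic A)
    then show ?case using closed by auto
  next
    case (compl A)
    then have [measurable]: "A \<in> sets borel" by simp
    have "(\<integral>x. indicat_real (UNIV - A) x *\<^sub>R h x \<partial>lborel) =
        (\<integral>x. indicat_real UNIV x *\<^sub>R h x - indicat_real A x *\<^sub>R h x \<partial>lborel)"
      by (intro Bochner_Integration.integral_cong) (auto simp: indicator_def)
    also have "\<dots> = 0"
      using closed[of UNIV] compl I[of UNIV] I[of A] by (subst Bochner_Integration.integral_diff) auto
    finally show ?case by auto
  next
    case (union A)
    then have A[measurable]: "\<And>i. A i \<in> sets borel" by blast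
    have "(\<Sum>i. set_lebesgue_integral lborel (A i) h) = set_lebesgue_integral lborel (\<Union>i. A i) h"
      by (rule lebesgue_integral_countable_add[symmetric])
         (use union A I[of "\<Union>i. A i"] in \<open>auto simp: disjoint_family_on_def set_integrable_def\<close>)
    then show ?case
      using union A by (simp add: set_lebesgue_integral_def sets.countable_UN)
  qed auto
  then show "set_lebesgue_integral lborel A h = 0"
    by (simp add: set_lebesgue_integral_def)
qed

text \<open>
  By the regularised inversion formula all Gaussian averages of \<open>h\<close> vanish. Paired with a continuous
  function \<open>c\<close>, the averaging can be moved from \<open>h\<close> to \<open>c\<close>, where it converges to the identity as the
  width tends to zero.
\<close>

theorem fourier_int_eq_0_imp_AE_zero:
  fixes h :: "'n::finite sfield"
  assumes h: "integrable lborel h" and zero: "\<And>\<xi>. fourier_int h \<xi> = 0"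
  shows "AE x in lborel. h x = 0"
proof (rule integral_continuous_zero_imp_AE_zero[OF h])
  let ?T = "gauss_mass TYPE('n)"
  let ?e = "\<lambda>n. 1 / real (Suc n)"
  have hm[measurable]: "h \<in> borel_measurable borel" using h by auto
  fix c :: "real^'n \<Rightarrow> real" assume c: "continuous_on UNIV c" and c1: "\<And>x. \<bar>c x\<bar> \<le> 1"
  have [measurable]: "c \<in> borel_measurable borel"
    by (rule borel_measurable_continuous_onI[OF c])
  have av: "(\<integral>y. h (x + ?e n *\<^sub>R y) * complex_of_real (gauss y) \<partial>lborel) = 0" for x n
    using fourier_gauss_regularisation[OF h, of "?e n" x] zero gauss_mass_pos[where 'n='n] by simp
  have I: "integrable lborel (\<lambda>x. complex_of_real (c x) * h (x + z))" for z
    by (rule integrable_bounded_mult[OF integrable_lborel_shift[OF h]]) (use c1 in auto)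
  have M: "(\<integral>x. norm (complex_of_real (c x) * h (x + z)) \<partial>lborel) \<le> (\<integral>x. norm (h x) \<partial>lborel)" for z
  proof -
    have "(\<integral>x. norm (complex_of_real (c x) * h (x + z)) \<partial>lborel) \<le> (\<integral>x. norm (h (x + z)) \<partial>lborel)"
      by (rule integral_mono[OF integrable_norm[OF I] integrable_norm[OF integrable_lborel_shift[OF h]]])
         (use c1 in \<open>auto simp: norm_mult mult_left_le_one_le\<close>)
    then show ?thesis
      by (subst (asm) integral_lborel_shift) auto
  qed
  have D: "(\<integral>y. complex_of_real (gauss y) * (\<integral>x. complex_of_real (c x) * h (x + ?e n *\<^sub>R y) \<partial>lborel) \<partial>lborel) = 0" for n
    by (subst gauss_average_pairing[OF _ hm I M, symmetric]) (simp_all only: av, simp_all)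
  have D': "(\<integral>x. complex_of_real (c x) * h (x + z) \<partial>lborel) = (\<integral>x. complex_of_real (c (x - z)) * h x \<partial>lborel)" for z
    using integral_lborel_shift[of "\<lambda>x. complex_of_real (c (x - z)) * h x" z] by simp
  have in_lim: "(\<lambda>n. \<integral>x. complex_of_real (c (x - ?e n *\<^sub>R y)) * h x \<partial>lborel) \<longlonglongrightarrow> (\<integral>x. complex_of_real (c x) * h x \<partial>lborel)" for y
  proof (rule integral_dominated_convergence[where w="\<lambda>x. norm (h x)"])
    show "AE x in lborel. (\<lambda>n. complex_of_real (c (x - ?e n *\<^sub>R y)) * h x) \<longlonglongrightarrow> complex_of_real (c x) * h x"
    proof (rule AE_I2)
      fix x
      have "isCont c x" using c by (simp add: continuous_on_eq_continuous_at)
      moreover have "(\<lambda>n. x - ?e n *\<^sub>R y) \<longlonglongrightarrow> x - 0 *\<^sub>R y"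
        by (intro tendsto_intros LIMSEQ_Suc lim_1_over_n)
      ultimately have "(\<lambda>n. c (x - ?e n *\<^sub>R y)) \<longlonglongrightarrow> c x"
        using isCont_tendsto_compose[of x c] by simp
      then show "(\<lambda>n. complex_of_real (c (x - ?e n *\<^sub>R y)) * h x) \<longlonglongrightarrow> complex_of_real (c x) * h x"
        by (intro tendsto_intros)
    qed
    show "AE x in lborel. norm (complex_of_real (c (x - ?e n *\<^sub>R y)) * h x) \<le> norm (h x)" for n
      using c1 by (auto simp: norm_mult intro!: AE_I2 mult_left_le_one_le)
  qed (use h in auto)
  have "(\<lambda>n. \<integral>y. complex_of_real (gauss y) * (\<integral>x. complex_of_real (c (x - ?e n *\<^sub>R y)) * h x \<partial>lborel) \<partial>lborel)
     \<longlonglongrightarrow> (\<integral>y. complex_of_real (gauss (y::real^'n)) * (\<integral>x. complex_of_real (c x) * h x \<partial>lborel) \<partial>lborel)"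
  proof (rule integral_dominated_convergence[where w="\<lambda>y. gauss y * (\<integral>x. norm (h x) \<partial>lborel)"])
    show "integrable lborel (\<lambda>y::real^'n. gauss y * (\<integral>x. norm (h x) \<partial>lborel))"
      by (simp add: integrable_gauss)
    show "AE y in lborel. (\<lambda>n. complex_of_real (gauss y) * (\<integral>x. complex_of_real (c (x - ?e n *\<^sub>R y)) * h x \<partial>lborel))
      \<longlonglongrightarrow> complex_of_real (gauss y) * (\<integral>x. complex_of_real (c x) * h x \<partial>lborel)"
      by (intro AE_I2 tendsto_mult tendsto_const in_lim)
    show "AE y in lborel. norm (complex_of_real (gauss y) * (\<integral>x. complex_of_real (c (x - ?e n *\<^sub>R y)) * h x \<partial>lborel))
       \<le> gauss y * (\<integral>x. norm (h x) \<partial>lborel)" for n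
    proof (rule AE_I2)
      fix y
      have "norm (\<integral>x. complex_of_real (c x) * h (x + ?e n *\<^sub>R y) \<partial>lborel) \<le> (\<integral>x. norm (h x) \<partial>lborel)"
        by (rule order_trans[OF integral_norm_bound M])
      then show "norm (complex_of_real (gauss y) * (\<integral>x. complex_of_real (c (x - ?e n *\<^sub>R y)) * h x \<partial>lborel))
       \<le> gauss y * (\<integral>x. norm (h x) \<partial>lborel)"
        unfolding D' using gauss_pos[of y] by (simp add: norm_mult abs_of_pos)
    qed
  next
    show "(\<lambda>y. complex_of_real (gauss y) * (\<integral>x. complex_of_real (c (x - ?e n *\<^sub>R y)) * h x \<partial>lborel)) \<in> borel_measurable lborel" for n
      by (intro borel_measurable_times lborel.borel_measurable_lebesgue_integral) measurable
  qed measurable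
  then have "(\<lambda>n. 0) \<longlonglongrightarrow> (\<integral>y. complex_of_real (gauss (y::real^'n)) * (\<integral>x. complex_of_real (c x) * h x \<partial>lborel) \<partial>lborel)"
    by (simp only: D'[symmetric] D)
  then have "complex_of_real ?T * (\<integral>x. complex_of_real (c x) * h x \<partial>lborel) = 0"
    by (simp add: integral_gauss LIMSEQ_const_iff)
  then show "(\<integral>x. complex_of_real (c x) * h x \<partial>lborel) = 0"
    using gauss_mass_pos[where 'n='n] by simp
qed

section \<open>Rapidly decreasing and tempered functions\<close>

text \<open>
  The decay of Schwartz functions without their smoothness. The transforms of test functions enter
  the definition of \<open>has_fourier\<close> only through their integrals against tempered functions, for which this
  decay suffices.
\<close>

definition rapid :: "'n::finite sfield \<Rightarrow> bool" where
  "rapid \<phi> \<longleftrightarrow> \<phi> \<in> borel_measurable borel \<and> (\<forall>k. \<exists>C. \<forall>x. (1 + norm x) ^ k * norm (\<phi> x) \<le> C)"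

lemma rapid_measurable: "rapid \<phi> \<Longrightarrow> \<phi> \<in> borel_measurable borel"
  by (simp add: rapid_def)

lemma one_plus_norm_power_pos [simp]: "0 < (1 + norm (x::'a::real_normed_vector)) ^ k"
  by (intro zero_less_power) (simp add: add_pos_nonneg)

lemma integrable_tempered_mult_rapid:
  fixes f \<phi> :: "'n::finite sfield"
  assumes f: "tempered_fun f" and \<phi>: "rapid \<phi>"
  shows "integrable lborel (\<lambda>x. f x * \<phi> x)"
proof -
  have [measurable]: "f \<in> borel_measurable borel" "\<phi> \<in> borel_measurable borel"
    using f \<phi> by (auto simp: tempered_fun_def rapid_def)
  obtain k where k: "integrable lborel (\<lambda>x. norm (f x) / (1 + norm x) ^ k)"
    using f by (auto simp: tempered_fun_def)
  obtain C where C: "\<And>x. (1 + norm x) ^ k * norm (\<phi> x) \<le> C"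
    using \<phi> unfolding rapid_def by blast
  show ?thesis
  proof (rule Bochner_Integration.integrable_bound)
    show "integrable lborel (\<lambda>x. C * (norm (f x) / (1 + norm x) ^ k))"
      using k by (intro integrable_mult_right)
    show "AE x in lborel. norm (f x * \<phi> x) \<le> norm (C * (norm (f x) / (1 + norm x) ^ k))"
    proof (rule AE_I2)
      fix x :: "real^'n"
      have p: "0 < (1 + norm x) ^ k" by simp
      have "norm (\<phi> x) \<le> C / (1 + norm x) ^ k"
        using C[of x] p by (simp add: pos_le_divide_eq mult.commute)
      then have "norm (f x) * norm (\<phi> x) \<le> norm (f x) * (C / (1 + norm x) ^ k)"
        by (rule mult_left_mono) simp
      then have "norm (f x * \<phi> x) \<le> C * (norm (f x) / (1 + norm x) ^ k)"
        by (simp add: norm_mult mult_ac)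
      also have "\<dots> \<le> norm (C * (norm (f x) / (1 + norm x) ^ k))"
        unfolding real_norm_def by (rule abs_ge_self)
      finally show "norm (f x * \<phi> x) \<le> norm (C * (norm (f x) / (1 + norm x) ^ k))" .
    qed
  qed simp
qed

lemma rapid_bounded:
  assumes "rapid \<phi>" obtains B where "\<And>x. norm (\<phi> x) \<le> B"
proof -
  obtain C where "\<And>x. (1 + norm x) ^ 0 * norm (\<phi> x) \<le> C"
    using assms unfolding rapid_def by blast
  then show ?thesis by (intro that) simp
qed

lemma tempered_fun_bounded:
  fixes f :: "'n::finite sfield"
  assumes [measurable]: "f \<in> borel_measurable borel" and B: "\<And>x. norm (f x) \<le> B"
  shows "tempered_fun f"
  unfolding tempered_fun_def
proof (intro conjI exI)
  have "integrable lborel (\<lambda>x::real^'n. B * (1 / (1 + norm x) ^ (2 * CARD('n))))"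
    by (intro integrable_mult_right integrable_inverse_power)
  then show "integrable lborel (\<lambda>x. norm (f x) / (1 + norm x) ^ (2 * CARD('n)))"
    by (rule Bochner_Integration.integrable_bound)
       (use B in \<open>auto intro!: AE_I2 divide_right_mono order_trans[OF B]\<close>)
qed fact

lemma tempered_fun_integrable:
  fixes f :: "'n::finite sfield"
  assumes "integrable lborel f"
  shows "tempered_fun f"
  unfolding tempered_fun_def using assms by (intro conjI exI[of _ 0]) auto

lemma tempered_fun_square_integrable:
  fixes f :: "'n::finite sfield"
  assumes [measurable]: "f \<in> borel_measurable borel" and f: "integrable lborel (\<lambda>x. (norm (f x))\<^sup>2)"
  shows "tempered_fun f"
  unfolding tempered_fun_def
proof (intro conjI exI)
  have "integrable lborel (\<lambda>x. norm (f x) * (1 / (1 + norm x) ^ CARD('n)))"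
    by (rule integrable_square_imp_product)
       (use f integrable_inverse_power[where 'n='n] in \<open>auto simp: power_mult[symmetric] power_divide mult.commute\<close>)
  then show "integrable lborel (\<lambda>x. norm (f x) / (1 + norm x) ^ CARD('n))"
    by simp
qed fact

lemma tempered_fun_weaken:
  fixes f :: "'n::finite sfield"
  assumes [measurable]: "f \<in> borel_measurable borel"
    and k: "integrable lborel (\<lambda>x. norm (f x) / (1 + norm x) ^ k)" and "k \<le> m"
  shows "integrable lborel (\<lambda>x. norm (f x) / (1 + norm x) ^ m)"
  by (rule Bochner_Integration.integrable_bound[OF k])
     (use \<open>k \<le> m\<close> in \<open>auto intro!: AE_I2 divide_left_mono power_increasing mult_pos_pos\<close>)

lemma tempered_fun_diff:
  fixes f g :: "'n::finite sfield"
  assumes f: "tempered_fun f" and g: "tempered_fun g"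
  shows "tempered_fun (\<lambda>x. f x - g x)"
proof -
  have [measurable]: "f \<in> borel_measurable borel" "g \<in> borel_measurable borel"
    using assms by (auto simp: tempered_fun_def)
  obtain k l where k: "integrable lborel (\<lambda>x. norm (f x) / (1 + norm x) ^ k)"
     and l: "integrable lborel (\<lambda>x. norm (g x) / (1 + norm x) ^ l)"
    using assms by (auto simp: tempered_fun_def)
  have "integrable lborel (\<lambda>x. norm (f x) / (1 + norm x) ^ max k l + norm (g x) / (1 + norm x) ^ max k l)"
    using tempered_fun_weaken[OF _ k, of "max k l"] tempered_fun_weaken[OF _ l, of "max k l"] by auto
  then have "integrable lborel (\<lambda>x. norm (f x - g x) / (1 + norm x) ^ max k l)"
    by (rule Bochner_Integration.integrable_bound)
       (auto intro!: AE_I2 simp: add_divide_distrib[symmetric] divide_right_mono norm_triangle_ineq4)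
  then show ?thesis
    unfolding tempered_fun_def by (intro conjI exI[of _ "max k l"]) auto
qed

lemma tempered_fun_conj_reflect:
  fixes f :: "'n::finite sfield"
  assumes f: "tempered_fun f"
  shows "tempered_fun (\<lambda>x. cnj (f x))" "tempered_fun (\<lambda>x. cnj (f (- x)))"
proof -
  have [measurable]: "f \<in> borel_measurable borel"
    using assms by (auto simp: tempered_fun_def)
  obtain k where k: "integrable lborel (\<lambda>x. norm (f x) / (1 + norm x) ^ k)"
    using assms by (auto simp: tempered_fun_def)
  show "tempered_fun (\<lambda>x. cnj (f x))" "tempered_fun (\<lambda>x. cnj (f (- x)))"
    unfolding tempered_fun_def
    using k integrable_lborel_uminus[OF k] by (auto intro!: exI[of _ k])
qed

section \<open>Schwartz functions\<close>

lemma schwartz_partial_deriv: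
  assumes "schwartz \<phi>" shows "schwartz (partial_deriv j \<phi>)"
  unfolding schwartz_def
proof (intro allI)
  fix js k
  have eq: "foldr partial_deriv js (partial_deriv j \<phi>) = foldr partial_deriv (js @ [j]) \<phi>"
    by simp
  show "(\<forall>x. foldr partial_deriv js (partial_deriv j \<phi>) differentiable at x) \<and>
    bounded (range (\<lambda>x. (1 + norm x) ^ k *\<^sub>R foldr partial_deriv js (partial_deriv j \<phi>) x))"
    unfolding eq using assms unfolding schwartz_def by blast
qed

lemma schwartz_differentiable: "schwartz \<phi> \<Longrightarrow> \<phi> differentiable at x"
  unfolding schwartz_def by (metis foldr_Nil id_apply)

lemma schwartz_isCont: "schwartz \<phi> \<Longrightarrow> isCont \<phi> x"
  using schwartz_differentiable differentiable_imp_continuous_within by blast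

lemma schwartz_rapid:
  assumes "schwartz \<phi>" shows "rapid \<phi>"
  unfolding rapid_def
proof (intro conjI allI)
  show "\<phi> \<in> borel_measurable borel"
    by (rule borel_measurable_continuous_onI)
       (use schwartz_isCont[OF assms] in \<open>simp add: continuous_at_imp_continuous_on\<close>)
  fix k
  have "bounded (range (\<lambda>x. (1 + norm x) ^ k *\<^sub>R foldr partial_deriv [] \<phi> x))"
    using assms unfolding schwartz_def by blast
  then show "\<exists>C. \<forall>x. (1 + norm x) ^ k * norm (\<phi> x) \<le> C"
    by (auto simp: bounded_iff)
qed

lemma rapid_integrable:
  fixes \<phi> :: "'n::finite sfield"
  assumes "rapid \<phi>" shows "integrable lborel \<phi>"
  using integrable_tempered_mult_rapid[OF tempered_fun_bounded[of "\<lambda>_. 1" 1] assms] by simp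

lemma difference_quotient_tendsto:
  fixes f :: "real \<Rightarrow> 'a::real_normed_vector"
  assumes "(f has_vector_derivative D) (at 0)"
  shows "(\<lambda>n. real (Suc n) *\<^sub>R (f (1 / real (Suc n)) - f 0)) \<longlonglongrightarrow> D"
proof -
  have "((\<lambda>y. norm ((f y - f 0) - y *\<^sub>R D) / norm y) \<longlongrightarrow> 0) (at 0)"
    using assms unfolding has_vector_derivative_def has_derivative_iff_norm by simp
  moreover have "filterlim (\<lambda>n. 1 / real (Suc n)) (at 0) sequentially"
    unfolding filterlim_at using LIMSEQ_Suc[OF lim_1_over_n] by (auto simp del: of_nat_Suc)
  ultimately have "(\<lambda>n. norm ((f (1 / real (Suc n)) - f 0) - (1 / real (Suc n)) *\<^sub>R D) / norm (1 / real (Suc n))) \<longlonglongrightarrow> 0"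
    by (rule filterlim_compose)
  also have "(\<lambda>n. norm ((f (1 / real (Suc n)) - f 0) - (1 / real (Suc n)) *\<^sub>R D) / norm (1 / real (Suc n)))
     = (\<lambda>n. norm (real (Suc n) *\<^sub>R (f (1 / real (Suc n)) - f 0) - D))"
  proof
    fix n
    have "real (Suc n) *\<^sub>R (f (1 / real (Suc n)) - f 0) - D
      = real (Suc n) *\<^sub>R ((f (1 / real (Suc n)) - f 0) - (1 / real (Suc n)) *\<^sub>R D)"
      by (simp add: scaleR_diff_right)
    then show "norm ((f (1 / real (Suc n)) - f 0) - (1 / real (Suc n)) *\<^sub>R D) / norm (1 / real (Suc n))
       = norm (real (Suc n) *\<^sub>R (f (1 / real (Suc n)) - f 0) - D)"
      by (simp only: norm_scaleR) simp
  qed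
  finally show ?thesis
    by (simp add: tendsto_norm_zero_iff LIM_zero_iff)
qed

lemma schwartz_directional_derivative:
  fixes \<phi> :: "'n::finite sfield"
  assumes "schwartz \<phi>"
  shows "((\<lambda>t. \<phi> (x + t *\<^sub>R axis j 1)) has_vector_derivative partial_deriv j \<phi> (x + t *\<^sub>R axis j 1)) (at t)"
proof -
  let ?y = "x + t *\<^sub>R axis j 1"
  have F: "(\<phi> has_derivative frechet_derivative \<phi> (at ?y)) (at ?y)"
    using schwartz_differentiable[OF assms] by (simp add: frechet_derivative_works)
  have "((\<lambda>t. x + t *\<^sub>R axis j 1) has_derivative (\<lambda>h. h *\<^sub>R axis j 1)) (at t)"
    by (auto intro!: derivative_eq_intros)
  from has_derivative_compose[OF this F]
  have "((\<lambda>t. \<phi> (x + t *\<^sub>R axis j 1)) has_derivative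
     (\<lambda>h. frechet_derivative \<phi> (at ?y) (h *\<^sub>R axis j 1))) (at t)" .
  then show ?thesis
    unfolding has_vector_derivative_def partial_deriv_def
    using F by (simp add: linear_cmul[OF has_derivative_linear])
qed

text \<open>
  Translation invariance of the Lebesgue integral takes the place of an integration by parts: both sides are
  the limit of the transforms of the difference quotients in direction \<open>j\<close>. On one side
  this is dominated convergence, on the other side the transform of a translate is a phase times the transform.
\<close>

lemma fourier_int_partial_deriv:
  fixes \<phi> :: "'n::finite sfield"
  assumes \<phi>: "schwartz \<phi>"
  shows "fourier_int (partial_deriv j \<phi>) \<xi> = \<i> * complex_of_real (\<xi> $ j) * fourier_int \<phi> \<xi>"
proof (rule LIMSEQ_unique)
  let ?r = "\<lambda>n. real (Suc n)"
  let ?e = "axis j 1 :: real^'n"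
  let ?D = "\<lambda>n x. ?r n *\<^sub>R (\<phi> (x + (1 / ?r n) *\<^sub>R ?e) - \<phi> x)"
  let ?L = "\<lambda>n. \<integral>x. cis (- (x \<bullet> \<xi>)) * ?D n x \<partial>lborel"
  have I: "integrable lborel \<phi>" and [measurable]: "\<phi> \<in> borel_measurable borel"
    using schwartz_rapid[OF \<phi>] rapid_integrable rapid_measurable by auto
  have [measurable]: "partial_deriv j \<phi> \<in> borel_measurable borel"
    using schwartz_rapid[OF schwartz_partial_deriv[OF \<phi>]] rapid_measurable by auto
  let ?k = "2 * CARD('n)"
  obtain C where C: "\<And>x. (1 + norm x) ^ ?k * norm (partial_deriv j \<phi> x) \<le> C"
    using schwartz_rapid[OF schwartz_partial_deriv[OF \<phi>]] unfolding rapid_def by blast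
  \<comment> \<open>The mean value theorem evaluates the derivative at distance at most one from \<open>x\<close>, where \<open>1 + norm\<close> is smaller by at most the factor 2.\<close>
  have bound: "norm (?D n x) \<le> 2 ^ ?k * C * (1 / (1 + norm x) ^ ?k)" for n x
  proof -
    let ?f = "\<lambda>t. \<phi> (x + t *\<^sub>R ?e)"
    have vd: "(?f has_vector_derivative partial_deriv j \<phi> (x + t *\<^sub>R ?e)) (at t)" for t
      by (rule schwartz_directional_derivative[OF \<phi>])
    have "\<exists>t\<in>{0<..<1 / ?r n}. norm (?f (1 / ?r n) - ?f 0) \<le> norm ((1 / ?r n - 0) *\<^sub>R partial_deriv j \<phi> (x + t *\<^sub>R ?e))"
    proof (rule mvt_general)
      show "continuous_on {0..1 / ?r n} ?f"
        using vd by (intro continuous_at_imp_continuous_on ballI has_vector_derivative_continuous) auto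
      show "(?f has_derivative (\<lambda>h. h *\<^sub>R partial_deriv j \<phi> (x + t *\<^sub>R ?e))) (at t)" for t
        using vd unfolding has_vector_derivative_def .
    qed simp
    then obtain t where t: "0 < t" "t < 1 / ?r n"
      and le: "norm (?f (1 / ?r n) - ?f 0) \<le> norm ((1 / ?r n - 0) *\<^sub>R partial_deriv j \<phi> (x + t *\<^sub>R ?e))"
      by auto
    have "1 / ?r n \<le> 1" by simp
    then have t1: "t \<le> 1" using t by linarith
    have "norm x \<le> norm (x + t *\<^sub>R ?e) + norm (t *\<^sub>R ?e)"
      by (metis add_diff_cancel norm_triangle_ineq4)
    moreover have "norm (t *\<^sub>R ?e) \<le> 1"
      using t t1 by simp
    moreover have "1 + a \<le> 2 * (1 + b)" if "a \<le> b + c" "c \<le> 1" "0 \<le> b" for a b c :: real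
      using that by simp
    ultimately have "1 + norm x \<le> 2 * (1 + norm (x + t *\<^sub>R ?e))"
      by (meson norm_ge_zero)
    then have pw: "(1 + norm x) ^ ?k \<le> 2 ^ ?k * (1 + norm (x + t *\<^sub>R ?e)) ^ ?k"
      unfolding power_mult_distrib[symmetric] by (rule power_mono) simp
    have "norm (?D n x) \<le> norm (partial_deriv j \<phi> (x + t *\<^sub>R ?e))"
      using mult_left_mono[OF le, of "?r n"] by simp
    moreover have "(1 + norm x) ^ ?k * norm (partial_deriv j \<phi> (x + t *\<^sub>R ?e)) \<le> 2 ^ ?k * C"
      using mult_right_mono[OF pw, of "norm (partial_deriv j \<phi> (x + t *\<^sub>R ?e))"] C[of "x + t *\<^sub>R ?e"]
      by (smt (verit) mult.assoc mult_left_mono norm_ge_zero zero_le_power)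
    then have "norm (partial_deriv j \<phi> (x + t *\<^sub>R ?e)) \<le> 2 ^ ?k * C / (1 + norm x) ^ ?k"
      by (simp add: pos_le_divide_eq mult.commute)
    ultimately show ?thesis by simp
  qed
  show "?L \<longlonglongrightarrow> fourier_int (partial_deriv j \<phi>) \<xi>"
    unfolding fourier_int_def
  proof (rule integral_dominated_convergence[where w="\<lambda>x. 2 ^ ?k * C * (1 / (1 + norm x) ^ ?k)"])
    show "integrable lborel (\<lambda>x::real^'n. 2 ^ ?k * C * (1 / (1 + norm x) ^ ?k))"
      by (intro integrable_mult_right integrable_inverse_power)
    show "AE x in lborel. (\<lambda>n. cis (- (x \<bullet> \<xi>)) * ?D n x) \<longlonglongrightarrow> cis (- (x \<bullet> \<xi>)) * partial_deriv j \<phi> x"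
    proof (intro AE_I2 tendsto_mult tendsto_const)
      fix x
      show "(\<lambda>n. ?D n x) \<longlonglongrightarrow> partial_deriv j \<phi> x"
        using difference_quotient_tendsto[OF schwartz_directional_derivative[OF \<phi>, of x j 0, simplified scaleR_zero_left add_0_right]]
        by simp
    qed
    show "AE x in lborel. norm (cis (- (x \<bullet> \<xi>)) * ?D n x) \<le> 2 ^ ?k * C * (1 / (1 + norm x) ^ ?k)" for n
      using bound[of n] by (intro AE_I2) (simp only: norm_mult norm_cis mult_1)
  qed measurable
  \<comment> \<open>The same transforms, computed from the transform of a translate.\<close>
  have "((\<lambda>t. exp (\<i> * of_real (\<xi> $ j) * complex_of_real t)) has_vector_derivative \<i> * of_real (\<xi> $ j)) (at 0)"
    by (rule has_vector_derivative_real_field) (auto intro!: derivative_eq_intros)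
  from difference_quotient_tendsto[OF this]
  have "(\<lambda>n. ?r n *\<^sub>R (cis (\<xi> $ j / ?r n) - 1)) \<longlonglongrightarrow> \<i> * of_real (\<xi> $ j)"
    by (simp add: cis_conv_exp)
  then have "(\<lambda>n. ?r n *\<^sub>R (cis (\<xi> $ j / ?r n) - 1) * fourier_int \<phi> \<xi>) \<longlonglongrightarrow> \<i> * of_real (\<xi> $ j) * fourier_int \<phi> \<xi>"
    by (intro tendsto_mult tendsto_const)
  moreover have "?L n = ?r n *\<^sub>R (cis (\<xi> $ j / ?r n) - 1) * fourier_int \<phi> \<xi>" for n
  proof -
    have J: "integrable lborel (\<lambda>x. cis (- (x \<bullet> \<xi>)) * \<phi> x)"
      by (rule integrable_cis_mult[OF I]) measurable
    have J': "integrable lborel (\<lambda>x. cis (- (x \<bullet> \<xi>)) * \<phi> (x + (1 / ?r n) *\<^sub>R ?e))"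
      by (rule integrable_cis_mult[OF integrable_lborel_shift[OF I]]) measurable
    have sh: "(\<integral>x. cis (- (x \<bullet> \<xi>)) * \<phi> (x + (1 / ?r n) *\<^sub>R ?e) \<partial>lborel) = cis (\<xi> $ j / ?r n) * fourier_int \<phi> \<xi>"
    proof -
      have "(\<integral>x. cis (- (x \<bullet> \<xi>)) * \<phi> (x + (1 / ?r n) *\<^sub>R ?e) \<partial>lborel) =
         (\<integral>x. cis (- ((x - (1 / ?r n) *\<^sub>R ?e) \<bullet> \<xi>)) * \<phi> x \<partial>lborel)"
        using integral_lborel_shift[of "\<lambda>x. cis (- ((x - (1 / ?r n) *\<^sub>R ?e) \<bullet> \<xi>)) * \<phi> x" "(1 / ?r n) *\<^sub>R ?e"]
        by simp
      also have "\<dots> = (\<integral>x. cis (\<xi> $ j / ?r n) * (cis (- (x \<bullet> \<xi>)) * \<phi> x) \<partial>lborel)"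
        by (intro Bochner_Integration.integral_cong refl)
           (simp add: inner_diff_left inner_axis' mult.assoc[symmetric] cis_mult)
      finally show ?thesis by (simp add: fourier_int_def)
    qed
    have "?L n = (\<integral>x. ?r n *\<^sub>R (cis (- (x \<bullet> \<xi>)) * \<phi> (x + (1 / ?r n) *\<^sub>R ?e) - cis (- (x \<bullet> \<xi>)) * \<phi> x) \<partial>lborel)"
      by (simp add: right_diff_distrib scaleR_conv_of_real mult_ac)
    also have "\<dots> = ?r n *\<^sub>R (cis (\<xi> $ j / ?r n) * fourier_int \<phi> \<xi> - fourier_int \<phi> \<xi>)"
      using J J' sh by (simp add: fourier_int_def)
    finally show ?thesis by (simp add: left_diff_distrib scaleR_conv_of_real right_diff_distrib)
  qed
  ultimately show "?L \<longlonglongrightarrow> \<i> * complex_of_real (\<xi> $ j) * fourier_int \<phi> \<xi>"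
    by simp
qed

text \<open>
  The transform of the $k$-th derivative in direction $j$ is bounded, that is, $|\xi_j|^k|\hat\phi(\xi)|$ is;
  and for some $j$ the number $|\xi_j|$ is at least $|\xi|/d$.
\<close>

lemma schwartz_rapid_fourier_int:
  fixes \<phi> :: "'n::finite sfield"
  assumes \<phi>: "schwartz \<phi>"
  shows "rapid (fourier_int \<phi>)"
  unfolding rapid_def
proof (intro conjI allI)
  show "fourier_int \<phi> \<in> borel_measurable borel"
    by (rule fourier_int_measurable[OF rapid_measurable[OF schwartz_rapid[OF \<phi>]]])
  fix k
  have it: "fourier_int (foldr partial_deriv (replicate k j) \<phi>) \<xi> = (\<i> * complex_of_real (\<xi> $ j)) ^ k * fourier_int \<phi> \<xi>
      \<and> schwartz (foldr partial_deriv (replicate k j) \<phi>)" for j \<xi>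
    by (induction k) (auto simp: \<phi> fourier_int_partial_deriv schwartz_partial_deriv mult_ac)
  obtain C0 where C0: "\<And>\<xi>. norm (fourier_int \<phi> \<xi>) \<le> C0"
    using norm_fourier_int_le[of \<phi>] by blast
  have "\<forall>j. \<exists>C. \<forall>\<xi>. \<bar>\<xi> $ j\<bar> ^ k * norm (fourier_int \<phi> \<xi>) \<le> C"
  proof (intro allI exI)
    fix j \<xi>
    show "\<bar>\<xi> $ j\<bar> ^ k * norm (fourier_int \<phi> \<xi>) \<le> (\<integral>x. norm (foldr partial_deriv (replicate k j) \<phi> x) \<partial>lborel)"
      using norm_fourier_int_le[of "foldr partial_deriv (replicate k j) \<phi>" \<xi>] it[of j \<xi>]
      by (simp add: norm_mult norm_power)
  qed
  then obtain C where C: "\<And>j \<xi>. \<bar>\<xi> $ j\<bar> ^ k * norm (fourier_int \<phi> \<xi>) \<le> C j"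
    by metis
  show "\<exists>C. \<forall>x. (1 + norm x) ^ k * norm (fourier_int \<phi> x) \<le> C"
  proof (intro exI allI)
    fix \<xi> :: "real^'n"
    have "\<exists>j. norm \<xi> \<le> real CARD('n) * \<bar>\<xi> $ j\<bar>"
    proof (rule ccontr)
      assume "\<not> ?thesis"
      then have "\<And>j. \<bar>\<xi> $ j\<bar> < norm \<xi> / real CARD('n)"
        by (simp add: not_le field_simps)
      then have "(\<Sum>j\<in>UNIV. \<bar>\<xi> $ j\<bar>) < (\<Sum>j\<in>(UNIV::'n set). norm \<xi> / real CARD('n))"
        by (intro sum_strict_mono) auto
      then show False
        using norm_le_l1_cart[of \<xi>] by simp
    qed
    then obtain j where j: "norm \<xi> \<le> real CARD('n) * \<bar>\<xi> $ j\<bar>" by blast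
    let ?F = "norm (fourier_int \<phi> \<xi>)"
    have Cs: "C j \<le> (\<Sum>i\<in>UNIV. \<bar>C i\<bar>)"
      by (rule order_trans[OF abs_ge_self member_le_sum[of j UNIV "\<lambda>i. \<bar>C i\<bar>"]]) auto
    have "(1 + norm \<xi>) ^ k \<le> (2 * max 1 (norm \<xi>)) ^ k"
      by (rule power_mono) auto
    also have "\<dots> = 2 ^ k * max 1 (norm \<xi>) ^ k"
      by (simp add: power_mult_distrib)
    also have "\<dots> \<le> 2 ^ k * (1 + norm \<xi> ^ k)"
      by (intro mult_left_mono) (auto simp: max_def)
    also have "\<dots> \<le> 2 ^ k * (1 + (real CARD('n) * \<bar>\<xi> $ j\<bar>) ^ k)"
      by (intro mult_left_mono add_left_mono power_mono j) auto
    finally have "(1 + norm \<xi>) ^ k * ?F \<le> 2 ^ k * (1 + (real CARD('n) * \<bar>\<xi> $ j\<bar>) ^ k) * ?F"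
      by (rule mult_right_mono) simp
    also have "\<dots> = 2 ^ k * (?F + real CARD('n) ^ k * (\<bar>\<xi> $ j\<bar> ^ k * ?F))"
      by (simp add: power_mult_distrib algebra_simps)
    also have "\<dots> \<le> 2 ^ k * (C0 + real CARD('n) ^ k * (\<Sum>i\<in>UNIV. \<bar>C i\<bar>))"
      by (intro mult_left_mono add_mono C0 order_trans[OF C Cs]) auto
    finally show "(1 + norm \<xi>) ^ k * ?F \<le> 2 ^ k * (C0 + real CARD('n) ^ k * (\<Sum>i\<in>UNIV. \<bar>C i\<bar>))" .
  qed
qed

section \<open>Gaussians are Schwartz functions\<close>

text \<open>
  Polynomials in the coordinates. The products of such a function with a fixed Gaussian are closed under
  partial derivatives, which gives the Schwartz property of Gaussians.
\<close>

inductive_set polyfuns :: "('n::finite) sfield set" where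
  const: "(\<lambda>_. c) \<in> polyfuns"
| coord: "(\<lambda>x. complex_of_real (x $ j)) \<in> polyfuns"
| add: "p \<in> polyfuns \<Longrightarrow> q \<in> polyfuns \<Longrightarrow> (\<lambda>x. p x + q x) \<in> polyfuns"
| mult: "p \<in> polyfuns \<Longrightarrow> q \<in> polyfuns \<Longrightarrow> (\<lambda>x. p x * q x) \<in> polyfuns"

text \<open>
  The Gaussian $\exp(c\cdot x-|x|^2/2)$ with complex $c$: up to a constant factor, an imaginary $c$ is a
  modulation and a real $c$ is a translation of \<open>gauss\<close>.
\<close>

definition gexp :: "('n::finite \<Rightarrow> complex) \<Rightarrow> 'n sfield" where
  "gexp c x = exp (\<Sum>j\<in>UNIV. c j * complex_of_real (x $ j) - complex_of_real ((x $ j)\<^sup>2 / 2))"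

lemma partial_derivI:
  "(f has_derivative D) (at x) \<Longrightarrow> partial_deriv j f x = D (axis j 1)"
  unfolding partial_deriv_def by (simp add: frechet_derivative_at[symmetric])

lemma polyfuns_derivative:
  assumes "p \<in> polyfuns"
  shows "(\<forall>x. p differentiable at x) \<and> partial_deriv j p \<in> polyfuns"
  using assms
proof induction
  case (const c)
  have "partial_deriv j (\<lambda>_. c) = (\<lambda>_. 0)"
    by (rule ext, subst partial_derivI[OF has_derivative_const]) simp
  then show ?case by (auto intro: polyfuns.const)
next
  case (coord i)
  have D: "((\<lambda>x. complex_of_real (x $ i)) has_derivative (\<lambda>h. complex_of_real (h $ i))) (at x)" for x :: "real^'a"
    by (auto intro!: derivative_eq_intros bounded_linear_imp_has_derivative bounded_linear_compose[OF bounded_linear_of_real bounded_linear_vec_nth])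
  have "partial_deriv j (\<lambda>x. complex_of_real (x $ i)) = (\<lambda>_. complex_of_real (axis j 1 $ i))"
    by (rule ext, rule partial_derivI[OF D])
  then show ?case using D by (auto intro: polyfuns.const simp: differentiable_def)
next
  case (add p q)
  have D: "((\<lambda>x. p x + q x) has_derivative (\<lambda>h. frechet_derivative p (at x) h + frechet_derivative q (at x) h)) (at x)" for x
    using add.IH by (intro has_derivative_add) (auto simp: frechet_derivative_works)
  have "partial_deriv j (\<lambda>x. p x + q x) = (\<lambda>x. partial_deriv j p x + partial_deriv j q x)"
    by (rule ext, subst partial_derivI[OF D]) (simp add: partial_deriv_def)
  then show ?case using D add.IH by (auto intro: polyfuns.add simp: differentiable_def)
next
  case (mult p q)
  have D: "((\<lambda>x. p x * q x) has_derivative (\<lambda>h. p x * frechet_derivative q (at x) h + frechet_derivative p (at x) h * q x)) (at x)" for x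
    using mult.IH by (intro has_derivative_mult) (auto simp: frechet_derivative_works)
  have "partial_deriv j (\<lambda>x. p x * q x) = (\<lambda>x. p x * partial_deriv j q x + partial_deriv j p x * q x)"
    by (rule ext, subst partial_derivI[OF D]) (simp add: partial_deriv_def)
  then show ?case using D mult by (auto intro: polyfuns.intros simp: differentiable_def)
qed

lemma polyfuns_bound:
  assumes "p \<in> polyfuns"
  shows "\<exists>C m. \<forall>x. norm (p x) \<le> C * (1 + norm x) ^ m"
  using assms
proof induction
  case (const c)
  show ?case by (intro exI[of _ "norm c"] exI[of _ 0]) simp
next
  case (coord j)
  show ?case
    by (intro exI[of _ 1] exI[of _ 1])
       (auto intro: order_trans[OF component_le_norm_cart])
next
  case (add p q)
  then obtain C m D n where C: "\<And>x. norm (p x) \<le> C * (1 + norm x) ^ m" and D: "\<And>x. norm (q x) \<le> D * (1 + norm x) ^ n"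
    by blast
  have "norm (p x + q x) \<le> (\<bar>C\<bar> + \<bar>D\<bar>) * (1 + norm x) ^ max m n" for x
  proof -
    have "norm (p x) \<le> \<bar>C\<bar> * (1 + norm x) ^ max m n"
      by (rule order_trans[OF C mult_mono]) (auto intro: power_increasing)
    moreover have "norm (q x) \<le> \<bar>D\<bar> * (1 + norm x) ^ max m n"
      by (rule order_trans[OF D mult_mono]) (auto intro: power_increasing)
    ultimately show ?thesis
      using norm_triangle_ineq[of "p x" "q x"] by (simp add: algebra_simps)
  qed
  then show ?case by blast
next
  case (mult p q)
  then obtain C m D n where C: "\<And>x. norm (p x) \<le> C * (1 + norm x) ^ m" and D: "\<And>x. norm (q x) \<le> D * (1 + norm x) ^ n"
    by blast
  have "norm (p x * q x) \<le> (C * D) * (1 + norm x) ^ (m + n)" for x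
    using mult_mono[OF C[of x] D[of x]] order_trans[OF norm_ge_zero C[of x]]
    by (simp add: norm_mult power_add mult_ac)
  then show ?case by blast
qed

lemma gexp_has_derivative:
  "(gexp c has_derivative (\<lambda>h. gexp c x * (\<Sum>j\<in>UNIV. (c j - complex_of_real (x $ j)) * complex_of_real (h $ j)))) (at x)"
proof -
  have D: "((\<lambda>x. complex_of_real (x $ i)) has_derivative (\<lambda>h. complex_of_real (h $ i))) (at x)" for i
    by (auto intro!: derivative_eq_intros bounded_linear_imp_has_derivative bounded_linear_compose[OF bounded_linear_of_real bounded_linear_vec_nth])
  let ?E = "\<lambda>x. \<Sum>j\<in>UNIV. c j * complex_of_real (x $ j) + (- 1 / 2) * (complex_of_real (x $ j) * complex_of_real (x $ j))"
  have "((\<lambda>x. c j * complex_of_real (x $ j) + (- 1 / 2) * (complex_of_real (x $ j) * complex_of_real (x $ j))) has_derivative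
     (\<lambda>h. c j * complex_of_real (h $ j) + (- 1 / 2) * (complex_of_real (x $ j) * complex_of_real (h $ j)
       + complex_of_real (h $ j) * complex_of_real (x $ j)))) (at x)" for j
    by (intro has_derivative_add has_derivative_mult_right has_derivative_mult D)
  then have "(?E has_derivative (\<lambda>h. \<Sum>j\<in>UNIV. c j * complex_of_real (h $ j) + (- 1 / 2) * (complex_of_real (x $ j) * complex_of_real (h $ j)
       + complex_of_real (h $ j) * complex_of_real (x $ j)))) (at x)"
    by (intro has_derivative_sum)
  from has_derivative_compose[OF this, of exp, OF DERIV_exp[unfolded has_field_derivative_def]]
  have "((\<lambda>x. exp (?E x)) has_derivative (\<lambda>h. exp (?E x) * (\<Sum>j\<in>UNIV. c j * complex_of_real (h $ j) + (- 1 / 2) * (complex_of_real (x $ j) * complex_of_real (h $ j)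
       + complex_of_real (h $ j) * complex_of_real (x $ j))))) (at x)" .
  moreover have E: "gexp c = (\<lambda>x. exp (?E x))"
    by (rule ext) (simp add: gexp_def power2_eq_square)
  moreover have "(\<Sum>j\<in>UNIV. c j * complex_of_real (h $ j) + (- 1 / 2) * (complex_of_real (x $ j) * complex_of_real (h $ j)
       + complex_of_real (h $ j) * complex_of_real (x $ j))) = (\<Sum>j\<in>UNIV. (c j - complex_of_real (x $ j)) * complex_of_real (h $ j))" for h
    by (rule sum.cong[OF refl]) (simp add: algebra_simps)
  ultimately show ?thesis
    by (simp only:)
qed

lemma gexp_bound:
  fixes c :: "'n::finite \<Rightarrow> complex"
  shows "\<exists>C. \<forall>x. (1 + norm x) ^ n * norm (gexp c x) \<le> C"
proof (intro exI allI)
  let ?M = "\<Sum>j\<in>UNIV. norm (c j)"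
  fix x :: "real^'n"
  let ?r = "norm x"
  have le: "(\<Sum>j\<in>UNIV. Re (c j) * x $ j) \<le> ?M * ?r"
    unfolding sum_distrib_right
  proof (rule sum_mono)
    fix j
    have "Re (c j) * x $ j \<le> \<bar>Re (c j)\<bar> * \<bar>x $ j\<bar>"
      by (metis abs_ge_self abs_mult)
    also have "\<dots> \<le> norm (c j) * ?r"
      by (intro mult_mono abs_Re_le_cmod component_le_norm_cart) auto
    finally show "Re (c j) * x $ j \<le> norm (c j) * ?r" .
  qed
  have "norm (gexp c x) = exp ((\<Sum>j\<in>UNIV. Re (c j) * x $ j) - ?r\<^sup>2 / 2)"
    by (simp add: gexp_def norm_vec_square sum_subtractf sum_divide_distrib)
  also have "\<dots> \<le> exp (?M * ?r - ?r\<^sup>2 / 2)"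
    using le by simp
  finally have 1: "norm (gexp c x) \<le> exp (?M * ?r - ?r\<^sup>2 / 2)" .
  have 2: "(1 + ?r) ^ n \<le> fact n * exp (1 + ?r)"
  proof -
    have "(1 + ?r) ^ n / fact n \<le> exp (1 + ?r)"
    proof -
      have "(\<Sum>k\<in>{n}. (1 + ?r) ^ k /\<^sub>R fact k) \<le> (\<Sum>k. (1 + ?r) ^ k /\<^sub>R fact k)"
        by (rule sum_le_suminf[OF summable_exp_generic]) (auto simp: divide_inverse)
      then show ?thesis by (simp add: exp_def field_simps)
    qed
    then show ?thesis by (simp add: field_simps)
  qed
  have "(1 + ?r) ^ n * norm (gexp c x) \<le> (fact n * exp (1 + ?r)) * exp (?M * ?r - ?r\<^sup>2 / 2)"
    by (rule mult_mono[OF 2 1]) auto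
  also have "\<dots> = fact n * exp (1 + ?r + ?M * ?r - ?r\<^sup>2 / 2)"
    by (simp add: exp_add exp_diff)
  also have "\<dots> \<le> fact n * exp (1 + (?M + 1)\<^sup>2 / 2)"
  proof -
    \<comment> \<open>The quadratic term of the exponent absorbs the linear ones.\<close>
    have "2 * ?r * (?M + 1) \<le> ?r\<^sup>2 + (?M + 1)\<^sup>2"
      by (rule sum_squares_bound)
    moreover have "2 * ?r * (?M + 1) = 2 * (?r + ?M * ?r)"
      by (simp add: algebra_simps)
    moreover have "1 + a + b - s / 2 \<le> 1 + q / 2" if "c \<le> s + q" "c = 2 * (a + b)" for a b c s q :: real
      using that by simp
    ultimately have "1 + ?r + ?M * ?r - ?r\<^sup>2 / 2 \<le> 1 + (?M + 1)\<^sup>2 / 2"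
      by meson
    then show ?thesis by simp
  qed
  finally show "(1 + ?r) ^ n * norm (gexp c x) \<le> fact n * exp (1 + (?M + 1)\<^sup>2 / 2)" .
qed

lemma partial_deriv_poly_gexp:
  fixes p :: "'n::finite sfield"
  assumes p: "p \<in> polyfuns"
  shows "(\<lambda>x. p x * gexp c x) differentiable at x"
    and "\<exists>q\<in>polyfuns. partial_deriv j (\<lambda>x. p x * gexp c x) = (\<lambda>x. q x * gexp c x)"
proof -
  have D: "((\<lambda>x. p x * gexp c x) has_derivative (\<lambda>h. p x * (gexp c x * (\<Sum>j\<in>UNIV. (c j - complex_of_real (x $ j)) * complex_of_real (h $ j)))
      + frechet_derivative p (at x) h * gexp c x)) (at x)" for x
    using polyfuns_derivative[OF p] by (intro has_derivative_mult gexp_has_derivative) (auto simp: frechet_derivative_works)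
  then show "(\<lambda>x. p x * gexp c x) differentiable at x"
    by (auto simp: differentiable_def)
  let ?q = "\<lambda>x. p x * (c j + (- 1) * complex_of_real (x $ j)) + partial_deriv j p x"
  have s: "(\<Sum>i\<in>UNIV. (c i - complex_of_real (x $ i)) * complex_of_real (axis j 1 $ i)) = c j - complex_of_real (x $ j)" for x
    by (subst sum.remove[of _ j]) (auto simp: axis_def intro!: sum.neutral)
  have "partial_deriv j (\<lambda>x. p x * gexp c x) = (\<lambda>x. ?q x * gexp c x)"
    by (rule ext, subst partial_derivI[OF D], subst s) (simp add: partial_deriv_def algebra_simps)
  moreover have "?q \<in> polyfuns"
    using polyfuns_derivative[OF p] p by (intro polyfuns.intros) auto
  ultimately show "\<exists>q\<in>polyfuns. partial_deriv j (\<lambda>x. p x * gexp c x) = (\<lambda>x. q x * gexp c x)"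
    by (rule bexI[where x="?q"])
qed

lemma schwartz_poly_gexp:
  fixes p :: "'n::finite sfield"
  assumes p: "p \<in> polyfuns"
  shows "schwartz (\<lambda>x. p x * gexp c x)"
  unfolding schwartz_def
proof (intro allI)
  fix js :: "'n list" and k :: nat
  have "\<exists>q\<in>polyfuns. foldr partial_deriv js (\<lambda>x. p x * gexp c x) = (\<lambda>x. q x * gexp c x)"
  proof (induction js)
    case Nil
    then show ?case using p by auto
  next
    case (Cons j js)
    then show ?case using partial_deriv_poly_gexp(2)[of _ j c] by auto
  qed
  then obtain q where q: "q \<in> polyfuns" and eq: "foldr partial_deriv js (\<lambda>x. p x * gexp c x) = (\<lambda>x. q x * gexp c x)"
    by blast
  obtain C m where C: "\<And>x. norm (q x) \<le> C * (1 + norm x) ^ m"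
    using polyfuns_bound[OF q] by blast
  obtain B where B: "\<And>x. (1 + norm x) ^ (k + m) * norm (gexp c x) \<le> B"
    using gexp_bound by blast
  have "norm ((1 + norm x) ^ k *\<^sub>R (q x * gexp c x)) \<le> \<bar>C\<bar> * B" for x
  proof -
    have "norm ((1 + norm x) ^ k *\<^sub>R (q x * gexp c x)) = (1 + norm x) ^ k * norm (q x) * norm (gexp c x)"
      by (simp add: norm_mult)
    also have "\<dots> \<le> (1 + norm x) ^ k * (\<bar>C\<bar> * (1 + norm x) ^ m) * norm (gexp c x)"
      by (intro mult_right_mono mult_left_mono order_trans[OF C]) auto
    also have "\<dots> = \<bar>C\<bar> * ((1 + norm x) ^ (k + m) * norm (gexp c x))"
      by (simp add: power_add)
    also have "\<dots> \<le> \<bar>C\<bar> * B"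
      by (intro mult_left_mono B) auto
    finally show ?thesis .
  qed
  then show "(\<forall>x. foldr partial_deriv js (\<lambda>x. p x * gexp c x) differentiable at x) \<and>
     bounded (range (\<lambda>x. (1 + norm x) ^ k *\<^sub>R foldr partial_deriv js (\<lambda>x. p x * gexp c x) x))"
    unfolding eq using partial_deriv_poly_gexp(1)[OF q] by (auto simp: bounded_iff)
qed

lemma schwartz_gauss_modulated:
  fixes b :: "real^'n::finite"
  shows "schwartz (\<lambda>x. cis (- (x \<bullet> b)) * complex_of_real (gauss x))"
proof -
  have "(\<lambda>x. cis (- (x \<bullet> b)) * complex_of_real (gauss x)) = (\<lambda>x. 1 * gexp (\<lambda>j. - \<i> * complex_of_real (b $ j)) x)"
  proof
    fix x
    have e: "gexp (\<lambda>j. - \<i> * complex_of_real (b $ j)) x =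
       exp (\<i> * complex_of_real (- (x \<bullet> b)) + complex_of_real (- (norm x)\<^sup>2 / 2))"
      unfolding gexp_def norm_vec_square inner_vec_def
      by (simp add: sum_subtractf sum_divide_distrib sum_distrib_left sum_negf mult_ac)
    show "cis (- (x \<bullet> b)) * complex_of_real (gauss x) = 1 * gexp (\<lambda>j. - \<i> * complex_of_real (b $ j)) x"
      unfolding e exp_add exp_of_real cis_conv_exp gauss_def by (simp only: mult_1)
  qed
  then show ?thesis
    using schwartz_poly_gexp[OF polyfuns.const[of 1]] by simp
qed

lemma schwartz_gauss_shifted:
  fixes b :: "real^'n::finite"
  shows "schwartz (\<lambda>x. complex_of_real (gauss (x - b)))"
proof -
  have "(\<lambda>x. complex_of_real (gauss (x - b))) = (\<lambda>x. complex_of_real (exp (- (norm b)\<^sup>2 / 2)) * gexp (\<lambda>j. complex_of_real (b $ j)) x)"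
  proof
    fix x
    have e: "gexp (\<lambda>j. complex_of_real (b $ j)) x = complex_of_real (exp (x \<bullet> b - (norm x)\<^sup>2 / 2))"
      unfolding gexp_def norm_vec_square inner_vec_def exp_of_real[symmetric]
      by (simp add: sum_subtractf sum_divide_distrib mult_ac)
    have "(norm (x - b))\<^sup>2 = (norm x)\<^sup>2 - 2 * (x \<bullet> b) + (norm b)\<^sup>2"
      by (simp add: power2_norm_eq_inner inner_diff_left inner_diff_right inner_commute)
    then have "- (norm (x - b))\<^sup>2 / 2 = - (norm b)\<^sup>2 / 2 + (x \<bullet> b - (norm x)\<^sup>2 / 2)"
      by simp
    then show "complex_of_real (gauss (x - b)) = complex_of_real (exp (- (norm b)\<^sup>2 / 2)) * gexp (\<lambda>j. complex_of_real (b $ j)) x"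
      unfolding e gauss_def by (simp only: exp_add of_real_mult)
  qed
  then show ?thesis
    using schwartz_poly_gexp[OF polyfuns.const] by simp
qed

lemma fourier_int_gauss_shifted:
  fixes b :: "real^'n::finite"
  shows "fourier_int (\<lambda>x. complex_of_real (gauss (x - b))) \<xi> =
     complex_of_real (gauss_mass TYPE('n)) * (cis (- (b \<bullet> \<xi>)) * complex_of_real (gauss \<xi>))"
proof -
  have "fourier_int (\<lambda>x. complex_of_real (gauss (x - b))) \<xi> =
    (\<integral>x. cis (- ((x + b) \<bullet> \<xi>)) * complex_of_real (gauss x) \<partial>lborel)"
    unfolding fourier_int_def
    using integral_lborel_shift[of "\<lambda>x. cis (- (x \<bullet> \<xi>)) * complex_of_real (gauss (x - b))" b, symmetric] by simp
  also have "\<dots> = (\<integral>x. cis (- (b \<bullet> \<xi>)) * (cis (x \<bullet> (- \<xi>)) * complex_of_real (gauss x)) \<partial>lborel)"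
  proof (intro Bochner_Integration.integral_cong refl)
    fix x
    have "- ((x + b) \<bullet> \<xi>) = - (b \<bullet> \<xi>) + x \<bullet> (- \<xi>)"
      by (simp add: inner_add_left)
    then show "cis (- ((x + b) \<bullet> \<xi>)) * complex_of_real (gauss x) = cis (- (b \<bullet> \<xi>)) * (cis (x \<bullet> (- \<xi>)) * complex_of_real (gauss x))"
      by (simp only: mult.assoc[symmetric] cis_mult)
  qed
  also have "\<dots> = complex_of_real (gauss_mass TYPE('n)) * (cis (- (b \<bullet> \<xi>)) * complex_of_real (gauss \<xi>))"
    unfolding integral_mult_right_zero integral_cis_gauss by simp
  finally show ?thesis .
qed

section \<open>The distributional Fourier transform\<close>

text \<open>
  The assumption says that the integrable function \<open>h\<close> times \<open>gauss\<close> has Fourier transform zero.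
\<close>

lemma tempered_fun_eqI_gauss:
  fixes h :: "'n::finite sfield"
  assumes h: "tempered_fun h" and zero: "\<And>b. (\<integral>x. h x * (cis (- (x \<bullet> b)) * complex_of_real (gauss x)) \<partial>lborel) = 0"
  shows "AE x in lborel. h x = 0"
proof -
  have r: "rapid (\<lambda>x. complex_of_real (gauss (x :: real^'n)))"
    using schwartz_rapid[OF schwartz_gauss_modulated[of 0]] by simp
  have "AE x in lborel. h x * complex_of_real (gauss x) = 0"
  proof (rule fourier_int_eq_0_imp_AE_zero)
    show "integrable lborel (\<lambda>x. h x * complex_of_real (gauss x))"
      by (rule integrable_tempered_mult_rapid[OF h r])
    show "fourier_int (\<lambda>x. h x * complex_of_real (gauss x)) \<xi> = 0" for \<xi>
      using zero[of \<xi>] by (simp add: fourier_int_def mult_ac)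
  qed
  then show ?thesis
    by eventually_elim (use gauss_pos in \<open>auto simp: less_le\<close>)
qed

lemma has_fourier_tempered: "has_fourier f g \<Longrightarrow> tempered_fun f" "has_fourier f g \<Longrightarrow> tempered_fun g"
  by (auto simp: has_fourier_def)

lemma has_fourier_measurable:
  assumes "has_fourier f g"
  shows "f \<in> borel_measurable borel" "g \<in> borel_measurable borel"
  using assms by (auto simp: has_fourier_def tempered_fun_def)

lemma has_fourier_diff:
  assumes 1: "has_fourier f g" and 2: "has_fourier f' g'"
  shows "has_fourier (\<lambda>x. f x - f' x) (\<lambda>x. g x - g' x)"
  unfolding has_fourier_def
proof (intro conjI allI impI)
  fix \<phi> :: "'a sfield" assume \<phi>: "schwartz \<phi>"
  note I = integrable_tempered_mult_rapid[OF has_fourier_tempered(1)[OF 1] schwartz_rapid_fourier_int[OF \<phi>]]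
    integrable_tempered_mult_rapid[OF has_fourier_tempered(1)[OF 2] schwartz_rapid_fourier_int[OF \<phi>]]
    integrable_tempered_mult_rapid[OF has_fourier_tempered(2)[OF 1] schwartz_rapid[OF \<phi>]]
    integrable_tempered_mult_rapid[OF has_fourier_tempered(2)[OF 2] schwartz_rapid[OF \<phi>]]
  show "(\<integral>x. (f x - f' x) * fourier_int \<phi> x \<partial>lborel) = (\<integral>\<xi>. (g \<xi> - g' \<xi>) * \<phi> \<xi> \<partial>lborel)"
    using I 1 2 \<phi> unfolding has_fourier_def by (simp add: left_diff_distrib)
qed (use assms in \<open>auto intro: tempered_fun_diff has_fourier_tempered\<close>)

text \<open>
  Test functions are the modulated Gaussians.
\<close>

lemma has_fourier_unique_right:
  assumes 1: "has_fourier f g" and 2: "has_fourier f g'"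
  shows "AE \<xi> in lborel. g \<xi> = g' \<xi>"
proof -
  have D: "has_fourier (\<lambda>x. 0) (\<lambda>x. g x - g' x)"
    using has_fourier_diff[OF 1 2] by simp
  have "AE x in lborel. g x - g' x = 0"
  proof (rule tempered_fun_eqI_gauss[OF has_fourier_tempered(2)[OF D]])
    fix b
    show "(\<integral>x. (g x - g' x) * (cis (- (x \<bullet> b)) * complex_of_real (gauss x)) \<partial>lborel) = 0"
      using D schwartz_gauss_modulated[of b] unfolding has_fourier_def by fastforce
  qed
  then show ?thesis by simp
qed

text \<open>
  Test functions are the translated Gaussians, whose transforms are modulated Gaussians.
\<close>

lemma has_fourier_unique_left:
  fixes f :: "'n::finite sfield"
  assumes 1: "has_fourier f g" and 2: "has_fourier f' g"
  shows "AE x in lborel. f x = f' x"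
proof -
  have D: "has_fourier (\<lambda>x. f x - f' x) (\<lambda>x. 0)"
    using has_fourier_diff[OF 1 2] by simp
  have "AE x in lborel. f x - f' x = 0"
  proof (rule tempered_fun_eqI_gauss[OF has_fourier_tempered(1)[OF D]])
    fix b :: "real^'n"
    have "(\<integral>x. (f x - f' x) * fourier_int (\<lambda>x. complex_of_real (gauss (x - b))) x \<partial>lborel) = 0"
      using D schwartz_gauss_shifted[of b] unfolding has_fourier_def by fastforce
    then have "(\<integral>x. complex_of_real (gauss_mass TYPE('n)) * ((f x - f' x) * (cis (- (b \<bullet> x)) * complex_of_real (gauss x))) \<partial>lborel) = 0"
      unfolding fourier_int_gauss_shifted by (simp add: mult_ac)
    then show "(\<integral>x. (f x - f' x) * (cis (- (x \<bullet> b)) * complex_of_real (gauss x)) \<partial>lborel) = 0"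
      using gauss_mass_pos[where 'n='n] unfolding integral_mult_right_zero by (simp add: inner_commute)
  qed
  then show ?thesis by simp
qed

lemma tempered_fun_cong_AE:
  assumes "tempered_fun f" "AE x in lborel. f x = f' x" "f' \<in> borel_measurable borel"
  shows "tempered_fun f'"
proof -
  have [measurable]: "f \<in> borel_measurable borel" "f' \<in> borel_measurable borel"
    using assms by (auto simp: tempered_fun_def)
  obtain k where k: "integrable lborel (\<lambda>x. norm (f x) / (1 + norm x) ^ k)"
    using assms by (auto simp: tempered_fun_def)
  have "integrable lborel (\<lambda>x. norm (f' x) / (1 + norm x) ^ k)"
    by (rule integrable_cong_AE[THEN iffD1, rotated 3, OF k]) (use assms(2) in auto)
  then show ?thesis using assms(3) by (auto simp: tempered_fun_def)
qed

lemma has_fourier_cong_AE: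
  assumes h: "has_fourier f g" and f: "AE x in lborel. f x = f' x" "f' \<in> borel_measurable borel"
    and g: "AE x in lborel. g x = g' x" "g' \<in> borel_measurable borel"
  shows "has_fourier f' g'"
proof -
  have [measurable]: "f \<in> borel_measurable borel" "g \<in> borel_measurable borel" "f' \<in> borel_measurable borel" "g' \<in> borel_measurable borel"
    using assms has_fourier_measurable by auto
  show ?thesis
    unfolding has_fourier_def
  proof (intro conjI allI impI)
    fix \<phi> :: "'a sfield" assume \<phi>: "schwartz \<phi>"
    have [measurable]: "\<phi> \<in> borel_measurable borel"
      using \<phi> by (intro rapid_measurable schwartz_rapid)
    have "(\<integral>x. f' x * fourier_int \<phi> x \<partial>lborel) = (\<integral>x. f x * fourier_int \<phi> x \<partial>lborel)"
      by (rule integral_cong_AE) (use f in auto)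
    also have "\<dots> = (\<integral>\<xi>. g \<xi> * \<phi> \<xi> \<partial>lborel)"
      using h \<phi> by (simp add: has_fourier_def)
    also have "\<dots> = (\<integral>\<xi>. g' \<xi> * \<phi> \<xi> \<partial>lborel)"
      by (rule integral_cong_AE) (use g in auto)
    finally show "(\<integral>x. f' x * fourier_int \<phi> x \<partial>lborel) = (\<integral>\<xi>. g' \<xi> * \<phi> \<xi> \<partial>lborel)" .
  qed (use assms tempered_fun_cong_AE has_fourier_tempered in blast)+
qed

lemma has_fourier_fourier_int:
  fixes f :: "'n::finite sfield"
  assumes "integrable lborel f"
  shows "has_fourier f (fourier_int f)"
  unfolding has_fourier_def
proof (intro conjI allI impI)
  have [measurable]: "f \<in> borel_measurable borel" using assms by auto
  show "tempered_fun (fourier_int f)"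
    by (rule tempered_fun_bounded[OF _ norm_fourier_int_le]) measurable
qed (use assms in \<open>auto intro!: tempered_fun_integrable fourier_int_swap rapid_integrable schwartz_rapid\<close>)

definition inv_fourier_int :: "'n::finite sfield \<Rightarrow> 'n sfield" where
  "inv_fourier_int g x = complex_of_real (1 / (gauss_mass TYPE('n))\<^sup>2) * fourier_int g (- x)"

text \<open>
  By Fubini's theorem the defining property of \<open>has_fourier\<close> becomes the inversion formula for
  the test function.
\<close>

lemma has_fourier_inv_fourier_int:
  fixes g :: "'n::finite sfield"
  assumes g: "integrable lborel g"
  shows "has_fourier (inv_fourier_int g) g"
  unfolding has_fourier_def
proof (intro conjI allI impI)
  have [measurable]: "g \<in> borel_measurable borel" using g by auto
  have m: "inv_fourier_int g \<in> borel_measurable borel"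
    unfolding inv_fourier_int_def[abs_def] by measurable
  show "tempered_fun (inv_fourier_int g)"
    by (rule tempered_fun_bounded[OF m, of "(1 / (gauss_mass TYPE('n))\<^sup>2) * (\<integral>x. norm (g x) \<partial>lborel)"])
       (auto simp: inv_fourier_int_def norm_mult norm_divide norm_power less_imp_le intro!: divide_right_mono norm_fourier_int_le)
  fix \<phi> :: "'n sfield" assume \<phi>: "schwartz \<phi>"
  let ?c = "complex_of_real (1 / (gauss_mass TYPE('n))\<^sup>2)"
  obtain B where B: "\<And>x. norm (\<phi> x) \<le> B" by (rule rapid_bounded[OF schwartz_rapid[OF \<phi>]]) blast
  have inv: "(\<integral>x. fourier_int \<phi> x * cis (\<xi> \<bullet> x) \<partial>lborel) = complex_of_real ((gauss_mass TYPE('n))\<^sup>2) * \<phi> \<xi>" for \<xi>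
    by (rule fourier_inversion[OF _ _ B])
       (use \<phi> in \<open>auto intro!: rapid_integrable schwartz_rapid schwartz_rapid_fourier_int schwartz_isCont\<close>)
  have "(\<integral>x. inv_fourier_int g x * fourier_int \<phi> x \<partial>lborel) =
     (\<integral>x. ?c * (fourier_int \<phi> x * (\<integral>\<xi>. cis (\<xi> \<bullet> x) * g \<xi> \<partial>lborel)) \<partial>lborel)"
    unfolding inv_fourier_int_def fourier_int_def[of g] by (simp add: mult_ac)
  also have "\<dots> = ?c * (\<integral>x. fourier_int \<phi> x * (\<integral>\<xi>. cis (\<xi> \<bullet> x) * g \<xi> \<partial>lborel) \<partial>lborel)"
    by (rule integral_mult_right_zero)
  also have "(\<integral>x. fourier_int \<phi> x * (\<integral>\<xi>. cis (\<xi> \<bullet> x) * g \<xi> \<partial>lborel) \<partial>lborel)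
     = (\<integral>\<xi>. g \<xi> * (\<integral>x. cis (\<xi> \<bullet> x) * fourier_int \<phi> x \<partial>lborel) \<partial>lborel)"
    by (rule integral_kernel_commute)
       (use g \<phi> in \<open>auto intro!: rapid_integrable schwartz_rapid_fourier_int\<close>)
  also have "\<dots> = (\<integral>\<xi>. complex_of_real ((gauss_mass TYPE('n))\<^sup>2) * (g \<xi> * \<phi> \<xi>) \<partial>lborel)"
    using inv by (simp add: mult_ac)
  also have "\<dots> = complex_of_real ((gauss_mass TYPE('n))\<^sup>2) * (\<integral>\<xi>. g \<xi> * \<phi> \<xi> \<partial>lborel)"
    by (rule integral_mult_right_zero)
  also have "?c * \<dots> = (\<integral>\<xi>. g \<xi> * \<phi> \<xi> \<partial>lborel)"
    using gauss_mass_pos[where 'n='n] by simp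
  finally show "(\<integral>x. inv_fourier_int g x * fourier_int \<phi> x \<partial>lborel) = (\<integral>\<xi>. g \<xi> * \<phi> \<xi> \<partial>lborel)" .
qed (use g in \<open>rule tempered_fun_integrable\<close>)

section \<open>Complex conjugation\<close>

lemma partial_deriv_conj_reflect:
  fixes \<phi> :: "'n::finite sfield"
  assumes \<phi>: "\<And>x. \<phi> differentiable at x"
  shows "(\<lambda>x. s * cnj (\<phi> (- x))) differentiable at x"
    and "partial_deriv j (\<lambda>x. s * cnj (\<phi> (- x))) = (\<lambda>x. (- s) * cnj (partial_deriv j \<phi> (- x)))"
proof -
  have D: "((\<lambda>x. s * cnj (\<phi> (- x))) has_derivative (\<lambda>h. s * cnj (frechet_derivative \<phi> (at (- x)) (- h)))) (at x)" for x
  proof -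
    have F: "(\<phi> has_derivative frechet_derivative \<phi> (at (- x))) (at (- x))"
      using \<phi> by (simp add: frechet_derivative_works)
    have "((\<lambda>x. \<phi> (- x)) has_derivative (\<lambda>h. frechet_derivative \<phi> (at (- x)) (- h))) (at x)"
      by (rule has_derivative_compose[where f=uminus and f'=uminus and g=\<phi>, OF _ F]) (auto intro!: derivative_eq_intros)
    then show ?thesis
      by (intro has_derivative_mult_right bounded_linear.has_derivative[OF bounded_linear_cnj])
  qed
  then show "(\<lambda>x. s * cnj (\<phi> (- x))) differentiable at x"
    by (auto simp: differentiable_def)
  have "frechet_derivative \<phi> (at (- x)) (- axis j 1) = - frechet_derivative \<phi> (at (- x)) (axis j 1)" for x
    using \<phi>[of "- x"] by (intro linear_neg linear_frechet_derivative)
  then show "partial_deriv j (\<lambda>x. s * cnj (\<phi> (- x))) = (\<lambda>x. (- s) * cnj (partial_deriv j \<phi> (- x)))"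
    by (intro ext) (subst partial_derivI[OF D], simp add: partial_deriv_def)
qed

text \<open>
  Every partial derivative of the reflected function contributes a sign.
\<close>

lemma schwartz_conj_reflect:
  fixes \<phi> :: "'n::finite sfield"
  assumes \<phi>: "schwartz \<phi>"
  shows "schwartz (\<lambda>x. cnj (\<phi> (- x)))"
  unfolding schwartz_def
proof (intro allI)
  fix js :: "'n list" and k
  have eq: "foldr partial_deriv js (\<lambda>x. cnj (\<phi> (- x))) = (\<lambda>x. (- 1) ^ length js * cnj (foldr partial_deriv js \<phi> (- x)))"
  proof (induction js)
    case (Cons j js)
    have "foldr partial_deriv js \<phi> differentiable at x" for x
      using \<phi> unfolding schwartz_def by blast
    from partial_deriv_conj_reflect(2)[OF this, of j "(- 1) ^ length js"]
    show ?case using Cons by simp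
  qed simp
  have d: "foldr partial_deriv js \<phi> differentiable at x" for x
    using \<phi> unfolding schwartz_def by blast
  have "bounded (range (\<lambda>x. (1 + norm x) ^ k *\<^sub>R foldr partial_deriv js \<phi> x))"
    using \<phi> unfolding schwartz_def by blast
  then obtain B where B: "\<And>x. norm ((1 + norm x) ^ k *\<^sub>R foldr partial_deriv js \<phi> x) \<le> B"
    by (auto simp: bounded_iff)
  show "(\<forall>x. foldr partial_deriv js (\<lambda>x. cnj (\<phi> (- x))) differentiable at x) \<and>
      bounded (range (\<lambda>x. (1 + norm x) ^ k *\<^sub>R foldr partial_deriv js (\<lambda>x. cnj (\<phi> (- x))) x))"
    unfolding eq bounded_iff
  proof (intro conjI allI exI ballI)
    show "(\<lambda>x. (- 1) ^ length js * cnj (foldr partial_deriv js \<phi> (- x))) differentiable at x" for x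
      by (rule partial_deriv_conj_reflect(1)[OF d])
    fix y assume "y \<in> range (\<lambda>x. (1 + norm x) ^ k *\<^sub>R ((- 1) ^ length js * cnj (foldr partial_deriv js \<phi> (- x))))"
    then show "norm y \<le> B"
      using B[of "- x" for x] by (auto simp: norm_mult norm_power)
  qed
qed

lemma has_fourier_cnj:
  fixes f :: "'n::finite sfield"
  assumes h: "has_fourier f g"
  shows "has_fourier (\<lambda>x. cnj (f x)) (\<lambda>\<xi>. cnj (g (- \<xi>)))"
  unfolding has_fourier_def
proof (intro conjI allI impI)
  have [measurable]: "f \<in> borel_measurable borel" "g \<in> borel_measurable borel"
    using has_fourier_measurable[OF h] by auto
  fix \<phi> :: "'n sfield" assume \<phi>: "schwartz \<phi>"
  have [measurable]: "\<phi> \<in> borel_measurable borel"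
    using \<phi> by (intro rapid_measurable schwartz_rapid)
  let ?\<phi> = "\<lambda>x. cnj (\<phi> (- x))"
  have F: "fourier_int ?\<phi> x = cnj (fourier_int \<phi> x)" for x
  proof -
    have "fourier_int ?\<phi> x = (\<integral>y. cis (- (- y \<bullet> x)) * cnj (\<phi> y) \<partial>lborel)"
      unfolding fourier_int_def
      using integral_lborel_uminus[of "\<lambda>y. cis (- (- y \<bullet> x)) * cnj (\<phi> y)"] by simp
    also have "\<dots> = (\<integral>y. cnj (cis (- (y \<bullet> x)) * \<phi> y) \<partial>lborel)"
      by (simp add: cis_cnj)
    finally show ?thesis by (simp only: fourier_int_def Bochner_Integration.integral_cnj)
  qed
  have "(\<integral>x. cnj (f x) * fourier_int \<phi> x \<partial>lborel) = (\<integral>x. cnj (f x * fourier_int ?\<phi> x) \<partial>lborel)"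
    unfolding F by simp
  also have "\<dots> = cnj (\<integral>\<xi>. g \<xi> * ?\<phi> \<xi> \<partial>lborel)"
    using h schwartz_conj_reflect[OF \<phi>] unfolding has_fourier_def by (simp only: Bochner_Integration.integral_cnj)
  also have "\<dots> = (\<integral>\<xi>. cnj (g \<xi>) * \<phi> (- \<xi>) \<partial>lborel)"
    by (simp only: Bochner_Integration.integral_cnj[symmetric]) simp
  also have "\<dots> = (\<integral>\<xi>. cnj (g (- \<xi>)) * \<phi> \<xi> \<partial>lborel)"
    using integral_lborel_uminus[of "\<lambda>\<xi>. cnj (g (- \<xi>)) * \<phi> \<xi>"] by simp
  finally show "(\<integral>x. cnj (f x) * fourier_int \<phi> x \<partial>lborel) = (\<integral>\<xi>. cnj (g (- \<xi>)) * \<phi> \<xi> \<partial>lborel)" .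
qed (use h in \<open>auto intro: tempered_fun_conj_reflect has_fourier_tempered\<close>)

section \<open>Square integrable functions\<close>

text \<open>
  The space \<open>L2\<close> and its norm for functions with values in a separable Banach space, so that one theory covers
  vector fields, their scalar components and functions on the Fourier side.
\<close>

definition sq_integrable :: "(real ^ 'n::finite \<Rightarrow> 'b::{banach, second_countable_topology}) \<Rightarrow> bool" where
  "sq_integrable f \<longleftrightarrow> f \<in> borel_measurable borel \<and> integrable lborel (\<lambda>x. (norm (f x))\<^sup>2)"

definition l2n :: "(real ^ 'n::finite \<Rightarrow> 'b::{banach, second_countable_topology}) \<Rightarrow> real" where
  "l2n f = sqrt (\<integral>x. (norm (f x))\<^sup>2 \<partial>lborel)"

lemma sq_integrable_measurable [measurable_dest]: "sq_integrable f \<Longrightarrow> f \<in> borel_measurable borel"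
  by (simp add: sq_integrable_def)

lemma l2n_nonneg [simp]: "0 \<le> l2n f"
  by (simp add: l2n_def)

lemma l2n_square: "(l2n f)\<^sup>2 = (\<integral>x. (norm (f x))\<^sup>2 \<partial>lborel)"
  by (simp add: l2n_def)

lemma sq_integrable_bound:
  assumes g: "sq_integrable g" and [measurable]: "f \<in> borel_measurable borel"
    and le: "AE x in lborel. norm (f x) \<le> norm (g x)"
  shows "sq_integrable f" "l2n f \<le> l2n g"
proof -
  have I: "integrable lborel (\<lambda>x. (norm (g x))\<^sup>2)"
    using g by (simp add: sq_integrable_def)
  have le2: "AE x in lborel. (norm (f x))\<^sup>2 \<le> (norm (g x))\<^sup>2"
    using le by eventually_elim (simp add: power_mono)
  show *: "sq_integrable f"
    unfolding sq_integrable_def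
    by (intro conjI Bochner_Integration.integrable_bound[OF I]) (use le2 in auto)
  show "l2n f \<le> l2n g"
    unfolding l2n_def using * I le2
    by (intro real_sqrt_le_mono integral_mono_AE) (auto simp: sq_integrable_def)
qed

lemma sq_integrable_cong_AE:
  assumes "AE x in lborel. f x = g x" and [measurable]: "f \<in> borel_measurable borel" "g \<in> borel_measurable borel"
  shows "sq_integrable f \<longleftrightarrow> sq_integrable g" "l2n f = l2n g"
proof -
  show "sq_integrable f \<longleftrightarrow> sq_integrable g"
    unfolding sq_integrable_def by (intro conj_cong integrable_cong_AE) (use assms in auto)
  show "l2n f = l2n g"
    unfolding l2n_def by (intro arg_cong[where f=sqrt] integral_cong_AE) (use assms in auto)
qed

lemma l2n_Cauchy_Schwarz:
  fixes f g :: "real ^ 'n::finite \<Rightarrow> 'b::{banach, second_countable_topology}"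
  assumes f: "sq_integrable f" and g: "sq_integrable g"
  shows "integrable lborel (\<lambda>x. norm (f x) * norm (g x))"
    and "(\<integral>x. norm (f x) * norm (g x) \<partial>lborel) \<le> l2n f * l2n g"
proof -
  have [measurable]: "f \<in> borel_measurable borel" "g \<in> borel_measurable borel"
    using assms by auto
  have If: "integrable lborel (\<lambda>x. (norm (f x))\<^sup>2)" and Ig: "integrable lborel (\<lambda>x. (norm (g x))\<^sup>2)"
    using assms by (auto simp: sq_integrable_def)
  show I: "integrable lborel (\<lambda>x. norm (f x) * norm (g x))"
    by (rule integrable_square_imp_product) (use If Ig in auto)
  have "(\<integral>\<^sup>+x. ennreal (norm (f x)) * ennreal (norm (g x)) \<partial>lborel)\<^sup>2
    \<le> (\<integral>\<^sup>+x. (ennreal (norm (f x)))\<^sup>2 \<partial>lborel) * (\<integral>\<^sup>+x. (ennreal (norm (g x)))\<^sup>2 \<partial>lborel)"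
    by (rule Cauchy_Schwarz_nn_integral) auto
  moreover have "(\<integral>\<^sup>+x. ennreal (norm (f x)) * ennreal (norm (g x)) \<partial>lborel) = ennreal (\<integral>x. norm (f x) * norm (g x) \<partial>lborel)"
    using nn_integral_eq_integral[OF I] by (simp add: ennreal_mult)
  moreover have "(\<integral>\<^sup>+x. (ennreal (norm (f x)))\<^sup>2 \<partial>lborel) = ennreal (\<integral>x. (norm (f x))\<^sup>2 \<partial>lborel)"
    using nn_integral_eq_integral[OF If] by (simp add: ennreal_power)
  moreover have "(\<integral>\<^sup>+x. (ennreal (norm (g x)))\<^sup>2 \<partial>lborel) = ennreal (\<integral>x. (norm (g x))\<^sup>2 \<partial>lborel)"
    using nn_integral_eq_integral[OF Ig] by (simp add: ennreal_power)
  ultimately have "(\<integral>x. norm (f x) * norm (g x) \<partial>lborel)\<^sup>2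
    \<le> (\<integral>x. (norm (f x))\<^sup>2 \<partial>lborel) * (\<integral>x. (norm (g x))\<^sup>2 \<partial>lborel)"
    by (simp add: ennreal_power ennreal_mult[symmetric])
  then have "(\<integral>x. norm (f x) * norm (g x) \<partial>lborel)\<^sup>2 \<le> (l2n f * l2n g)\<^sup>2"
    by (simp add: power_mult_distrib l2n_square)
  then show "(\<integral>x. norm (f x) * norm (g x) \<partial>lborel) \<le> l2n f * l2n g"
    by (rule power2_le_imp_le) simp
qed

lemma sq_integrable_scaleR:
  assumes "sq_integrable f"
  shows "sq_integrable (\<lambda>x. c *\<^sub>R f x)" "l2n (\<lambda>x. c *\<^sub>R f x) = \<bar>c\<bar> * l2n f"
  using assms by (auto simp: sq_integrable_def l2n_def power_mult_distrib real_sqrt_mult)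

lemma sq_integrable_zero [simp]: "sq_integrable (\<lambda>x. 0)" "l2n (\<lambda>x. 0) = 0"
  by (auto simp: sq_integrable_def l2n_def)

lemma
  fixes f g :: "real ^ 'n::finite \<Rightarrow> 'b::{banach, second_countable_topology}"
  assumes f: "sq_integrable f" and g: "sq_integrable g"
  shows sq_integrable_add: "sq_integrable (\<lambda>x. f x + g x)"
    and l2n_triangle: "l2n (\<lambda>x. f x + g x) \<le> l2n f + l2n g"
proof -
  have [measurable]: "f \<in> borel_measurable borel" "g \<in> borel_measurable borel"
    using assms by auto
  have If: "integrable lborel (\<lambda>x. (norm (f x))\<^sup>2)" and Ig: "integrable lborel (\<lambda>x. (norm (g x))\<^sup>2)"
    using assms by (auto simp: sq_integrable_def)
  let ?w = "\<lambda>x. (norm (f x))\<^sup>2 + (norm (g x))\<^sup>2 + 2 * (norm (f x) * norm (g x))"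
  have w: "integrable lborel ?w"
    using If Ig l2n_Cauchy_Schwarz(1)[OF f g] by simp
  have le: "(norm (f x + g x))\<^sup>2 \<le> ?w x" for x
  proof -
    have "(norm (f x + g x))\<^sup>2 \<le> (norm (f x) + norm (g x))\<^sup>2"
      by (intro power_mono norm_triangle_ineq) simp
    then show ?thesis by (simp add: power2_sum)
  qed
  show *: "sq_integrable (\<lambda>x. f x + g x)"
    unfolding sq_integrable_def
  proof (intro conjI)
    show "integrable lborel (\<lambda>x. (norm (f x + g x))\<^sup>2)"
    proof (rule Bochner_Integration.integrable_bound[OF w])
      show "AE x in lborel. norm ((norm (f x + g x))\<^sup>2) \<le> norm (?w x)"
      proof (rule AE_I2)
        fix x
        have "norm ((norm (f x + g x))\<^sup>2) = (norm (f x + g x))\<^sup>2" by simp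
        also have "\<dots> \<le> ?w x" by (rule le)
        also have "\<dots> \<le> norm (?w x)" unfolding real_norm_def by (rule abs_ge_self)
        finally show "norm ((norm (f x + g x))\<^sup>2) \<le> norm (?w x)" .
      qed
    qed simp
  qed simp
  have "(l2n (\<lambda>x. f x + g x))\<^sup>2 \<le> (\<integral>x. ?w x \<partial>lborel)"
    unfolding l2n_square using * w le by (intro integral_mono) (auto simp: sq_integrable_def)
  also have "\<dots> = (l2n f)\<^sup>2 + (l2n g)\<^sup>2 + 2 * (\<integral>x. norm (f x) * norm (g x) \<partial>lborel)"
    using If Ig l2n_Cauchy_Schwarz(1)[OF f g] by (simp add: l2n_square)
  also have "\<dots> \<le> (l2n f + l2n g)\<^sup>2"
    using l2n_Cauchy_Schwarz(2)[OF f g] by (simp add: power2_sum)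
  finally show "l2n (\<lambda>x. f x + g x) \<le> l2n f + l2n g"
    by (rule power2_le_imp_le) simp
qed

lemma
  assumes f: "sq_integrable f" and g: "sq_integrable g"
  shows sq_integrable_diff: "sq_integrable (\<lambda>x. f x - g x)"
    and l2n_triangle_diff: "l2n (\<lambda>x. f x - g x) \<le> l2n f + l2n g"
  using sq_integrable_add[OF f sq_integrable_scaleR(1)[OF g, of "-1"]]
    l2n_triangle[OF f sq_integrable_scaleR(1)[OF g, of "-1"]] sq_integrable_scaleR(2)[OF g, of "-1"]
  by auto

lemma l2n_minus_commute: "l2n (\<lambda>x. f x - g x) = l2n (\<lambda>x. g x - f x)"
  unfolding l2n_def by (simp add: norm_minus_commute)

lemma l2n_triangle3:
  assumes "sq_integrable f" "sq_integrable g" "sq_integrable h"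
  shows "l2n (\<lambda>x. f x - h x) \<le> l2n (\<lambda>x. f x - g x) + l2n (\<lambda>x. g x - h x)"
  using l2n_triangle[OF sq_integrable_diff[OF assms(1,2)] sq_integrable_diff[OF assms(2,3)]] by simp

lemma gauss_sq_integrable: "sq_integrable (gauss :: real^'n::finite \<Rightarrow> real)"
  unfolding sq_integrable_def
proof (intro conjI)
  show "integrable lborel (\<lambda>x::real^'n. (norm (gauss x))\<^sup>2)"
    by (rule Bochner_Integration.integrable_bound[OF integrable_gauss])
       (auto simp: gauss_le_1 gauss_pos less_imp_le power2_eq_square mult_left_le)
qed simp

text \<open>
  The measure of the whole space is infinite, but after multiplication by \<open>gauss\<close> a Cauchy sequence in $L^2$
  is one in $L^1$ by the Cauchy--Schwarz inequality, and so has a subsequence that converges almost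
  everywhere. Fatou's lemma shows that its pointwise limit is the limit in $L^2$.
\<close>

theorem sq_integrable_complete:
  fixes f :: "nat \<Rightarrow> real ^ 'n::finite \<Rightarrow> 'b::{banach, second_countable_topology}"
  assumes f: "\<And>n. sq_integrable (f n)"
    and Cauchy: "\<And>e. 0 < e \<Longrightarrow> \<exists>N. \<forall>i\<ge>N. \<forall>j\<ge>N. l2n (\<lambda>x. f i x - f j x) < e"
  obtains g where "sq_integrable g" "(\<lambda>n. l2n (\<lambda>x. f n x - g x)) \<longlonglongrightarrow> 0"
proof -
  have [measurable]: "f n \<in> borel_measurable borel" for n
    using f by auto
  let ?s = "\<lambda>n x. gauss x *\<^sub>R f n x"
  have fn: "sq_integrable (\<lambda>x. norm (f n x))" for n
    using f[of n] by (simp add: sq_integrable_def)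
  have s: "integrable lborel (?s n)" for n
    by (rule Bochner_Integration.integrable_bound[OF l2n_Cauchy_Schwarz(1)[OF gauss_sq_integrable fn[of n]]]) (auto simp: abs_of_pos[OF gauss_pos] gauss_pos less_imp_le)
  have dd: "sq_integrable (\<lambda>x. norm (f i x - f j x))" "l2n (\<lambda>x. norm (f i x - f j x)) = l2n (\<lambda>x. f i x - f j x)" for i j
    using sq_integrable_diff[OF f f, of i j] by (auto simp: sq_integrable_def l2n_def)
  have C1: "\<exists>N. \<forall>i\<ge>N. \<forall>j\<ge>N. LINT x|lborel. norm (?s i x - ?s j x) < e" if e: "0 < e" for e
  proof -
    \<comment> \<open>The summand 1 only serves to make the divisor positive.\<close>
    let ?c = "l2n (gauss :: real^'n \<Rightarrow> real) + 1"
    have c: "0 < ?c" by (simp add: add_nonneg_pos)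
    obtain N where N: "\<And>i j. i \<ge> N \<Longrightarrow> j \<ge> N \<Longrightarrow> l2n (\<lambda>x. f i x - f j x) < e / ?c"
      using Cauchy[of "e / ?c"] e c by (auto simp: divide_pos_pos)
    have "(LINT x|lborel. norm (?s i x - ?s j x)) < e" if "i \<ge> N" "j \<ge> N" for i j
    proof -
      have "(LINT x|lborel. norm (?s i x - ?s j x)) = (LINT x|lborel. norm (gauss x) * norm (norm (f i x - f j x)))"
        by (simp add: scaleR_diff_right[symmetric])
      also have "\<dots> \<le> l2n (gauss :: real^'n \<Rightarrow> real) * l2n (\<lambda>x. f i x - f j x)"
        using l2n_Cauchy_Schwarz(2)[OF gauss_sq_integrable dd(1)[of i j]] unfolding dd(2) .
      also have "\<dots> \<le> ?c * l2n (\<lambda>x. f i x - f j x)"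
        by (rule mult_right_mono) auto
      also have "\<dots> < e"
        using N[OF that] c by (simp add: pos_less_divide_eq mult.commute)
      finally show ?thesis .
    qed
    then show ?thesis by blast
  qed
  \<comment> \<open>The Gaussian is positive, so the unweighted subsequence converges almost everywhere, too.\<close>
  obtain r where r: "strict_mono r" and ae: "AE x in lborel. Cauchy (\<lambda>i. ?s (r i) x)"
    using cauchy_L1_AE_cauchy_subseq[OF s C1] by blast
  define g where "g x = lim (\<lambda>i. f (r i) x)" for x
  have [measurable]: "g \<in> borel_measurable borel"
    unfolding g_def by measurable
  have lim: "AE x in lborel. (\<lambda>i. f (r i) x) \<longlonglongrightarrow> g x"
    using ae
  proof eventually_elim
    fix x assume "Cauchy (\<lambda>i. ?s (r i) x)"
    then have "convergent (\<lambda>i. ?s (r i) x)"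
      by (rule Cauchy_convergent)
    then obtain L where L: "(\<lambda>i. ?s (r i) x) \<longlonglongrightarrow> L"
      by (auto simp: convergent_def)
    have "gauss x \<noteq> 0" using gauss_pos[of x] by simp
    then have "(\<lambda>i. f (r i) x) \<longlonglongrightarrow> (1 / gauss x) *\<^sub>R L"
      using tendsto_scaleR[OF tendsto_const[of "1 / gauss x"] L] by simp
    then have "convergent (\<lambda>i. f (r i) x)"
      by (auto simp: convergent_def)
    then show "(\<lambda>i. f (r i) x) \<longlonglongrightarrow> g x"
      unfolding g_def by (rule convergent_LIMSEQ_iff[THEN iffD1])
  qed
  have key: "sq_integrable (\<lambda>x. f n x - g x) \<and> l2n (\<lambda>x. f n x - g x) \<le> e"
    if e: "0 \<le> e" and N: "\<And>i. i \<ge> N \<Longrightarrow> l2n (\<lambda>x. f n x - f i x) \<le> e" for n N e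
  proof -
    have "(\<integral>\<^sup>+x. ennreal ((norm (f n x - g x))\<^sup>2) \<partial>lborel) = (\<integral>\<^sup>+x. liminf (\<lambda>i. ennreal ((norm (f n x - f (r i) x))\<^sup>2)) \<partial>lborel)"
      using lim
    proof (intro nn_integral_cong_AE, eventually_elim)
      fix x assume "(\<lambda>i. f (r i) x) \<longlonglongrightarrow> g x"
      then have "(\<lambda>i. ennreal ((norm (f n x - f (r i) x))\<^sup>2)) \<longlonglongrightarrow> ennreal ((norm (f n x - g x))\<^sup>2)"
        by (intro tendsto_ennrealI tendsto_intros)
      from lim_imp_Liminf[OF _ this]
      show "ennreal ((norm (f n x - g x))\<^sup>2) = liminf (\<lambda>i. ennreal ((norm (f n x - f (r i) x))\<^sup>2))"
        by simp
    qed
    also have "\<dots> \<le> liminf (\<lambda>i. \<integral>\<^sup>+x. ennreal ((norm (f n x - f (r i) x))\<^sup>2) \<partial>lborel)"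
      by (rule nn_integral_liminf) measurable
    also have "\<dots> \<le> liminf (\<lambda>i::nat. ennreal (e\<^sup>2))"
    proof (rule Liminf_mono, rule eventually_sequentiallyI)
      fix i assume "N \<le> i"
      then have "N \<le> r i" using seq_suble[OF r, of i] by linarith
      from N[OF this] have "(l2n (\<lambda>x. f n x - f (r i) x))\<^sup>2 \<le> e\<^sup>2"
        by (intro power_mono) auto
      then show "(\<integral>\<^sup>+x. ennreal ((norm (f n x - f (r i) x))\<^sup>2) \<partial>lborel) \<le> ennreal (e\<^sup>2)"
        using sq_integrable_diff[OF f f, of n "r i"]
        by (subst nn_integral_eq_integral) (auto simp: sq_integrable_def l2n_square intro: ennreal_leI)
    qed
    finally have le: "(\<integral>\<^sup>+x. ennreal ((norm (f n x - g x))\<^sup>2) \<partial>lborel) \<le> ennreal (e\<^sup>2)"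
      by (simp add: Liminf_const)
    have I: "integrable lborel (\<lambda>x. (norm (f n x - g x))\<^sup>2)"
      by (rule integrableI_bounded) (use le in \<open>auto simp: top_unique less_top[symmetric]\<close>)
    moreover have "(l2n (\<lambda>x. f n x - g x))\<^sup>2 \<le> e\<^sup>2"
      using le unfolding l2n_square by (subst (asm) nn_integral_eq_integral[OF I]) auto
    ultimately show ?thesis
      using e by (auto simp: sq_integrable_def intro: power2_le_imp_le)
  qed
  show ?thesis
  proof (rule that)
    obtain N where N: "\<And>i j. i \<ge> N \<Longrightarrow> j \<ge> N \<Longrightarrow> l2n (\<lambda>x. f i x - f j x) < 1"
      using Cauchy[of 1] by auto
    have "sq_integrable (\<lambda>x. f N x - g x)"
      using key[of 1 N N] N[of N] by (auto simp: less_imp_le)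
    from sq_integrable_diff[OF f[of N] this] show "sq_integrable g"
      by simp
    show "(\<lambda>n. l2n (\<lambda>x. f n x - g x)) \<longlonglongrightarrow> 0"
    proof (rule LIMSEQ_I)
      fix e :: real assume e: "0 < e"
      obtain N where N: "\<And>i j. i \<ge> N \<Longrightarrow> j \<ge> N \<Longrightarrow> l2n (\<lambda>x. f i x - f j x) < e / 2"
        using Cauchy[of "e / 2"] e by auto
      have "l2n (\<lambda>x. f n x - g x) \<le> e / 2" if "n \<ge> N" for n
        using key[of "e / 2" N n] N[OF that] e by (auto simp: less_imp_le)
      then show "\<exists>N. \<forall>n\<ge>N. norm (l2n (\<lambda>x. f n x - g x) - 0) < e"
        using e by (intro exI[of _ N]) force
    qed
  qed
qed

lemma sq_integrable_truncate:
  fixes f :: "real ^ 'n::finite \<Rightarrow> complex"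
  assumes f: "sq_integrable f"
  defines "t \<equiv> \<lambda>n x. if norm x \<le> real n then f x else 0"
  shows "sq_integrable (t n)" "integrable lborel (t n)" "(\<lambda>n. l2n (\<lambda>x. t n x - f x)) \<longlonglongrightarrow> 0"
proof -
  have [measurable]: "f \<in> borel_measurable borel" using f by auto
  have [measurable]: "t n \<in> borel_measurable borel" for n unfolding t_def by measurable
  have If: "integrable lborel (\<lambda>x. (norm (f x))\<^sup>2)" using f by (simp add: sq_integrable_def)
  show sq: "sq_integrable (t n)" for n
    by (rule sq_integrable_bound[OF f]) (auto simp: t_def)
  show "integrable lborel (t n)"
  proof -
    have [measurable]: "indicat_real (cball (0::real^'n) (real n)) \<in> borel_measurable borel"
      by (rule borel_measurable_indicator) simp
    have "integrable lborel (\<lambda>x. t n x * indicat_real (cball 0 (real n)) x)"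
    proof (rule integrable_square_imp_product)
      have "emeasure lborel (cball (0::real^'n) (real n)) < \<infinity>"
        by (rule emeasure_bounded_finite) simp
      then have "integrable lborel (indicat_real (cball (0::real^'n) (real n)))"
        by (intro integrable_real_indicator) auto
      then show "integrable lborel (\<lambda>x. (norm (complex_of_real (indicat_real (cball (0::real^'n) (real n)) x)))\<^sup>2)"
        by (rule Bochner_Integration.integrable_bound) (auto simp: indicator_def)
    qed (use sq[of n] in \<open>auto simp: sq_integrable_def\<close>)
    then show ?thesis
      by (rule Bochner_Integration.integrable_bound) (auto simp: t_def indicator_def)
  qed
  have "(\<lambda>n. \<integral>x. (norm (t n x - f x))\<^sup>2 \<partial>lborel) \<longlonglongrightarrow> (\<integral>x. 0 \<partial>(lborel :: (real^'n) measure))"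
  proof (rule integral_dominated_convergence[OF _ _ If])
    show "AE x in lborel. (\<lambda>n. (norm (t n x - f x))\<^sup>2) \<longlonglongrightarrow> 0"
    proof (rule AE_I2)
      fix x :: "real^'n"
      obtain N where N: "norm x \<le> real N" using real_arch_simple by blast
      have "(norm (t n x - f x))\<^sup>2 = 0" if "N \<le> n" for n
      proof -
        have "norm x \<le> real n" using N that by (meson le_trans of_nat_mono order_trans)
        then show ?thesis by (simp add: t_def)
      qed
      then show "(\<lambda>n. (norm (t n x - f x))\<^sup>2) \<longlonglongrightarrow> 0"
        by (intro tendsto_eventually) (auto simp: eventually_sequentially)
    qed
    show "AE x in lborel. norm ((norm (t n x - f x))\<^sup>2) \<le> (norm (f x))\<^sup>2" for n
      by (auto simp: t_def)
  qed measurable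
  then show "(\<lambda>n. l2n (\<lambda>x. t n x - f x)) \<longlonglongrightarrow> 0"
    unfolding l2n_def using tendsto_real_sqrt by fastforce
qed

section \<open>The Fourier transform on square integrable functions\<close>

lemma integral_L2_limit:
  fixes f :: "nat \<Rightarrow> real ^ 'n::finite \<Rightarrow> complex"
  assumes f: "\<And>n. sq_integrable (f n)" and g: "sq_integrable g" and lim: "(\<lambda>n. l2n (\<lambda>x. f n x - g x)) \<longlonglongrightarrow> 0"
    and h: "sq_integrable h"
  shows "(\<lambda>n. \<integral>x. f n x * h x \<partial>lborel) \<longlonglongrightarrow> (\<integral>x. g x * h x \<partial>lborel)"
proof -
  have I: "integrable lborel (\<lambda>x. k x * h x)" if "sq_integrable k" for k
    by (rule integrable_square_imp_product) (use that h in \<open>auto simp: sq_integrable_def\<close>)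
  have "(\<lambda>n. (\<integral>x. f n x * h x \<partial>lborel) - (\<integral>x. g x * h x \<partial>lborel)) \<longlonglongrightarrow> 0"
  proof (rule Lim_null_comparison)
    show "\<forall>\<^sub>F n in sequentially. norm ((\<integral>x. f n x * h x \<partial>lborel) - (\<integral>x. g x * h x \<partial>lborel)) \<le> l2n (\<lambda>x. f n x - g x) * l2n h"
    proof (rule always_eventually, rule allI)
      fix n
      have "(\<integral>x. f n x * h x \<partial>lborel) - (\<integral>x. g x * h x \<partial>lborel) = (\<integral>x. (f n x - g x) * h x \<partial>lborel)"
        using I[OF f] I[OF g] by (simp add: left_diff_distrib)
      also have "norm \<dots> \<le> (\<integral>x. norm ((f n x - g x) * h x) \<partial>lborel)"
        by (rule integral_norm_bound)
      also have "\<dots> \<le> l2n (\<lambda>x. f n x - g x) * l2n h"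
        using l2n_Cauchy_Schwarz(2)[OF sq_integrable_diff[OF f[of n] g] h] by (simp add: norm_mult)
      finally show "norm ((\<integral>x. f n x * h x \<partial>lborel) - (\<integral>x. g x * h x \<partial>lborel)) \<le> l2n (\<lambda>x. f n x - g x) * l2n h" .
    qed
    show "(\<lambda>n. l2n (\<lambda>x. f n x - g x) * l2n h) \<longlonglongrightarrow> 0"
      using tendsto_mult_right[OF lim, of "l2n h"] by simp
  qed
  then show ?thesis by (rule LIM_zero_cancel)
qed

lemma rapid_sq_integrable:
  assumes "rapid \<phi>" shows "sq_integrable \<phi>"
proof -
  obtain B where B: "\<And>x. norm (\<phi> x) \<le> B" by (rule rapid_bounded[OF assms]) blast
  have "integrable lborel (\<lambda>x. \<phi> x * \<phi> x)"
    by (rule integrable_bounded_mult[OF rapid_integrable[OF assms] _ B]) (simp add: rapid_measurable[OF assms])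
  then have "integrable lborel (\<lambda>x. norm (\<phi> x * \<phi> x))" by (rule integrable_norm)
  then show ?thesis
    using rapid_measurable[OF assms] by (simp add: sq_integrable_def norm_mult power2_eq_square)
qed

lemma sq_integrable_tempered: "sq_integrable f \<Longrightarrow> tempered_fun f"
  by (auto simp: sq_integrable_def intro: tempered_fun_square_integrable)

lemma has_fourier_L2_limit:
  fixes f g :: "nat \<Rightarrow> 'n::finite sfield"
  assumes h: "\<And>n. has_fourier (f n) (g n)"
    and f: "\<And>n. sq_integrable (f n)" "sq_integrable f'" "(\<lambda>n. l2n (\<lambda>x. f n x - f' x)) \<longlonglongrightarrow> 0"
    and g: "\<And>n. sq_integrable (g n)" "sq_integrable g'" "(\<lambda>n. l2n (\<lambda>x. g n x - g' x)) \<longlonglongrightarrow> 0"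
  shows "has_fourier f' g'"
  unfolding has_fourier_def
proof (intro conjI allI impI)
  fix \<phi> :: "'n sfield" assume \<phi>: "schwartz \<phi>"
  have "(\<lambda>n. \<integral>x. f n x * fourier_int \<phi> x \<partial>lborel) \<longlonglongrightarrow> (\<integral>x. f' x * fourier_int \<phi> x \<partial>lborel)"
    by (rule integral_L2_limit[OF f rapid_sq_integrable[OF schwartz_rapid_fourier_int[OF \<phi>]]])
  moreover have "(\<lambda>n. \<integral>x. g n x * \<phi> x \<partial>lborel) \<longlonglongrightarrow> (\<integral>x. g' x * \<phi> x \<partial>lborel)"
    by (rule integral_L2_limit[OF g rapid_sq_integrable[OF schwartz_rapid[OF \<phi>]]])
  moreover have "(\<integral>x. f n x * fourier_int \<phi> x \<partial>lborel) = (\<integral>x. g n x * \<phi> x \<partial>lborel)" for n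
    using h[of n] \<phi> by (simp add: has_fourier_def)
  ultimately show "(\<integral>x. f' x * fourier_int \<phi> x \<partial>lborel) = (\<integral>x. g' x * \<phi> x \<partial>lborel)"
    using LIMSEQ_unique by fastforce
qed (use f g in \<open>auto intro: sq_integrable_tempered\<close>)

text \<open>
  An operator that is bounded in the $L^2$ norm on integrable, square integrable functions extends to $L^2$:
  apply it to the truncations of \<open>f\<close> to balls, which converge to \<open>f\<close>.
\<close>

lemma L2_extension:
  fixes K :: "'n::finite sfield \<Rightarrow> 'n sfield"
  assumes C: "0 \<le> C"
    and K: "\<And>h. integrable lborel h \<Longrightarrow> sq_integrable h \<Longrightarrow> sq_integrable (K h) \<and> l2n (K h) \<le> C * l2n h"
    and Kdiff: "\<And>h h'. integrable lborel h \<Longrightarrow> integrable lborel h' \<Longrightarrow> K (\<lambda>x. h x - h' x) = (\<lambda>x. K h x - K h' x)"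
    and f: "sq_integrable f"
  obtains k where "sq_integrable k" "l2n k \<le> C * l2n f"
    "(\<lambda>n. l2n (\<lambda>x. K (\<lambda>x. if norm x \<le> real n then f x else 0) x - k x)) \<longlonglongrightarrow> 0"
proof -
  let ?t = "\<lambda>n x. if norm x \<le> real n then f x else 0"
  note t = sq_integrable_truncate[OF f]
  have tC: "\<exists>N. \<forall>n\<ge>N. l2n (\<lambda>x. ?t n x - f x) < e" if "0 < e" for e
    using order_tendstoD(2)[OF t(3) that] by (simp add: eventually_sequentially)
  have KC: "\<exists>N. \<forall>i\<ge>N. \<forall>j\<ge>N. l2n (\<lambda>x. K (?t i) x - K (?t j) x) < e" if e: "0 < e" for e
  proof -
    \<comment> \<open>The denominator with \<open>C + 1\<close> covers the case \<open>C = 0\<close> as well.\<close>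
    have c: "0 < e / (2 * (C + 1))" using e C by simp
    obtain N where N: "\<And>n. n \<ge> N \<Longrightarrow> l2n (\<lambda>x. ?t n x - f x) < e / (2 * (C + 1))"
      using tC[OF c] by blast
    have "l2n (\<lambda>x. K (?t i) x - K (?t j) x) < e" if "i \<ge> N" "j \<ge> N" for i j
    proof -
      have "l2n (\<lambda>x. K (?t i) x - K (?t j) x) = l2n (K (\<lambda>x. ?t i x - ?t j x))"
        using Kdiff[OF t(2) t(2)] by simp
      also have "\<dots> \<le> C * l2n (\<lambda>x. ?t i x - ?t j x)"
        using K[OF Bochner_Integration.integrable_diff[OF t(2) t(2)] sq_integrable_diff[OF t(1) t(1)]] by blast
      also have "\<dots> \<le> C * (l2n (\<lambda>x. ?t i x - f x) + l2n (\<lambda>x. f x - ?t j x))"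
        by (intro mult_left_mono l2n_triangle3 t(1) f C)
      also have "\<dots> \<le> C * (2 * (e / (2 * (C + 1))))"
        using N[OF that(1)] N[OF that(2)] l2n_minus_commute[of f "?t j"] by (intro mult_left_mono C) linarith
      also have "\<dots> = e * (C / (C + 1))" using C by (simp add: field_simps)
      also have "\<dots> < e * 1" using C e by (intro mult_strict_left_mono) auto
      finally show ?thesis by simp
    qed
    then show ?thesis by blast
  qed
  have sqK: "sq_integrable (K (?t n))" for n using K[OF t(2) t(1)] by blast
  obtain k where k: "sq_integrable k" and lim: "(\<lambda>n. l2n (\<lambda>x. K (?t n) x - k x)) \<longlonglongrightarrow> 0"
    using sq_integrable_complete[of "\<lambda>n. K (?t n)", OF sqK KC] by blast
  have "l2n k \<le> C * l2n f"
  proof (rule tendsto_lowerbound)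
    show "(\<lambda>n. l2n (\<lambda>x. K (?t n) x - k x) + C * l2n f) \<longlonglongrightarrow> C * l2n f"
      using tendsto_add[OF lim tendsto_const, of "C * l2n f"] by simp
    show "\<forall>\<^sub>F n in sequentially. l2n k \<le> l2n (\<lambda>x. K (?t n) x - k x) + C * l2n f"
    proof (intro always_eventually allI)
      fix n
      have "l2n k \<le> l2n (\<lambda>x. k x - K (?t n) x) + l2n (K (?t n))"
        using l2n_triangle3[OF k sqK[of n] sq_integrable_zero(1)] by simp
      also have "l2n (K (?t n)) \<le> C * l2n (?t n)"
        using K[OF t(2) t(1)] by blast
      also have "l2n (?t n) \<le> l2n f"
        by (rule sq_integrable_bound[OF f]) (use t(1) in auto)
      finally show "l2n k \<le> l2n (\<lambda>x. K (?t n) x - k x) + C * l2n f"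
        using C by (simp add: l2n_minus_commute mult_left_mono)
    qed
  qed simp
  then show ?thesis using that k lim by blast
qed

lemma fourier_int_diff:
  assumes "integrable lborel h" "integrable lborel h'"
  shows "fourier_int (\<lambda>x. h x - h' x) = (\<lambda>x. fourier_int h x - fourier_int h' x)"
proof
  fix \<xi>
  have "integrable lborel (\<lambda>x. cis (- (x \<bullet> \<xi>)) * h x)" "integrable lborel (\<lambda>x. cis (- (x \<bullet> \<xi>)) * h' x)"
    using assms by (auto intro!: integrable_cis_mult)
  then show "fourier_int (\<lambda>x. h x - h' x) \<xi> = fourier_int h \<xi> - fourier_int h' \<xi>"
    by (simp add: fourier_int_def right_diff_distrib)
qed

lemma fourier_int_sq_integrable:
  fixes h :: "'n::finite sfield"
  assumes h: "integrable lborel h" "sq_integrable h"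
  shows "sq_integrable (fourier_int h)" "l2n (fourier_int h) \<le> gauss_mass TYPE('n) * l2n h"
proof -
  have [measurable]: "h \<in> borel_measurable borel" using h by auto
  have I: "integrable lborel (\<lambda>x. (norm (h x))\<^sup>2)" using h by (simp add: sq_integrable_def)
  show "sq_integrable (fourier_int h)"
    unfolding sq_integrable_def using fourier_int_L2_bound(1)[OF h(1) I] by simp
  have "(l2n (fourier_int h))\<^sup>2 \<le> (gauss_mass TYPE('n) * l2n h)\<^sup>2"
    using fourier_int_L2_bound(2)[OF h(1) I] by (simp add: l2n_square power_mult_distrib)
  then show "l2n (fourier_int h) \<le> gauss_mass TYPE('n) * l2n h"
    by (rule power2_le_imp_le) (simp add: less_imp_le)
qed

lemma inv_fourier_int_sq_integrable:
  fixes h :: "'n::finite sfield"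
  assumes h: "integrable lborel h" "sq_integrable h"
  shows "sq_integrable (inv_fourier_int h)" "l2n (inv_fourier_int h) \<le> (1 / gauss_mass TYPE('n)) * l2n h"
proof -
  let ?T = "gauss_mass TYPE('n)"
  have [measurable]: "h \<in> borel_measurable borel" using h by auto
  have F: "integrable lborel (\<lambda>x. (norm (fourier_int h x))\<^sup>2)"
    using fourier_int_sq_integrable(1)[OF h] by (simp add: sq_integrable_def)
  have eq: "(norm (inv_fourier_int h x))\<^sup>2 = (1 / ?T\<^sup>2)\<^sup>2 * (norm (fourier_int h (- x)))\<^sup>2" for x
    by (simp add: inv_fourier_int_def norm_mult norm_divide norm_power power_mult_distrib power_divide)
  show "sq_integrable (inv_fourier_int h)"
    unfolding sq_integrable_def
  proof (intro conjI)
    show "inv_fourier_int h \<in> borel_measurable borel"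
      unfolding inv_fourier_int_def[abs_def] by measurable
    show "integrable lborel (\<lambda>x. (norm (inv_fourier_int h x))\<^sup>2)"
      unfolding eq by (intro integrable_mult_right integrable_lborel_uminus[OF F])
  qed
  have "(l2n (inv_fourier_int h))\<^sup>2 = (1 / ?T\<^sup>2)\<^sup>2 * (\<integral>x. (norm (fourier_int h (- x)))\<^sup>2 \<partial>lborel)"
    unfolding l2n_square eq by simp
  also have "(\<integral>x. (norm (fourier_int h (- x)))\<^sup>2 \<partial>lborel) = (l2n (fourier_int h))\<^sup>2"
    unfolding l2n_square by (rule integral_lborel_uminus) simp
  also have "(1 / ?T\<^sup>2)\<^sup>2 * \<dots> \<le> (1 / ?T\<^sup>2)\<^sup>2 * (?T * l2n h)\<^sup>2"
    by (intro mult_left_mono power_mono fourier_int_sq_integrable h) auto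
  also have "\<dots> = ((1 / ?T) * l2n h)\<^sup>2"
    by (simp add: power_mult_distrib power_divide power2_eq_square)
  finally show "l2n (inv_fourier_int h) \<le> (1 / ?T) * l2n h"
    by (rule power2_le_imp_le) (simp add: less_imp_le)
qed

lemma L2_fourier_exists:
  fixes f :: "'n::finite sfield"
  assumes f: "sq_integrable f"
  obtains g where "has_fourier f g" "sq_integrable g" "l2n g \<le> gauss_mass TYPE('n) * l2n f"
proof -
  let ?t = "\<lambda>n x. if norm x \<le> real n then f x else 0"
  obtain g where g: "sq_integrable g" "l2n g \<le> gauss_mass TYPE('n) * l2n f"
    "(\<lambda>n. l2n (\<lambda>x. fourier_int (?t n) x - g x)) \<longlonglongrightarrow> 0"
    by (rule L2_extension[of "gauss_mass TYPE('n)" fourier_int f])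
       (use f in \<open>auto simp: less_imp_le fourier_int_sq_integrable fourier_int_diff\<close>)
  note t = sq_integrable_truncate[OF f]
  have "has_fourier f g"
    by (rule has_fourier_L2_limit[OF has_fourier_fourier_int[OF t(2)] t(1) f t(3) _ g(1) g(3)])
       (rule fourier_int_sq_integrable[OF t(2) t(1)])
  then show ?thesis using that g by blast
qed

lemma inv_fourier_int_diff:
  "integrable lborel h \<Longrightarrow> integrable lborel h' \<Longrightarrow>
    inv_fourier_int (\<lambda>x. h x - h' x) = (\<lambda>x. inv_fourier_int h x - inv_fourier_int h' x)"
  by (simp add: inv_fourier_int_def[abs_def] fourier_int_diff diff_divide_distrib)

lemma L2_inv_fourier_exists:
  fixes g :: "'n::finite sfield"
  assumes g: "sq_integrable g"
  obtains f where "has_fourier f g" "sq_integrable f" "l2n f \<le> (1 / gauss_mass TYPE('n)) * l2n g"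
proof -
  let ?t = "\<lambda>n x. if norm x \<le> real n then g x else 0"
  obtain f where f: "sq_integrable f" "l2n f \<le> (1 / gauss_mass TYPE('n)) * l2n g"
    "(\<lambda>n. l2n (\<lambda>x. inv_fourier_int (?t n) x - f x)) \<longlonglongrightarrow> 0"
    by (rule L2_extension[of "1 / gauss_mass TYPE('n)" inv_fourier_int g])
       (use g inv_fourier_int_sq_integrable in \<open>auto simp: less_imp_le inv_fourier_int_diff\<close>)
  note t = sq_integrable_truncate[OF g]
  have "has_fourier f g"
    by (rule has_fourier_L2_limit[OF has_fourier_inv_fourier_int[OF t(2)] _ f(1) f(3) t(1) g t(3)])
       (rule inv_fourier_int_sq_integrable[OF t(2) t(1)])
  then show ?thesis using that f by blast
qed

text \<open>
  On $L^2$ the transform has norm at most \<open>gauss_mass\<close> and the inverse transform has norm at most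
  its reciprocal. By uniqueness \<open>f\<close> and \<open>g\<close> are images of each other under these two maps, and the two
  inequalities combine to an equality.
\<close>

theorem Plancherel:
  fixes f g :: "'n::finite sfield"
  assumes h: "has_fourier f g"
  shows "sq_integrable f \<longleftrightarrow> sq_integrable g"
    and "sq_integrable g \<Longrightarrow> l2n g = gauss_mass TYPE('n) * l2n f"
proof -
  let ?T = "gauss_mass TYPE('n)"
  note [measurable] = has_fourier_measurable[OF h]
  have 1: "sq_integrable g \<and> l2n g \<le> ?T * l2n f" if f: "sq_integrable f"
  proof -
    obtain g' where g': "has_fourier f g'" "sq_integrable g'" "l2n g' \<le> ?T * l2n f"
      by (rule L2_fourier_exists[OF f])
    have "AE x in lborel. g x = g' x" by (rule has_fourier_unique_right[OF h g'(1)])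
    from sq_integrable_cong_AE[OF this] show ?thesis
      using g' has_fourier_measurable[OF g'(1)] by simp
  qed
  have 2: "sq_integrable f \<and> l2n f \<le> (1 / ?T) * l2n g" if g: "sq_integrable g"
  proof -
    obtain f' where f': "has_fourier f' g" "sq_integrable f'" "l2n f' \<le> (1 / ?T) * l2n g"
      by (rule L2_inv_fourier_exists[OF g])
    have "AE x in lborel. f x = f' x" by (rule has_fourier_unique_left[OF h f'(1)])
    from sq_integrable_cong_AE[OF this] show ?thesis
      using f' has_fourier_measurable[OF f'(1)] by simp
  qed
  show "sq_integrable f \<longleftrightarrow> sq_integrable g" using 1 2 by blast
  assume g: "sq_integrable g"
  have "?T * l2n f \<le> ?T * ((1 / ?T) * l2n g)"
    using 2[OF g] by (intro mult_left_mono) (auto simp: less_imp_le)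
  then show "l2n g = ?T * l2n f"
    using 1 2[OF g] by (intro antisym) auto
qed

section \<open>Vector fields\<close>

lemma vec_nth_measurable [measurable (raw)]:
  fixes f :: "'a \<Rightarrow> complex ^ 'n::finite"
  shows "f \<in> borel_measurable M \<Longrightarrow> (\<lambda>x. f x $ j) \<in> borel_measurable M"
  by (rule measurable_compose[OF _ borel_measurable_continuous_onI]) (auto intro!: continuous_intros)

lemma borel_measurable_vec_iff:
  fixes f :: "'a \<Rightarrow> complex ^ 'n::finite"
  shows "f \<in> borel_measurable M \<longleftrightarrow> (\<forall>j. (\<lambda>x. f x $ j) \<in> borel_measurable M)"
proof
  assume f: "\<forall>j. (\<lambda>x. f x $ j) \<in> borel_measurable M"
  show "f \<in> borel_measurable M"
  proof (subst borel_measurable_euclidean_space, rule ballI)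
    fix b :: "complex ^ 'n" assume "b \<in> Basis"
    then obtain j c where b: "b = axis j c" by (auto simp: Basis_vec_def)
    have "(\<lambda>x. f x $ j) \<in> borel_measurable M" using f by blast
    then show "(\<lambda>x. f x \<bullet> b) \<in> borel_measurable M"
      unfolding b inner_axis by measurable
  qed
qed auto

lemma norm_vsmult: "norm (c *s (v :: complex ^ 'n::finite)) = norm c * norm v"
  by (simp add: norm_vec_def norm_mult L2_set_right_distrib)

lemma norm_cvec_square: "(norm (v :: complex ^ 'n::finite))\<^sup>2 = (\<Sum>j\<in>UNIV. (norm (v $ j))\<^sup>2)"
  by (simp add: norm_vec_def L2_set_def sum_nonneg)

lemma vsmult_measurable [measurable (raw)]:
  fixes f :: "'a \<Rightarrow> complex ^ 'n::finite"
  assumes "c \<in> borel_measurable M" "f \<in> borel_measurable M"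
  shows "(\<lambda>x. c x *s f x) \<in> borel_measurable M"
  using assms by (subst borel_measurable_vec_iff) (auto intro!: borel_measurable_times vec_nth_measurable)

lemma sq_integrable_vec_iff:
  fixes f :: "'n::finite vfield"
  shows "sq_integrable f \<longleftrightarrow> (\<forall>j. sq_integrable (\<lambda>x. f x $ j))" (is "?L \<longleftrightarrow> ?R")
    and "sq_integrable f \<Longrightarrow> (l2n f)\<^sup>2 = (\<Sum>j\<in>UNIV. (l2n (\<lambda>x. f x $ j))\<^sup>2)"
proof -
  show *: "?L \<longleftrightarrow> ?R"
  proof
    assume f: ?L
    then have [measurable]: "f \<in> borel_measurable borel" by auto
    have "integrable lborel (\<lambda>x. (norm (f x))\<^sup>2)" using f by (simp add: sq_integrable_def)
    then have "integrable lborel (\<lambda>x. (norm (f x $ j))\<^sup>2)" for j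
      by (rule Bochner_Integration.integrable_bound) (auto simp: component_le_norm_cart Finite_Cartesian_Product.norm_nth_le intro!: power_mono)
    then show ?R by (auto simp: sq_integrable_def)
  next
    assume ?R
    then show ?L
      unfolding sq_integrable_def borel_measurable_vec_iff[of f] norm_cvec_square by auto
  qed
  assume "sq_integrable f"
  then show "(l2n f)\<^sup>2 = (\<Sum>j\<in>UNIV. (l2n (\<lambda>x. f x $ j))\<^sup>2)"
    unfolding * unfolding l2n_square norm_cvec_square by (auto simp: sq_integrable_def)
qed

lemma L2_eq: "f \<in> L2 \<longleftrightarrow> sq_integrable f" "L2_norm f = l2n f"
  by (auto simp: L2_def L2_norm_def sq_integrable_def l2n_def)

definition vhas_fourier :: "'n::finite vfield \<Rightarrow> 'n vfield \<Rightarrow> bool" where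
  "vhas_fourier f g \<longleftrightarrow> (\<forall>j. has_fourier (\<lambda>x. f x $ j) (\<lambda>\<xi>. g \<xi> $ j))"

lemma vhas_fourier_measurable:
  "vhas_fourier f g \<Longrightarrow> f \<in> borel_measurable borel" "vhas_fourier f g \<Longrightarrow> g \<in> borel_measurable borel"
  unfolding vhas_fourier_def borel_measurable_vec_iff by (auto dest: has_fourier_measurable)

lemma vhas_fourier_diff:
  "vhas_fourier f g \<Longrightarrow> vhas_fourier f' g' \<Longrightarrow> vhas_fourier (\<lambda>x. f x - f' x) (\<lambda>x. g x - g' x)"
  unfolding vhas_fourier_def by (auto intro: has_fourier_diff)

lemma AE_vec_eqI:
  fixes f g :: "'a \<Rightarrow> complex ^ 'n::finite"
  assumes "\<And>j. AE x in M. f x $ j = g x $ j"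
  shows "AE x in M. f x = g x"
proof -
  have "AE x in M. \<forall>j\<in>UNIV. f x $ j = g x $ j"
    by (rule AE_finite_allI) (use assms in auto)
  then show ?thesis by (simp add: vec_eq_iff)
qed

lemma vhas_fourier_unique_left:
  "vhas_fourier f g \<Longrightarrow> vhas_fourier f' g \<Longrightarrow> AE x in lborel. f x = f' x"
  unfolding vhas_fourier_def by (intro AE_vec_eqI has_fourier_unique_left) auto

lemma vhas_fourier_cong_left:
  assumes "vhas_fourier f g" and ae: "AE x in lborel. f x = f' x" and "f' \<in> borel_measurable borel"
  shows "vhas_fourier f' g"
  unfolding vhas_fourier_def
proof
  fix j
  have [measurable]: "g \<in> borel_measurable borel" by (rule vhas_fourier_measurable[OF assms(1)])
  show "has_fourier (\<lambda>x. f' x $ j) (\<lambda>\<xi>. g \<xi> $ j)"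
    by (rule has_fourier_cong_AE[of "\<lambda>x. f x $ j" "\<lambda>\<xi>. g \<xi> $ j"])
       (use assms in \<open>auto simp: vhas_fourier_def\<close>)
qed

theorem vector_Plancherel:
  fixes f g :: "'n::finite vfield"
  assumes h: "vhas_fourier f g"
  shows "sq_integrable f \<longleftrightarrow> sq_integrable g"
    and "sq_integrable g \<Longrightarrow> l2n f = l2n g / gauss_mass TYPE('n)"
proof -
  let ?T = "gauss_mass TYPE('n)"
  have hj: "has_fourier (\<lambda>x. f x $ j) (\<lambda>x. g x $ j)" for j
    using h by (simp add: vhas_fourier_def)
  show *: "sq_integrable f \<longleftrightarrow> sq_integrable g"
    unfolding sq_integrable_vec_iff(1)[of f] sq_integrable_vec_iff(1)[of g] using Plancherel(1)[OF hj] by simp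
  assume g: "sq_integrable g"
  then have f: "sq_integrable f" using * by simp
  have gj: "sq_integrable (\<lambda>x. g x $ j)" for j
    using g by (simp add: sq_integrable_vec_iff)
  have "(l2n g)\<^sup>2 = (?T * l2n f)\<^sup>2"
    unfolding power_mult_distrib sq_integrable_vec_iff(2)[OF f] sq_integrable_vec_iff(2)[OF g] sum_distrib_left
    by (intro sum.cong refl) (simp add: Plancherel(2)[OF hj gj] power_mult_distrib)
  then have "l2n g = ?T * l2n f"
    by (simp add: power2_eq_iff_nonneg less_imp_le)
  then show "l2n f = l2n g / ?T" by simp
qed

lemma vhas_fourier_vecI:
  assumes "\<And>j. \<exists>f. has_fourier f (\<lambda>\<xi>. g \<xi> $ j)"
  obtains f where "vhas_fourier f g"
proof -
  from assms have "\<forall>j. \<exists>f. has_fourier f (\<lambda>\<xi>. g \<xi> $ j)" by blast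
  then obtain F where "\<And>j. has_fourier (F j) (\<lambda>\<xi>. g \<xi> $ j)" by metis
  then have "vhas_fourier (\<lambda>x. \<chi> j. F j x) g" by (simp add: vhas_fourier_def)
  then show ?thesis by (rule that)
qed

text \<open>
  The operator \<open>fmult\<close> chooses some function with the required transform. As the transform of the argument is
  unique, every choice has transform $m\hat f$, provided that a function with this transform exists.
\<close>

lemma fmult_vec_vhas_fourier:
  assumes f: "vhas_fourier f g" and ex: "vhas_fourier h (\<lambda>\<xi>. m \<xi> *s g \<xi>)"
  shows "vhas_fourier (fmult_vec m f) (\<lambda>\<xi>. m \<xi> *s g \<xi>)"
  unfolding vhas_fourier_def
proof
  fix j
  have fj: "has_fourier (\<lambda>x. f x $ j) (\<lambda>\<xi>. g \<xi> $ j)" and hj: "has_fourier (\<lambda>x. h x $ j) (\<lambda>\<xi>. m \<xi> * g \<xi> $ j)"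
    using f ex by (auto simp: vhas_fourier_def)
  then have "has_multiplier m (\<lambda>x. f x $ j) (\<lambda>x. h x $ j)"
    unfolding has_multiplier_def by blast
  then have "has_multiplier m (\<lambda>x. f x $ j) (fmult m (\<lambda>x. f x $ j))"
    unfolding fmult_def by (rule someI[where P="has_multiplier m (\<lambda>x. f x $ j)"])
  then obtain g' where g': "has_fourier (\<lambda>x. f x $ j) g'" "has_fourier (fmult m (\<lambda>x. f x $ j)) (\<lambda>\<xi>. m \<xi> * g' \<xi>)"
    unfolding has_multiplier_def by blast
  have "AE \<xi> in lborel. g' \<xi> = g \<xi> $ j"
    by (rule has_fourier_unique_right[OF g'(1) fj])
  then have ae: "AE \<xi> in lborel. m \<xi> * g' \<xi> = m \<xi> * g \<xi> $ j" by eventually_elim simp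
  have "has_fourier (fmult m (\<lambda>x. f x $ j)) (\<lambda>\<xi>. m \<xi> * g \<xi> $ j)"
    by (rule has_fourier_cong_AE[OF g'(2) _ _ ae has_fourier_measurable(2)[OF hj]])
       (use has_fourier_measurable[OF g'(2)] in auto)
  then show "has_fourier (\<lambda>x. fmult_vec m f x $ j) (\<lambda>\<xi>. (m \<xi> *s g \<xi>) $ j)"
    by (simp add: fmult_vec_def)
qed

lemma vhas_fourier_vcnj:
  assumes "vhas_fourier f g"
  shows "vhas_fourier (vcnj f) (vcnj (\<lambda>\<xi>. g (- \<xi>)))"
  using assms unfolding vhas_fourier_def vcnj_def by (auto intro: has_fourier_cnj)

lemma L2_inv_fourier_vec:
  fixes g :: "'n::finite vfield"
  assumes "sq_integrable g"
  obtains f where "vhas_fourier f g"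
proof (rule vhas_fourier_vecI)
  fix j
  have "sq_integrable (\<lambda>\<xi>. g \<xi> $ j)" using assms by (simp add: sq_integrable_vec_iff)
  then show "\<exists>f. has_fourier f (\<lambda>\<xi>. g \<xi> $ j)" by (metis L2_inv_fourier_exists)
qed (rule that)

lemma propagator_vhas_fourier_L2:
  fixes f g :: "'n::finite vfield"
  assumes f: "vhas_fourier f g" and g: "sq_integrable g"
  shows "vhas_fourier (propagator \<sigma> t f) (\<lambda>\<xi>. cis (- (t * \<sigma> * (norm \<xi>)\<^sup>2)) *s g \<xi>)"
proof -
  have [measurable]: "g \<in> borel_measurable borel" using g by auto
  have "sq_integrable (\<lambda>\<xi>. cis (- (t * \<sigma> * (norm \<xi>)\<^sup>2)) *s g \<xi>)"
    by (rule sq_integrable_bound[OF g]) (auto simp: norm_vsmult)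
  then obtain h where "vhas_fourier h (\<lambda>\<xi>. cis (- (t * \<sigma> * (norm \<xi>)\<^sup>2)) *s g \<xi>)"
    by (rule L2_inv_fourier_vec)
  then show ?thesis
    unfolding propagator_def by (rule fmult_vec_vhas_fourier[OF f])
qed

section \<open>The dyadic decomposition\<close>

lemma dyadic_pos: "N \<in> dyadic \<Longrightarrow> 0 < N"
  by (auto simp: dyadic_def)

lemma log_powi_two: "log 2 (2 powi k) = real_of_int k"
  by (simp add: powr_real_of_int'[symmetric])

lemma dyadic_countable: "countable dyadic" and dyadic_infinite: "infinite dyadic"
proof -
  show "countable dyadic" by (simp add: dyadic_def)
  have "inj (\<lambda>k::int. (2::real) powi k)"
    by (metis injI log_powi_two of_int_eq_iff)
  then show "infinite dyadic"
    unfolding dyadic_def by (simp add: finite_image_iff infinite_UNIV_int)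
qed

text \<open>
  An enumeration of the dyadic numbers. It turns the sums over all dyadic numbers, whose terms are non-negative,
  into series.
\<close>

definition dy :: "nat \<Rightarrow> real" where "dy = from_nat_into dyadic"

lemma dy_bij: "bij_betw dy UNIV dyadic"
  unfolding dy_def by (rule bij_betw_from_nat_into[OF dyadic_countable dyadic_infinite])

lemma dy_in [simp]: "dy n \<in> dyadic"
  using dy_bij by (auto simp: bij_betw_def)

lemma dy_pos [simp]: "0 < dy n"
  by (rule dyadic_pos[OF dy_in])

lemma all_dyadic_iff: "(\<forall>N\<in>dyadic. P N) \<longleftrightarrow> (\<forall>n. P (dy n))"
  using dy_bij unfolding bij_betw_def by (metis dy_in imageE)

lemma dyadic_sum:
  fixes a :: "real \<Rightarrow> real"
  assumes "\<And>N. 0 \<le> a N"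
  shows "a summable_on dyadic \<longleftrightarrow> summable (\<lambda>n. a (dy n))"
    and "summable (\<lambda>n. a (dy n)) \<Longrightarrow> infsum a dyadic = (\<Sum>n. a (dy n))"
proof -
  have "a summable_on dyadic \<longleftrightarrow> (\<lambda>n. a (dy n)) summable_on UNIV"
    by (rule summable_on_reindex_bij_betw[OF dy_bij, symmetric])
  then show "a summable_on dyadic \<longleftrightarrow> summable (\<lambda>n. a (dy n))"
    using summable_on_UNIV_nonneg_real_iff[of "\<lambda>n. a (dy n)"] assms by simp
  assume s: "summable (\<lambda>n. a (dy n))"
  have "infsum a dyadic = infsum (\<lambda>n. a (dy n)) UNIV"
    by (rule infsum_reindex_bij_betw[OF dy_bij, symmetric])
  also have "\<dots> = (\<Sum>n. a (dy n))"
    by (rule infsumI, rule norm_summable_imp_has_sum) (use s assms in \<open>auto intro: summable_sums\<close>)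
  finally show "infsum a dyadic = (\<Sum>n. a (dy n))" .
qed

lemma lp_cutoff_continuous:
  assumes "lp_cutoff \<eta>" shows "continuous_on UNIV \<eta>"
proof -
  have "(deriv ^^ 0) \<eta> differentiable (at t)" for t
    using assms unfolding lp_cutoff_def by blast
  then have "isCont \<eta> t" for t
    by (simp add: differentiable_imp_continuous_within)
  then show ?thesis by (simp add: continuous_at_imp_continuous_on)
qed

lemma lp_cutoff_eq_0: assumes "lp_cutoff \<eta>" "2 \<le> \<bar>t\<bar>" shows "\<eta> t = 0"
proof (rule ccontr)
  assume "\<eta> t \<noteq> 0"
  then have "t \<in> closure {t. \<eta> t \<noteq> 0}" by (intro closure_subset[THEN subsetD]) simp
  moreover have "closure {t. \<eta> t \<noteq> 0} \<subseteq> {-2<..<2}" using assms(1) unfolding lp_cutoff_def by blast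
  ultimately have "t \<in> {-2<..<2}" by blast
  then show False using assms(2) by auto
qed

lemma lp_cutoff_eq_1: "lp_cutoff \<eta> \<Longrightarrow> \<bar>t\<bar> \<le> 1 \<Longrightarrow> \<eta> t = 1"
  by (auto simp: lp_cutoff_def abs_le_iff)

lemma lp_psi_continuous:
  assumes "lp_cutoff \<eta>" shows "continuous_on UNIV (lp_psi \<eta>)"
  unfolding lp_psi_def[abs_def]
  by (intro continuous_intros continuous_on_compose2[OF lp_cutoff_continuous[OF assms]]) auto

lemma lp_psi_measurable [measurable]:
  "lp_cutoff \<eta> \<Longrightarrow> lp_psi \<eta> \<in> borel_measurable borel"
  by (rule borel_measurable_continuous_onI[OF lp_psi_continuous])

lemma lp_psi_support:
  assumes "lp_cutoff \<eta>" "lp_psi \<eta> t \<noteq> 0" shows "1 / 2 < \<bar>t\<bar>" "\<bar>t\<bar> < 2"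
proof -
  show "1 / 2 < \<bar>t\<bar>"
  proof (rule ccontr)
    assume "\<not> ?thesis"
    then have "\<eta> t = 1" "\<eta> (2 * t) = 1"
      by (auto intro!: lp_cutoff_eq_1[OF assms(1)])
    then show False using assms(2) by (simp add: lp_psi_def)
  qed
  show "\<bar>t\<bar> < 2"
  proof (rule ccontr)
    assume "\<not> ?thesis"
    then have "\<eta> t = 0" "\<eta> (2 * t) = 0"
      by (auto intro!: lp_cutoff_eq_0[OF assms(1)])
    then show False using assms(2) by (simp add: lp_psi_def)
  qed
qed

lemma lp_psi_bounded:
  assumes "lp_cutoff \<eta>" obtains B where "\<And>t. \<bar>lp_psi \<eta> t\<bar> \<le> B"
proof -
  have "compact (lp_psi \<eta> ` {-2..2})"
    by (intro compact_continuous_image continuous_on_subset[OF lp_psi_continuous[OF assms]]) auto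
  then have "bounded (lp_psi \<eta> ` {-2..2})" by (rule compact_imp_bounded)
  then obtain B where "\<forall>y\<in>lp_psi \<eta> ` {-2..2}. norm y \<le> B"
    unfolding bounded_iff by blast
  then have B: "\<And>t. t \<in> {-2..2} \<Longrightarrow> \<bar>lp_psi \<eta> t\<bar> \<le> B" by auto
  have "\<bar>lp_psi \<eta> t\<bar> \<le> max B 0" for t
  proof (cases "lp_psi \<eta> t = 0")
    case False
    then have "t \<in> {-2..2}" using lp_psi_support[OF assms, of t] by auto
    then show ?thesis using B by fastforce
  qed simp
  then show ?thesis by (rule that)
qed

lemma lp_psi_finite_support:
  assumes "lp_cutoff \<eta>" "0 \<le> x"
  shows "finite {n. lp_psi \<eta> (x / dy n) \<noteq> 0}"
proof -
  have "{N \<in> dyadic. lp_psi \<eta> (x / N) \<noteq> 0} \<subseteq> (\<lambda>k::int. 2 powi k) ` {\<lfloor>log 2 x - 1\<rfloor>..\<lceil>log 2 x + 1\<rceil>}"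
  proof
    fix N assume "N \<in> {N \<in> dyadic. lp_psi \<eta> (x / N) \<noteq> 0}"
    then obtain k where N: "N = 2 powi k" and nz: "lp_psi \<eta> (x / N) \<noteq> 0"
      by (auto simp: dyadic_def)
    have pos: "0 < N" by (simp add: N)
    have "1 / 2 < x / N" "x / N < 2"
      using lp_psi_support[OF assms(1) nz] pos assms(2) by auto
    then have b: "N < 2 * x" "x < 2 * N" using pos by (auto simp: field_simps)
    then have x: "0 < x" using pos by linarith
    have "log 2 N < log 2 (2 * x)" "log 2 x < log 2 (2 * N)"
      using b pos x by auto
    then have "real_of_int k < log 2 x + 1" "log 2 x - 1 < real_of_int k"
      using pos x by (auto simp: log_mult N log_powi_two)
    then have "k \<in> {\<lfloor>log 2 x - 1\<rfloor>..\<lceil>log 2 x + 1\<rceil>}"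
      unfolding atLeastAtMost_iff by linarith
    then show "N \<in> (\<lambda>k::int. 2 powi k) ` {\<lfloor>log 2 x - 1\<rfloor>..\<lceil>log 2 x + 1\<rceil>}"
      using N by blast
  qed
  then have "finite {N \<in> dyadic. lp_psi \<eta> (x / N) \<noteq> 0}"
    by (rule finite_subset) simp
  moreover have "{n. lp_psi \<eta> (x / dy n) \<noteq> 0} = dy -` {N \<in> dyadic. lp_psi \<eta> (x / N) \<noteq> 0}"
    by auto
  moreover have "inj dy" using dy_bij by (simp add: bij_betw_def)
  ultimately show ?thesis
    by (simp only: finite_vimageI)
qed

text \<open>
  For $1\le t<2$ two neighbouring pieces of the partition of unity satisfy $\psi(t)+\psi(t/2)=1$, so one of them is
  at least $1/2$.
\<close>

lemma lp_psi_lower: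
  assumes "lp_cutoff \<eta>" "0 < x"
  obtains n where "x / 2 \<le> dy n" "1 / 4 \<le> (lp_psi \<eta> (x / dy n))\<^sup>2"
proof -
  define k where "k = \<lfloor>log 2 x\<rfloor>"
  define M where "M = (2::real) powi k"
  have Mpos: "0 < M" by (simp add: M_def)
  have Mpowr: "M = 2 powr real_of_int k" by (simp add: M_def powr_real_of_int')
  have "real_of_int k \<le> log 2 x" "log 2 x < real_of_int k + 1"
    by (auto simp: k_def)
  then have "M \<le> x" "x < 2 * M"
    using assms(2) unfolding Mpowr by (auto simp: le_log_iff log_less_iff powr_add mult.commute)
  then have t: "1 \<le> x / M" "x / M < 2" using Mpos by (auto simp: field_simps)
  have "2 \<le> \<bar>2 * (x / M)\<bar>" using t by linarith
  then have "\<eta> (2 * (x / M)) = 0" by (rule lp_cutoff_eq_0[OF assms(1)])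
  then have p1: "lp_psi \<eta> (x / M) = \<eta> (x / M)" by (simp add: lp_psi_def)
  have "\<eta> (x / (2 * M)) = 1"
    by (rule lp_cutoff_eq_1[OF assms(1)]) (use t in auto)
  then have p2: "lp_psi \<eta> (x / (2 * M)) = 1 - \<eta> (x / M)" by (simp add: lp_psi_def)
  have M1: "M \<in> dyadic" by (auto simp: M_def dyadic_def)
  have "2 * M = 2 powi (k + 1)" by (simp add: M_def power_int_add)
  then have M2: "2 * M \<in> dyadic" by (auto simp: dyadic_def)
  have *: "\<exists>N\<in>dyadic. x / 2 \<le> N \<and> 1 / 4 \<le> (lp_psi \<eta> (x / N))\<^sup>2"
  proof (cases "1 / 2 \<le> \<eta> (x / M)")
    case True
    then have "(1 / 2)\<^sup>2 \<le> (\<eta> (x / M))\<^sup>2" by (intro power_mono) auto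
    then show ?thesis using M1 p1 \<open>x < 2 * M\<close> by (intro bexI[of _ M]) (auto simp: power2_eq_square)
  next
    case False
    then have "(1 / 2)\<^sup>2 \<le> (1 - \<eta> (x / M))\<^sup>2" by (intro power_mono) auto
    then show ?thesis using M2 p2 \<open>x < 2 * M\<close> Mpos by (intro bexI[of _ "2 * M"]) (auto simp: power2_eq_square)
  qed
  then obtain N where "N \<in> dyadic" and N: "x / 2 \<le> N" "1 / 4 \<le> (lp_psi \<eta> (x / N))\<^sup>2"
    by blast
  then obtain n where "N = dy n"
    using dy_bij by (auto simp: bij_betw_def)
  then show ?thesis using that N by blast
qed

section \<open>Homogeneous Sobolev spaces as weighted spaces on the Fourier side\<close>

abbreviation psi :: "(real \<Rightarrow> real) \<Rightarrow> nat \<Rightarrow> real ^ 'n::finite \<Rightarrow> real" where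
  "psi \<eta> n \<xi> \<equiv> lp_psi \<eta> (norm \<xi> / dy n)"

text \<open>
  The weight $|\xi|^{2s}$, up to constants, in the form in which the definition of \<open>Hdot_norm\<close> produces it;
  with it the norm is an exact weighted $L^2$ norm.
\<close>

definition hweight :: "(real \<Rightarrow> real) \<Rightarrow> real \<Rightarrow> real ^ 'n::finite \<Rightarrow> real" where
  "hweight \<eta> s \<xi> = (\<Sum>n. dy n powr (2 * s) * (psi \<eta> n \<xi>)\<^sup>2)"

lemma hweight_summable:
  assumes "lp_cutoff \<eta>"
  shows "summable (\<lambda>n. dy n powr (2 * s) * (psi \<eta> n \<xi>)\<^sup>2)"
  by (rule summable_finite[OF lp_psi_finite_support[OF assms, of "norm \<xi>"]]) auto

lemma hweight_nonneg: "0 \<le> hweight \<eta> s \<xi>" if "lp_cutoff \<eta>"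
  unfolding hweight_def by (rule suminf_nonneg[OF hweight_summable[OF that]]) simp

lemma hweight_measurable [measurable]:
  assumes [measurable]: "lp_cutoff \<eta>"
  shows "hweight \<eta> s \<in> borel_measurable borel"
  unfolding hweight_def[abs_def] by measurable

lemma hweight_lower:
  assumes \<eta>: "lp_cutoff \<eta>" and "0 \<le> s" "\<xi> \<noteq> 0"
  shows "(norm \<xi> / 2) powr (2 * s) / 4 \<le> hweight \<eta> s \<xi>"
proof -
  obtain n where n: "norm \<xi> / 2 \<le> dy n" "1 / 4 \<le> (psi \<eta> n \<xi>)\<^sup>2"
    by (rule lp_psi_lower[OF \<eta>, of "norm \<xi>"]) (use \<open>\<xi> \<noteq> 0\<close> in auto)
  have "(norm \<xi> / 2) powr (2 * s) * (1 / 4) \<le> dy n powr (2 * s) * (psi \<eta> n \<xi>)\<^sup>2"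
    using n \<open>0 \<le> s\<close> by (intro mult_mono powr_mono2) auto
  also have "\<dots> = (\<Sum>k\<in>{n}. dy k powr (2 * s) * (psi \<eta> k \<xi>)\<^sup>2)" by simp
  also have "\<dots> \<le> hweight \<eta> s \<xi>"
    unfolding hweight_def by (rule sum_le_suminf[OF hweight_summable[OF \<eta>]]) auto
  finally show ?thesis by simp
qed

lemma hweight_pos:
  assumes "lp_cutoff \<eta>" "0 \<le> s" "\<xi> \<noteq> 0"
  shows "0 < hweight \<eta> s \<xi>"
  using hweight_lower[OF assms] assms(3) by (smt (verit) divide_pos_pos powr_gt_zero zero_less_norm_iff)

lemma hweight_uminus [simp]: "hweight \<eta> s (- \<xi>) = hweight \<eta> s \<xi>"
  by (simp add: hweight_def)

definition hw :: "(real \<Rightarrow> real) \<Rightarrow> real \<Rightarrow> 'n::finite vfield \<Rightarrow> 'n vfield" where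
  "hw \<eta> s g \<xi> = sqrt (hweight \<eta> s \<xi>) *\<^sub>R g \<xi>"

lemma hw_measurable [measurable]:
  assumes [measurable]: "lp_cutoff \<eta>" "g \<in> borel_measurable borel"
  shows "hw \<eta> s g \<in> borel_measurable borel"
  unfolding hw_def[abs_def] by measurable

lemma hw_norm_square: "lp_cutoff \<eta> \<Longrightarrow> (norm (hw \<eta> s g \<xi>))\<^sup>2 = hweight \<eta> s \<xi> * (norm (g \<xi>))\<^sup>2"
  by (simp add: hw_def power_mult_distrib hweight_nonneg)

lemma sq_integrable_nn:
  assumes [measurable]: "f \<in> borel_measurable borel"
  shows "sq_integrable f \<longleftrightarrow> (\<integral>\<^sup>+x. ennreal ((norm (f x))\<^sup>2) \<partial>lborel) < \<infinity>"
    and "sq_integrable f \<Longrightarrow> (\<integral>\<^sup>+x. ennreal ((norm (f x))\<^sup>2) \<partial>lborel) = ennreal ((l2n f)\<^sup>2)"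
  by (auto simp: sq_integrable_def integrable_iff_bounded l2n_square nn_integral_eq_integral)

text \<open>
  Tonelli's theorem for the sum over the dyadic pieces and the integral.
\<close>

lemma hw_dyadic:
  fixes g :: "'n::finite vfield"
  assumes \<eta>: "lp_cutoff \<eta>" and [measurable]: "g \<in> borel_measurable borel"
  defines "p \<equiv> \<lambda>n \<xi>. complex_of_real (psi \<eta> n \<xi>) *s g \<xi>"
  shows "sq_integrable (hw \<eta> s g) \<longleftrightarrow>
      (\<forall>n. sq_integrable (p n)) \<and> summable (\<lambda>n. dy n powr (2 * s) * (l2n (p n))\<^sup>2)"
    and "sq_integrable (hw \<eta> s g) \<Longrightarrow> (\<Sum>n. dy n powr (2 * s) * (l2n (p n))\<^sup>2) = (l2n (hw \<eta> s g))\<^sup>2"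
proof -
  note [measurable] = \<eta>
  have [measurable]: "p n \<in> borel_measurable borel" for n
    unfolding p_def by measurable
  have eq: "(\<integral>\<^sup>+\<xi>. ennreal ((norm (hw \<eta> s g \<xi>))\<^sup>2) \<partial>lborel)
     = (\<Sum>n. ennreal (dy n powr (2 * s)) * (\<integral>\<^sup>+\<xi>. ennreal ((norm (p n \<xi>))\<^sup>2) \<partial>lborel))"
  proof -
    have "ennreal ((norm (hw \<eta> s g \<xi>))\<^sup>2) = (\<Sum>n. ennreal (dy n powr (2 * s)) * ennreal ((norm (p n \<xi>))\<^sup>2))" for \<xi>
    proof -
      have "(norm (hw \<eta> s g \<xi>))\<^sup>2 = (\<Sum>n. dy n powr (2 * s) * (psi \<eta> n \<xi>)\<^sup>2 * (norm (g \<xi>))\<^sup>2)"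
        unfolding hw_norm_square[OF \<eta>] hweight_def by (rule suminf_mult2[OF hweight_summable[OF \<eta>]])
      then have "ennreal ((norm (hw \<eta> s g \<xi>))\<^sup>2) = (\<Sum>n. ennreal (dy n powr (2 * s) * (psi \<eta> n \<xi>)\<^sup>2 * (norm (g \<xi>))\<^sup>2))"
        by (simp only:) (rule suminf_ennreal2[symmetric], auto intro: summable_mult2 hweight_summable[OF \<eta>])
      then show ?thesis
        by (simp add: p_def norm_vsmult power_mult_distrib ennreal_mult mult.assoc)
    qed
    then have "(\<integral>\<^sup>+\<xi>. ennreal ((norm (hw \<eta> s g \<xi>))\<^sup>2) \<partial>lborel)
       = (\<integral>\<^sup>+\<xi>. (\<Sum>n. ennreal (dy n powr (2 * s)) * ennreal ((norm (p n \<xi>))\<^sup>2)) \<partial>lborel)"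
      by simp
    also have "\<dots> = (\<Sum>n. \<integral>\<^sup>+\<xi>. ennreal (dy n powr (2 * s)) * ennreal ((norm (p n \<xi>))\<^sup>2) \<partial>lborel)"
      by (rule nn_integral_suminf) measurable
    also have "\<dots> = (\<Sum>n. ennreal (dy n powr (2 * s)) * (\<integral>\<^sup>+\<xi>. ennreal ((norm (p n \<xi>))\<^sup>2) \<partial>lborel))"
      by (intro suminf_cong nn_integral_cmult) measurable
    finally show ?thesis .
  qed
  have fwd: "(\<forall>n. sq_integrable (p n)) \<and> summable (\<lambda>n. dy n powr (2 * s) * (l2n (p n))\<^sup>2)
     \<and> (\<Sum>n. dy n powr (2 * s) * (l2n (p n))\<^sup>2) = (l2n (hw \<eta> s g))\<^sup>2" if h: "sq_integrable (hw \<eta> s g)"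
  proof -
    have fin: "(\<Sum>n. ennreal (dy n powr (2 * s)) * (\<integral>\<^sup>+\<xi>. ennreal ((norm (p n \<xi>))\<^sup>2) \<partial>lborel)) = ennreal ((l2n (hw \<eta> s g))\<^sup>2)"
      using eq sq_integrable_nn(2)[OF _ h] by simp
    have sq: "sq_integrable (p n)" for n
    proof -
      have "(\<Sum>k\<in>{n}. ennreal (dy k powr (2 * s)) * (\<integral>\<^sup>+\<xi>. ennreal ((norm (p k \<xi>))\<^sup>2) \<partial>lborel))
         \<le> (\<Sum>k. ennreal (dy k powr (2 * s)) * (\<integral>\<^sup>+\<xi>. ennreal ((norm (p k \<xi>))\<^sup>2) \<partial>lborel))"
        by (rule sum_le_suminf) auto
      also have "\<dots> < \<infinity>" unfolding fin by simp
      finally have "ennreal (dy n powr (2 * s)) * (\<integral>\<^sup>+\<xi>. ennreal ((norm (p n \<xi>))\<^sup>2) \<partial>lborel) < \<infinity>" by simp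
      moreover have "0 < dy n powr (2 * s)" using dy_pos[of n] by (simp add: powr_gt_zero less_imp_neq[symmetric])
      ultimately have "(\<integral>\<^sup>+\<xi>. ennreal ((norm (p n \<xi>))\<^sup>2) \<partial>lborel) < \<infinity>"
        by (auto simp: ennreal_mult_less_top)
      then show ?thesis by (subst sq_integrable_nn(1)) auto
    qed
    have fin': "(\<Sum>n. ennreal (dy n powr (2 * s) * (l2n (p n))\<^sup>2)) = ennreal ((l2n (hw \<eta> s g))\<^sup>2)"
      using fin by (simp add: sq_integrable_nn(2)[OF _ sq] ennreal_mult)
    have sm: "summable (\<lambda>n. dy n powr (2 * s) * (l2n (p n))\<^sup>2)"
      by (rule summable_suminf_not_top) (use fin' in auto)
    have "ennreal (\<Sum>n. dy n powr (2 * s) * (l2n (p n))\<^sup>2) = ennreal ((l2n (hw \<eta> s g))\<^sup>2)"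
      unfolding fin'[symmetric] by (rule suminf_ennreal2[OF _ sm, symmetric]) simp
    then have "(\<Sum>n. dy n powr (2 * s) * (l2n (p n))\<^sup>2) = (l2n (hw \<eta> s g))\<^sup>2"
      by (subst (asm) ennreal_inj) (auto intro: suminf_nonneg[OF sm])
    then show ?thesis using sq sm by blast
  qed
  have bwd: "sq_integrable (hw \<eta> s g)" if sq: "\<forall>n. sq_integrable (p n)" and sm: "summable (\<lambda>n. dy n powr (2 * s) * (l2n (p n))\<^sup>2)"
  proof -
    have "(\<integral>\<^sup>+\<xi>. ennreal ((norm (hw \<eta> s g \<xi>))\<^sup>2) \<partial>lborel) = (\<Sum>n. ennreal (dy n powr (2 * s) * (l2n (p n))\<^sup>2))"
      unfolding eq using sq by (simp add: sq_integrable_nn(2) ennreal_mult)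
    also have "\<dots> = ennreal (\<Sum>n. dy n powr (2 * s) * (l2n (p n))\<^sup>2)"
      by (rule suminf_ennreal2[OF _ sm]) simp
    finally show ?thesis by (subst sq_integrable_nn(1)) auto
  qed
  show "sq_integrable (hw \<eta> s g) \<longleftrightarrow>
      (\<forall>n. sq_integrable (p n)) \<and> summable (\<lambda>n. dy n powr (2 * s) * (l2n (p n))\<^sup>2)"
    using fwd bwd by blast
  show "sq_integrable (hw \<eta> s g) \<Longrightarrow> (\<Sum>n. dy n powr (2 * s) * (l2n (p n))\<^sup>2) = (l2n (hw \<eta> s g))\<^sup>2"
    using fwd by blast
qed

text \<open>
  On the support of the cutoff a tempered function is integrable, so the inverse Fourier integral provides the
  function that \<open>fmult\<close> looks for.
\<close>

lemma LP_vhas_fourier: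
  fixes f g :: "'n::finite vfield"
  assumes \<eta>: "lp_cutoff \<eta>" and f: "vhas_fourier f g" and N: "0 < N"
  shows "vhas_fourier (LP \<eta> N f) (\<lambda>\<xi>. complex_of_real (lp_psi \<eta> (norm \<xi> / N)) *s g \<xi>)"
proof -
  note [measurable] = \<eta>
  obtain B where B: "\<And>t. \<bar>lp_psi \<eta> t\<bar> \<le> B" by (rule lp_psi_bounded[OF \<eta>]) blast
  have B0: "0 \<le> B" using B[of 0] by linarith
  obtain h where "vhas_fourier h (\<lambda>\<xi>. complex_of_real (lp_psi \<eta> (norm \<xi> / N)) *s g \<xi>)"
  proof (rule vhas_fourier_vecI)
    fix j
    have fj: "has_fourier (\<lambda>x. f x $ j) (\<lambda>\<xi>. g \<xi> $ j)" using f by (simp add: vhas_fourier_def)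
    have [measurable]: "(\<lambda>\<xi>. g \<xi> $ j) \<in> borel_measurable borel" by (rule has_fourier_measurable[OF fj])
    obtain k where k: "integrable lborel (\<lambda>\<xi>. norm (g \<xi> $ j) / (1 + norm \<xi>) ^ k)"
      using has_fourier_tempered(2)[OF fj] by (auto simp: tempered_fun_def)
    have "integrable lborel (\<lambda>\<xi>. complex_of_real (lp_psi \<eta> (norm \<xi> / N)) * g \<xi> $ j)"
    proof (rule Bochner_Integration.integrable_bound)
      show "integrable lborel (\<lambda>\<xi>. (B * (1 + 2 * N) ^ k) * (norm (g \<xi> $ j) / (1 + norm \<xi>) ^ k))"
        using k by (intro integrable_mult_right)
      show "AE \<xi> in lborel. norm (complex_of_real (lp_psi \<eta> (norm \<xi> / N)) * g \<xi> $ j)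
        \<le> norm ((B * (1 + 2 * N) ^ k) * (norm (g \<xi> $ j) / (1 + norm \<xi>) ^ k))"
      proof (rule AE_I2)
        fix \<xi> :: "real^'n"
        show "norm (complex_of_real (lp_psi \<eta> (norm \<xi> / N)) * g \<xi> $ j)
          \<le> norm ((B * (1 + 2 * N) ^ k) * (norm (g \<xi> $ j) / (1 + norm \<xi>) ^ k))"
        proof (cases "lp_psi \<eta> (norm \<xi> / N) = 0")
          case False
          then have "norm \<xi> / N < 2" using lp_psi_support[OF \<eta> False] N by simp
          then have "norm \<xi> \<le> 2 * N" using N by (simp add: field_simps)
          then have le: "(1 + norm \<xi>) ^ k \<le> (1 + 2 * N) ^ k" by (intro power_mono) auto
          have "1 \<le> (1 + 2 * N) ^ k / (1 + norm \<xi>) ^ k" using le by (simp add: le_divide_eq)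
          then have "\<bar>lp_psi \<eta> (norm \<xi> / N)\<bar> * norm (g \<xi> $ j) * 1 \<le> B * norm (g \<xi> $ j) * ((1 + 2 * N) ^ k / (1 + norm \<xi>) ^ k)"
            by (intro mult_mono B) (use B0 in auto)
          also have "\<dots> = (B * (1 + 2 * N) ^ k) * (norm (g \<xi> $ j) / (1 + norm \<xi>) ^ k)" by simp
          also have "\<dots> \<le> norm \<dots>" unfolding real_norm_def by (rule abs_ge_self)
          finally show ?thesis by (simp only: norm_mult norm_of_real mult_1_right)
        qed simp
      qed
    qed measurable
    then show "\<exists>f. has_fourier f (\<lambda>\<xi>. (complex_of_real (lp_psi \<eta> (norm \<xi> / N)) *s g \<xi>) $ j)"
      by (auto intro: has_fourier_inv_fourier_int)
  qed
  then show ?thesis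
    unfolding LP_def by (rule fmult_vec_vhas_fourier[OF f])
qed

lemma Hdot_imp_vhas_fourier:
  assumes "f \<in> Hdot \<eta> s" obtains g where "vhas_fourier f g"
proof -
  have "\<forall>j. \<exists>g. has_fourier (\<lambda>x. f x $ j) g" using assms by (simp add: Hdot_def)
  then obtain G where "\<And>j. has_fourier (\<lambda>x. f x $ j) (G j)" by metis
  then have "vhas_fourier f (\<lambda>\<xi>. \<chi> j. G j \<xi>)" by (simp add: vhas_fourier_def)
  then show ?thesis by (rule that)
qed

text \<open>
  Plancherel's theorem on each dyadic piece, summed up.
\<close>

theorem Hdot_iff_weighted:
  fixes f g :: "'n::finite vfield"
  assumes \<eta>: "lp_cutoff \<eta>" and f: "vhas_fourier f g"
  shows "f \<in> Hdot \<eta> s \<longleftrightarrow> sq_integrable (hw \<eta> s g)"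
    and "f \<in> Hdot \<eta> s \<Longrightarrow> Hdot_norm \<eta> s f = l2n (hw \<eta> s g) / gauss_mass TYPE('n)"
proof -
  let ?T = "gauss_mass TYPE('n)"
  let ?p = "\<lambda>n \<xi>. complex_of_real (psi \<eta> n \<xi>) *s g \<xi>"
  have gm: "g \<in> borel_measurable borel" by (rule vhas_fourier_measurable[OF f])
  have F: "vhas_fourier (LP \<eta> (dy n) f) (?p n)" for n
    by (rule LP_vhas_fourier[OF \<eta> f dy_pos])
  have sq: "LP \<eta> (dy n) f \<in> L2 \<longleftrightarrow> sq_integrable (?p n)" for n
    unfolding L2_eq by (rule vector_Plancherel(1)[OF F])
  have nrm: "L2_norm (LP \<eta> (dy n) f) = l2n (?p n) / ?T" if "sq_integrable (?p n)" for n
    unfolding L2_eq by (rule vector_Plancherel(2)[OF F that])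
  have ex: "\<forall>j. \<exists>g. has_fourier (\<lambda>x. f x $ j) g" using f by (auto simp: vhas_fourier_def)
  let ?a = "\<lambda>N. N powr (2 * s) * (L2_norm (LP \<eta> N f))\<^sup>2"
  have trm: "?a (dy n) = (1 / ?T\<^sup>2) * (dy n powr (2 * s) * (l2n (?p n))\<^sup>2)" if "sq_integrable (?p n)" for n
    by (simp add: nrm[OF that] power_divide)
  have sm: "?a summable_on dyadic \<longleftrightarrow> summable (\<lambda>n. dy n powr (2 * s) * (l2n (?p n))\<^sup>2)" if "\<forall>n. sq_integrable (?p n)"
  proof -
    have "?a summable_on dyadic \<longleftrightarrow> summable (\<lambda>n. ?a (dy n))"
      by (rule dyadic_sum) simp
    also have "\<dots> \<longleftrightarrow> summable (\<lambda>n. (1 / ?T\<^sup>2) * (dy n powr (2 * s) * (l2n (?p n))\<^sup>2))"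
      using that by (simp only: trm)
    also have "\<dots> \<longleftrightarrow> summable (\<lambda>n. dy n powr (2 * s) * (l2n (?p n))\<^sup>2)"
      by (rule summable_cmult_iff[THEN trans]) simp
    finally show ?thesis .
  qed
  have "f \<in> Hdot \<eta> s \<longleftrightarrow> (\<forall>n. sq_integrable (?p n)) \<and> ?a summable_on dyadic"
    unfolding Hdot_def all_dyadic_iff using ex sq by simp
  also have "\<dots> \<longleftrightarrow> sq_integrable (hw \<eta> s g)"
    unfolding hw_dyadic(1)[OF \<eta> gm] using sm by blast
  finally show *: "f \<in> Hdot \<eta> s \<longleftrightarrow> sq_integrable (hw \<eta> s g)" .
  assume "f \<in> Hdot \<eta> s"
  then have h: "sq_integrable (hw \<eta> s g)" using * by simp
  then have S: "\<forall>n. sq_integrable (?p n)" "summable (\<lambda>n. dy n powr (2 * s) * (l2n (?p n))\<^sup>2)"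
    unfolding hw_dyadic(1)[OF \<eta> gm] by auto
  have "summable (\<lambda>n. ?a (dy n))" using sm[OF S(1)] S(2) dyadic_sum(1)[of ?a] by simp
  then have "infsum ?a dyadic = (\<Sum>n. ?a (dy n))" by (intro dyadic_sum(2)) auto
  also have "\<dots> = (\<Sum>n. (1 / ?T\<^sup>2) * (dy n powr (2 * s) * (l2n (?p n))\<^sup>2))" using S(1) by (simp only: trm)
  also have "\<dots> = (1 / ?T\<^sup>2) * (l2n (hw \<eta> s g))\<^sup>2"
    by (subst suminf_mult[OF S(2)]) (simp only: hw_dyadic(2)[OF \<eta> gm h])
  also have "\<dots> = (l2n (hw \<eta> s g) / ?T)\<^sup>2" by (simp add: power_divide)
  finally show "Hdot_norm \<eta> s f = l2n (hw \<eta> s g) / ?T"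
    unfolding Hdot_norm_def by (simp add: less_imp_le)
qed

section \<open>Inverse Fourier transforms of homogeneous Sobolev functions\<close>

lemma emeasure_cball_scaled:
  assumes "0 < r"
  shows "emeasure lborel (cball (0::real^'n::finite) r) = ennreal (r ^ CARD('n)) * emeasure lborel (cball (0::real^'n) 1)"
proof -
  have "emeasure lborel (cball (0::real^'n) r) = (\<integral>\<^sup>+x. indicator (cball (0::real^'n) r) x \<partial>lborel)"
    by (simp add: nn_integral_indicator)
  also have "\<dots> = ennreal (\<bar>r\<bar> ^ DIM(real^'n)) * (\<integral>\<^sup>+x. indicator (cball (0::real^'n) r) (0 + r *\<^sub>R x) \<partial>lborel)"
    by (rule nn_integral_lborel_affine) (use assms in \<open>auto intro!: borel_measurable_indicator\<close>)
  also have "(\<lambda>x. indicator (cball (0::real^'n) r) (0 + r *\<^sub>R x)) = (indicator (cball (0::real^'n) 1) :: _ \<Rightarrow> ennreal)"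
    using assms by (auto simp: fun_eq_iff indicator_def)
  finally show ?thesis using assms by (simp add: nn_integral_indicator)
qed

text \<open>
  On the shell $2^{-k-1}<|x|\le2^{-k}$ the function is at most $2^{(k+1)p}$, and the ball of radius $2^{-k}$ has
  volume proportional to $2^{-kd}$. This gives a geometric series, convergent because of $p<d$.
\<close>

lemma integrable_norm_powr_near_0:
  assumes p: "0 \<le> p" "p < real CARD('n)"
  shows "integrable lborel (\<lambda>x::real^'n::finite. if norm x < 1 then norm x powr (- p) else 0)"
proof (rule integrableI_bounded)
  let ?f = "\<lambda>x::real^'n. if norm x < 1 then norm x powr (- p) else 0"
  let ?c = "\<lambda>k::nat. 2 powr (real (k + 1) * p)"
  let ?V = "measure lborel (cball (0::real^'n) 1)"
  let ?q = "2 powr (p - real CARD('n))"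
  have "(\<integral>\<^sup>+x. ennreal (norm (?f x)) \<partial>lborel) \<le>
     (\<integral>\<^sup>+x. (\<Sum>k. ennreal (?c k) * indicator (cball (0::real^'n) (2 powr - real k)) x) \<partial>lborel)"
  proof (rule nn_integral_mono)
    fix x :: "real^'n"
    show "ennreal (norm (?f x)) \<le> (\<Sum>k. ennreal (?c k) * indicator (cball (0::real^'n) (2 powr - real k)) x)"
    proof (cases "norm x < 1 \<and> x \<noteq> 0")
      case True
      then have x: "0 < norm x" "norm x < 1" by auto
      define y where "y = - log 2 (norm x)"
      have nx: "norm x = 2 powr (- y)" using x by (simp add: y_def)
      have y0: "0 < y" using x by (simp add: y_def)
      \<comment> \<open>The index of the shell that contains \<open>x\<close>.\<close>
      define k where "k = nat \<lfloor>y\<rfloor>"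
      have k: "real k \<le> y" "y < real k + 1" using y0 by (auto simp: k_def)
      have "?f x = 2 powr (y * p)" using x by (simp add: nx powr_powr)
      also have "\<dots> \<le> ?c k" using k p by (intro powr_mono mult_right_mono) auto
      finally have "ennreal (norm (?f x)) \<le> ennreal (?c k)"
        by (intro ennreal_leI) simp
      also have "\<dots> = ennreal (?c k) * indicator (cball (0::real^'n) (2 powr - real k)) x"
        using k by (simp add: nx)
      also have "\<dots> \<le> (\<Sum>k. ennreal (?c k) * indicator (cball (0::real^'n) (2 powr - real k)) x)"
      proof -
        have "F k \<le> suminf F" for F :: "nat \<Rightarrow> ennreal"
          using sum_le_suminf[of F "{k}"] by simp
        then show ?thesis .
      qed
      finally show ?thesis .
    next
      case False
      then have "?f x = 0" by auto
      then show ?thesis by (simp only: norm_zero ennreal_0 zero_le)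
    qed
  qed
  also have "\<dots> = (\<Sum>k. \<integral>\<^sup>+x. ennreal (?c k) * indicator (cball (0::real^'n) (2 powr - real k)) x \<partial>lborel)"
    by (rule nn_integral_suminf) (intro borel_measurable_times_ennreal borel_measurable_const borel_measurable_indicator, simp)
  also have "\<dots> = (\<Sum>k. ennreal (?c k) * emeasure lborel (cball (0::real^'n) (2 powr - real k)))"
    by (intro suminf_cong nn_integral_cmult_indicator) simp
  also have "\<dots> = (\<Sum>k. ennreal ((2 powr p * ?V) * ?q ^ k))"
  proof (intro suminf_cong)
    fix k
    have V: "emeasure lborel (cball (0::real^'n) 1) = ennreal ?V"
      using emeasure_bounded_finite[of "cball (0::real^'n) 1"] by (simp add: emeasure_eq_ennreal_measure)
    have "(2 powr - real k) ^ CARD('n) = 2 powr (real CARD('n) * - real k)" "?q ^ k = 2 powr (real k * (p - real CARD('n)))"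
      by (rule powr_power, simp)+
    moreover have "real (k + 1) * p + real CARD('n) * - real k = p + real k * (p - real CARD('n))"
      by (simp add: algebra_simps)
    ultimately have "?c k * (2 powr - real k) ^ CARD('n) = 2 powr p * ?q ^ k"
      by (simp only: powr_add[symmetric])
    then have "?c k * ((2 powr - real k) ^ CARD('n) * ?V) = (2 powr p * ?V) * ?q ^ k"
      by (simp only: mult.assoc[symmetric]) (simp only: mult.commute mult.left_commute)
    then have "ennreal (?c k) * (ennreal ((2 powr - real k) ^ CARD('n)) * ennreal ?V) = ennreal ((2 powr p * ?V) * ?q ^ k)"
      by (subst ennreal_mult[symmetric], simp, simp)+ (simp only:)
    then show "ennreal (?c k) * emeasure lborel (cball (0::real^'n) (2 powr - real k)) = ennreal ((2 powr p * ?V) * ?q ^ k)"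
      by (subst emeasure_cball_scaled) (auto simp: V)
  qed
  also have "\<dots> = ennreal (\<Sum>k. (2 powr p * ?V) * ?q ^ k)"
  proof (rule suminf_ennreal2)
    have "?q < 2 powr 0" using p by (intro powr_less_mono) auto
    then show "summable (\<lambda>k. (2 powr p * ?V) * ?q ^ k)"
      by (intro summable_mult summable_geometric) simp
  qed simp
  also have "\<dots> < \<infinity>" by simp
  finally show "(\<integral>\<^sup>+x. ennreal (norm (?f x)) \<partial>lborel) < \<infinity>" .
qed measurable

lemma has_fourier_add:
  assumes 1: "has_fourier f g" and 2: "has_fourier f' g'"
  shows "has_fourier (\<lambda>x. f x + f' x) (\<lambda>x. g x + g' x)"
proof -
  have "has_fourier (\<lambda>x. f' x - f' x) (\<lambda>x. g' x - g' x)" by (rule has_fourier_diff[OF 2 2])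
  from has_fourier_diff[OF 1 has_fourier_diff[OF this 2]] show ?thesis by simp
qed

text \<open>
  Split \<open>g\<close> at $|\xi|=1$. For high frequencies the weight is bounded below and \<open>g\<close> is square integrable.
  For low frequencies \<open>g\<close> is integrable by the Cauchy--Schwarz inequality, as $|\xi|^{-s}$ is square integrable
  near the origin. Each part is a Fourier transform.
\<close>

theorem weighted_inv_fourier_exists:
  fixes g :: "'n::finite vfield"
  assumes \<eta>: "lp_cutoff \<eta>" and s: "0 \<le> s" "s < real CARD('n) / 2"
    and [measurable]: "g \<in> borel_measurable borel" and h: "sq_integrable (hw \<eta> s g)"
  obtains f where "vhas_fourier f g"
proof (rule vhas_fourier_vecI)
  note [measurable] = \<eta>
  fix j
  \<comment> \<open>The low and the high frequencies of a component.\<close>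
  let ?lo = "\<lambda>\<xi>. if norm \<xi> < 1 then g \<xi> $ j else 0"
  let ?hi = "\<lambda>\<xi>. if norm \<xi> < 1 then 0 else g \<xi> $ j"
  let ?r = "\<lambda>\<xi>::real^'n. if norm \<xi> < 1 then norm \<xi> powr (- s) else 0"
  have bound: "norm (g \<xi> $ j) * ((norm \<xi> / 2) powr s / 2) \<le> norm (hw \<eta> s g \<xi>)" if "\<xi> \<noteq> 0" for \<xi>
  proof -
    have "((norm \<xi> / 2) powr s / 2)\<^sup>2 \<le> hweight \<eta> s \<xi>"
      using hweight_lower[OF \<eta> s(1) that] that by (simp add: power_divide powr_power mult.commute)
    then have le: "(norm \<xi> / 2) powr s / 2 \<le> sqrt (hweight \<eta> s \<xi>)"
      by (rule real_le_rsqrt)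
    have "norm (g \<xi> $ j) * ((norm \<xi> / 2) powr s / 2) \<le> norm (g \<xi>) * sqrt (hweight \<eta> s \<xi>)"
      by (intro mult_mono le Finite_Cartesian_Product.norm_nth_le) auto
    then show ?thesis by (simp add: hw_def hweight_nonneg[OF \<eta>] mult.commute)
  qed
  have nz: "AE \<xi> in lborel. (\<xi> :: real^'n) \<noteq> 0" by (rule AE_lborel_singleton)
  have rsq: "sq_integrable ?r"
    unfolding sq_integrable_def
  proof (intro conjI)
    have "(norm (?r \<xi>))\<^sup>2 = (if norm \<xi> < 1 then norm \<xi> powr (- (2 * s)) else 0)" for \<xi>
      by (cases "\<xi> = 0") (auto simp: powr_power)
    then show "integrable lborel (\<lambda>\<xi>. (norm (?r \<xi>))\<^sup>2)"
      using integrable_norm_powr_near_0[of "2 * s", where 'n='n] s by simp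
  qed measurable
  have "integrable lborel ?lo"
  proof (rule Bochner_Integration.integrable_bound)
    show "integrable lborel (\<lambda>\<xi>. (2 * 2 powr s) * (norm (hw \<eta> s g \<xi>) * norm (norm (?r \<xi>))))"
      using l2n_Cauchy_Schwarz(1)[of "\<lambda>\<xi>. norm (hw \<eta> s g \<xi>)" ?r] h rsq
      by (intro integrable_mult_right) (auto simp: sq_integrable_def)
    show "AE \<xi> in lborel. norm (?lo \<xi>) \<le> norm ((2 * 2 powr s) * (norm (hw \<eta> s g \<xi>) * norm (norm (?r \<xi>))))"
      using nz
    proof eventually_elim
      fix \<xi> :: "real^'n" assume z: "\<xi> \<noteq> 0"
      show "norm (?lo \<xi>) \<le> norm ((2 * 2 powr s) * (norm (hw \<eta> s g \<xi>) * norm (norm (?r \<xi>))))"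
      proof (cases "norm \<xi> < 1")
        case True
        have "norm (g \<xi> $ j) = (2 * 2 powr s) * ((norm (g \<xi> $ j) * ((norm \<xi> / 2) powr s / 2)) * norm \<xi> powr (- s))"
          using z by (simp add: powr_divide powr_minus field_simps)
        also have "\<dots> \<le> (2 * 2 powr s) * (norm (hw \<eta> s g \<xi>) * norm \<xi> powr (- s))"
          by (intro mult_left_mono mult_right_mono bound z) auto
        finally show ?thesis using True by simp
      qed simp
    qed
  qed measurable
  from has_fourier_inv_fourier_int[OF this]
  have lo: "has_fourier (inv_fourier_int ?lo) ?lo" .
  have "sq_integrable ?hi"
  proof (rule sq_integrable_bound)
    show "sq_integrable (\<lambda>\<xi>. (2 * 2 powr s) *\<^sub>R hw \<eta> s g \<xi>)" by (rule sq_integrable_scaleR[OF h])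
    show "AE \<xi> in lborel. norm (?hi \<xi>) \<le> norm ((2 * 2 powr s) *\<^sub>R hw \<eta> s g \<xi>)"
    proof (rule AE_I2)
      fix \<xi> :: "real^'n"
      show "norm (?hi \<xi>) \<le> norm ((2 * 2 powr s) *\<^sub>R hw \<eta> s g \<xi>)"
      proof (cases "norm \<xi> < 1")
        case False
        then have z: "\<xi> \<noteq> 0" by auto
        have "1 \<le> norm \<xi> powr s" using False s(1) by (intro ge_one_powr_ge_zero) auto
        then have "norm (g \<xi> $ j) * 1 \<le> norm (g \<xi> $ j) * norm \<xi> powr s" by (intro mult_left_mono) auto
        also have "\<dots> = (2 * 2 powr s) * (norm (g \<xi> $ j) * ((norm \<xi> / 2) powr s / 2))"
          by (simp add: powr_divide)
        also have "\<dots> \<le> (2 * 2 powr s) * norm (hw \<eta> s g \<xi>)"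
          by (intro mult_left_mono bound z) auto
        finally show ?thesis using False by simp
      qed simp
    qed
  qed measurable
  then obtain F where hi: "has_fourier F ?hi" by (metis L2_inv_fourier_exists)
  have "(\<lambda>\<xi>. ?lo \<xi> + ?hi \<xi>) = (\<lambda>\<xi>. g \<xi> $ j)" by auto
  then show "\<exists>f. has_fourier f (\<lambda>\<xi>. g \<xi> $ j)"
    using has_fourier_add[OF lo hi] by auto
qed (rule that)

section \<open>Limits at infinity of functions in the atomic space\<close>

text \<open>
  At any time at most one of the intervals is active, so the value is zero or one of the $\phi_k$.
\<close>

lemma U2_atom_bound:
  assumes "U2_atom a"
  shows "sq_integrable (a t)" "l2n (a t) \<le> 1"
proof -
  obtain K :: nat and \<tau> :: "nat \<Rightarrow> ereal" and \<phi>
    where \<tau>: "strict_mono_on {0..K} \<tau>" and \<phi>: "\<forall>k<K. \<phi> k \<in> L2"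
    and one: "(\<Sum>k<K. (L2_norm (\<phi> k))\<^sup>2) = 1"
    and a: "a = (\<lambda>t x. \<Sum>k=1..K. if \<tau> (k - 1) \<le> ereal t \<and> ereal t < \<tau> k then \<phi> (k - 1) x else 0)"
    using assms unfolding U2_atom_def by blast
  have mono: "\<tau> i \<le> \<tau> j" if "i \<le> j" "j \<le> K" for i j
    using strict_mono_onD[OF \<tau>, of i j] that by (cases "i = j") auto
  let ?P = "\<lambda>k. \<tau> (k - 1) \<le> ereal t \<and> ereal t < \<tau> k"
  have "sq_integrable (a t) \<and> l2n (a t) \<le> 1"
  proof (cases "\<exists>k\<in>{1..K}. ?P k")
    case False
    then have "a t = (\<lambda>x. 0)" unfolding a by (intro ext sum.neutral) auto
    then show ?thesis by simp
  next
    case True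
    then obtain k where k: "k \<in> {1..K}" "?P k" by blast
    have no: "\<not> ?P i" if "i \<in> {1..K} - {k}" for i
    proof (cases "i < k")
      case True
      then have "\<tau> i \<le> \<tau> (k - 1)" using k by (intro mono) auto
      then show ?thesis using k by auto
    next
      case False
      then have "\<tau> k \<le> \<tau> (i - 1)" using that by (intro mono) auto
      then show ?thesis using k by auto
    qed
    have at: "a t = \<phi> (k - 1)"
    proof
      fix x
      have "a t x = (if ?P k then \<phi> (k - 1) x else 0) + (\<Sum>i\<in>{1..K} - {k}. if ?P i then \<phi> (i - 1) x else 0)"
        unfolding a using k(1) by (intro sum.remove) auto
      also have "(\<Sum>i\<in>{1..K} - {k}. if ?P i then \<phi> (i - 1) x else 0) = 0"
        using no by (intro sum.neutral) auto
      finally show "a t x = \<phi> (k - 1) x" using k by simp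
    qed
    have kK: "k - 1 < K" using k by auto
    have "(l2n (\<phi> (k - 1)))\<^sup>2 \<le> (\<Sum>k<K. (L2_norm (\<phi> k))\<^sup>2)"
      unfolding L2_eq(2)[symmetric] using kK by (intro member_le_sum) auto
    then have "(l2n (\<phi> (k - 1)))\<^sup>2 \<le> 1\<^sup>2" using one by simp
    then have "l2n (\<phi> (k - 1)) \<le> 1" by (rule power2_le_imp_le) simp
    then show ?thesis using \<phi>[rule_format, OF kK] at by (simp add: L2_eq)
  qed
  then show "sq_integrable (a t)" "l2n (a t) \<le> 1" by auto
qed

lemma U2_atom_eventually_constant:
  assumes "U2_atom a"
  shows "\<exists>T. \<forall>t\<ge>T. a t = a T"
proof -
  obtain K :: nat and \<tau> :: "nat \<Rightarrow> ereal" and \<phi>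
    where a: "a = (\<lambda>t x. \<Sum>k=1..K. if \<tau> (k - 1) \<le> ereal t \<and> ereal t < \<tau> k then \<phi> (k - 1) x else 0)"
    using assms unfolding U2_atom_def by blast
  \<comment> \<open>Only the last breakpoint can be infinite. All others are eventually passed.\<close>
  have "\<exists>T. \<forall>t\<ge>T. \<tau> k \<le> ereal t \<longleftrightarrow> \<tau> k \<noteq> \<infinity>" for k
    by (cases "\<tau> k") auto
  then obtain T where T: "\<And>k t. T k \<le> t \<Longrightarrow> \<tau> k \<le> ereal t \<longleftrightarrow> \<tau> k \<noteq> \<infinity>"
    by metis
  let ?T = "Max (T ` {0..K})"
  have le: "T k \<le> ?T" if "k \<le> K" for k using that by (intro Max_ge) auto
  have "a t = a ?T" if t: "?T \<le> t" for t
  proof -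
    have *: "\<tau> k \<le> ereal t \<longleftrightarrow> \<tau> k \<le> ereal ?T" if "k \<le> K" for k
      using T[of k t] T[of k ?T] le[OF that] t by auto
    then have "(\<tau> (k - 1) \<le> ereal t \<and> ereal t < \<tau> k) \<longleftrightarrow> (\<tau> (k - 1) \<le> ereal ?T \<and> ereal ?T < \<tau> k)" if "k \<in> {1..K}" for k
      using that *[of k] *[of "k - 1"] by (auto simp: not_le[symmetric])
    then show ?thesis unfolding a by (intro ext sum.cong refl) auto
  qed
  then show ?thesis by blast
qed

lemma sq_integrable_vsmult:
  fixes f :: "'n::finite vfield"
  assumes f: "sq_integrable f"
  shows "sq_integrable (\<lambda>x. c *s f x)" "l2n (\<lambda>x. c *s f x) = norm c * l2n f"
proof -
  have [measurable]: "f \<in> borel_measurable borel" using f by auto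
  show "sq_integrable (\<lambda>x. c *s f x)"
    using f by (auto simp: sq_integrable_def norm_vsmult power_mult_distrib)
  show "l2n (\<lambda>x. c *s f x) = norm c * l2n f"
    by (simp add: l2n_def norm_vsmult power_mult_distrib real_sqrt_mult)
qed

lemma atom_sum_bound:
  fixes a :: "nat \<Rightarrow> 'n::finite traj"
  assumes a: "\<And>j. U2_atom (a j)" and "finite A"
  shows "sq_integrable (\<lambda>x. \<Sum>j\<in>A. c j *s a j t x) \<and> l2n (\<lambda>x. \<Sum>j\<in>A. c j *s a j t x) \<le> (\<Sum>j\<in>A. norm (c j))"
  using assms(2)
proof (induction A rule: finite_induct)
  case (insert j A)
  note j = sq_integrable_vsmult[OF U2_atom_bound(1)[OF a], of "c j" j t]
  have "l2n (\<lambda>x. c j *s a j t x) \<le> norm (c j)"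
    unfolding j(2) using U2_atom_bound(2)[OF a, of j t] by (intro mult_left_le) auto
  then show ?case
    using insert sq_integrable_add[OF j(1), of "\<lambda>x. \<Sum>j\<in>A. c j *s a j t x"]
      l2n_triangle[OF j(1), of "\<lambda>x. \<Sum>j\<in>A. c j *s a j t x"] by simp
qed simp

text \<open>
  The tail of $\sum\lambda_ja_j$ is bounded by the tail of $\sum|\lambda_j|$, uniformly in time. The uniformity
  carries the behaviour of atoms at infinity over to their sums.
\<close>

lemma U2_repr_approx:
  fixes u :: "'n::finite traj"
  assumes r: "U2_repr u c a"
  shows "sq_integrable (u t)" "l2n (\<lambda>x. u t x - (\<Sum>j<n. c j *s a j t x)) \<le> (\<Sum>j. norm (c (j + n)))"
proof -
  have a: "\<And>j. U2_atom (a j)" and c: "summable (\<lambda>j. norm (c j))"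
    and lim: "tends_to_zero L2 L2_norm (\<lambda>n x. u t x - (\<Sum>j<n. c j *s a j t x)) sequentially"
    using r unfolding U2_repr_def by auto
  let ?S = "\<lambda>n x. \<Sum>j<n. c j *s a j t x"
  have S: "sq_integrable (?S n)" for n
    by (rule atom_sum_bound[of a, OF a finite_lessThan, THEN conjunct1])
  have "\<forall>\<^sub>F n in sequentially. sq_integrable (\<lambda>x. u t x - ?S n x)"
    using lim by (simp add: tends_to_zero_def L2_eq)
  then obtain n0 where "sq_integrable (\<lambda>x. u t x - ?S n0 x)"
    by (auto simp: eventually_sequentially)
  from sq_integrable_add[OF this S[of n0]] show u: "sq_integrable (u t)" by simp
  have l: "(\<lambda>n. l2n (\<lambda>x. u t x - ?S n x)) \<longlonglongrightarrow> 0"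
    using lim by (simp add: tends_to_zero_def L2_eq)
  show "l2n (\<lambda>x. u t x - ?S n x) \<le> (\<Sum>j. norm (c (j + n)))"
  proof (rule tendsto_lowerbound)
    show "(\<lambda>m. l2n (\<lambda>x. u t x - ?S m x) + (\<Sum>j. norm (c (j + n)))) \<longlonglongrightarrow> (\<Sum>j. norm (c (j + n)))"
      using tendsto_add[OF l tendsto_const] by fastforce
    show "\<forall>\<^sub>F m in sequentially. l2n (\<lambda>x. u t x - ?S n x) \<le> l2n (\<lambda>x. u t x - ?S m x) + (\<Sum>j. norm (c (j + n)))"
    proof (rule eventually_sequentiallyI)
      fix m assume m: "n \<le> m"
      have "?S m x - ?S n x = (\<Sum>j\<in>{n..<m}. c j *s a j t x)" for x
        using m by (simp add: sum_diff_nat_ivl lessThan_atLeast0)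
      then have "l2n (\<lambda>x. ?S m x - ?S n x) \<le> (\<Sum>j\<in>{n..<m}. norm (c j))"
        using atom_sum_bound[of a, OF a, where A="{n..<m}" and c=c and t=t] by simp
      also have "\<dots> = (\<Sum>j<m - n. norm (c (j + n)))"
        using sum.shift_bounds_nat_ivl[of "\<lambda>j. norm (c j)" 0 n "m - n"] m by (simp add: lessThan_atLeast0)
      also have "\<dots> \<le> (\<Sum>j. norm (c (j + n)))"
        by (rule sum_le_suminf) (use c in \<open>auto simp: summable_iff_shift[of "\<lambda>j. norm (c j)"]\<close>)
      finally show "l2n (\<lambda>x. u t x - ?S n x) \<le> l2n (\<lambda>x. u t x - ?S m x) + (\<Sum>j. norm (c (j + n)))"
        using l2n_triangle3[OF u S[of m] S[of n]] by linarith
    qed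
  qed simp
qed

lemma U2_bounded:
  fixes u :: "'n::finite traj"
  assumes u: "u \<in> U2"
  shows "sq_integrable (u t)" "l2n (u t) \<le> U2_norm u"
proof -
  obtain c a where r: "U2_repr u c a" using u by (auto simp: U2_def)
  show "sq_integrable (u t)" by (rule U2_repr_approx[OF r])
  show "l2n (u t) \<le> U2_norm u"
    unfolding U2_norm_def
  proof (rule cInf_greatest)
    fix y assume "y \<in> {\<Sum>j. norm (c j) |c a. U2_repr u c a}"
    then obtain c a where "U2_repr u c a" and y: "y = (\<Sum>j. norm (c j))" by blast
    from U2_repr_approx(2)[OF this(1), of t 0] show "l2n (u t) \<le> y" by (simp add: y)
  qed (use r in blast)
qed

text \<open>
  Up to a uniformly small error \<open>u\<close> is a finite sum of atoms, and this sum is constant for large times.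
\<close>

lemma U2_Cauchy_at_infinity:
  fixes u :: "'n::finite traj"
  assumes u: "u \<in> U2" and e: "0 < e"
  shows "\<exists>T. \<forall>t\<ge>T. \<forall>t'\<ge>T. l2n (\<lambda>x. u t x - u t' x) < e"
proof -
  obtain c a where r: "U2_repr u c a" using u by (auto simp: U2_def)
  have a: "\<And>j. U2_atom (a j)" and c: "summable (\<lambda>j. norm (c j))"
    using r unfolding U2_repr_def by auto
  obtain n where "\<forall>m\<ge>n. norm (\<Sum>j. norm (c (j + m))) < e / 2"
    using suminf_exist_split[OF half_gt_zero[OF e] c] by blast
  then have "\<bar>\<Sum>j. norm (c (j + n))\<bar> < e / 2" unfolding real_norm_def by blast
  then have n: "(\<Sum>j. norm (c (j + n))) < e / 2" by linarith
  obtain T where T: "\<And>j t. T j \<le> t \<Longrightarrow> a j t = a j (T j)"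
    using U2_atom_eventually_constant[OF a] by metis
  let ?T = "Max (T ` {0..n})"
  let ?S = "\<lambda>t x. \<Sum>j<n. c j *s a j t x"
  have S: "sq_integrable (?S t)" for t
    by (rule atom_sum_bound[of a, OF a finite_lessThan, THEN conjunct1])
  have "l2n (\<lambda>x. u t x - u t' x) < e" if t: "?T \<le> t" "?T \<le> t'" for t t'
  proof -
    have "T j \<le> ?T" if "j < n" for j using that by (intro Max_ge) auto
    then have "a j t = a j t'" if "j < n" for j
      using T[of j t] T[of j t'] t that by fastforce
    then have eq: "?S t x = ?S t' x" for x by simp
    have "l2n (\<lambda>x. u t x - u t' x) \<le> l2n (\<lambda>x. u t x - ?S t x) + l2n (\<lambda>x. ?S t x - u t' x)"
      by (rule l2n_triangle3[OF U2_repr_approx(1)[OF r] S U2_repr_approx(1)[OF r]])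
    also have "l2n (\<lambda>x. ?S t x - u t' x) = l2n (\<lambda>x. u t' x - ?S t' x)"
      unfolding eq by (rule l2n_minus_commute)
    finally show ?thesis
      using U2_repr_approx(2)[OF r, of t n] U2_repr_approx(2)[OF r, of t' n] n by linarith
  qed
  then show ?thesis by blast
qed

section \<open>Scattering in the spaces $Z$\<close>

lemma hw_phase:
  fixes g :: "'n::finite vfield"
  assumes [measurable]: "lp_cutoff \<eta>" "g \<in> borel_measurable borel" "a \<in> borel_measurable borel"
  shows "sq_integrable (hw \<eta> s (\<lambda>\<xi>. cis (a \<xi>) *s g \<xi>)) \<longleftrightarrow> sq_integrable (hw \<eta> s g)"
    and "l2n (hw \<eta> s (\<lambda>\<xi>. cis (a \<xi>) *s g \<xi>)) = l2n (hw \<eta> s g)"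
proof -
  have n: "norm (hw \<eta> s (\<lambda>\<xi>. cis (a \<xi>) *s g \<xi>) \<xi>) = norm (hw \<eta> s g \<xi>)" for \<xi>
    by (simp add: hw_def norm_vsmult)
  have m: "hw \<eta> s (\<lambda>\<xi>. cis (a \<xi>) *s g \<xi>) \<in> borel_measurable borel" "hw \<eta> s g \<in> borel_measurable borel"
    by measurable
  show "sq_integrable (hw \<eta> s (\<lambda>\<xi>. cis (a \<xi>) *s g \<xi>)) \<longleftrightarrow> sq_integrable (hw \<eta> s g)"
    using m by (simp add: sq_integrable_def n)
  show "l2n (hw \<eta> s (\<lambda>\<xi>. cis (a \<xi>) *s g \<xi>)) = l2n (hw \<eta> s g)"
    by (simp add: l2n_def n)
qed

lemma hw_diff: "hw \<eta> s (\<lambda>\<xi>. g \<xi> - g' \<xi>) = (\<lambda>\<xi>. hw \<eta> s g \<xi> - hw \<eta> s g' \<xi>)"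
  by (simp add: hw_def[abs_def] scaleR_diff_right)

lemma propagator_vhas_fourier:
  fixes f g :: "'n::finite vfield"
  assumes \<eta>: "lp_cutoff \<eta>" and s: "0 \<le> s" "s < real CARD('n) / 2"
    and f: "vhas_fourier f g" and g: "sq_integrable (hw \<eta> s g)"
  shows "vhas_fourier (propagator \<sigma> t f) (\<lambda>\<xi>. cis (- (t * \<sigma> * (norm \<xi>)\<^sup>2)) *s g \<xi>)"
proof -
  note [measurable] = \<eta> vhas_fourier_measurable(2)[OF f]
  have "sq_integrable (hw \<eta> s (\<lambda>\<xi>. cis (- (t * \<sigma> * (norm \<xi>)\<^sup>2)) *s g \<xi>))"
    using g by (subst hw_phase(1)[OF \<eta>]) auto
  then obtain h where "vhas_fourier h (\<lambda>\<xi>. cis (- (t * \<sigma> * (norm \<xi>)\<^sup>2)) *s g \<xi>)"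
    by (rule weighted_inv_fourier_exists[OF \<eta> s, rotated]) measurable
  then show ?thesis
    unfolding propagator_def by (rule fmult_vec_vhas_fourier[OF f])
qed

lemma Hdot_cong_AE:
  assumes \<eta>: "lp_cutoff \<eta>" and f: "f \<in> Hdot \<eta> s" and ae: "AE x in lborel. f x = f' x" and m: "f' \<in> borel_measurable borel"
  shows "f' \<in> Hdot \<eta> s" "Hdot_norm \<eta> s f' = Hdot_norm \<eta> s f"
proof -
  obtain g where g: "vhas_fourier f g" by (rule Hdot_imp_vhas_fourier[OF f])
  note g' = vhas_fourier_cong_left[OF g ae m]
  show *: "f' \<in> Hdot \<eta> s" using f unfolding Hdot_iff_weighted(1)[OF \<eta> g] Hdot_iff_weighted(1)[OF \<eta> g'] .
  show "Hdot_norm \<eta> s f' = Hdot_norm \<eta> s f"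
    unfolding Hdot_iff_weighted(2)[OF \<eta> g f] Hdot_iff_weighted(2)[OF \<eta> g' *] ..
qed

text \<open>
  The weight for the intersection of two homogeneous spaces. A joint weight yields one limit that serves
  for both norms.
\<close>

definition cw :: "(real \<Rightarrow> real) \<Rightarrow> real \<Rightarrow> real \<Rightarrow> 'n::finite vfield \<Rightarrow> 'n vfield" where
  "cw \<eta> s\<^sub>1 s\<^sub>2 g \<xi> = sqrt (hweight \<eta> s\<^sub>1 \<xi> + hweight \<eta> s\<^sub>2 \<xi>) *\<^sub>R g \<xi>"

lemma cw_facts:
  fixes g :: "'n::finite vfield"
  assumes \<eta>: "lp_cutoff \<eta>" and [measurable]: "g \<in> borel_measurable borel"
  shows "sq_integrable (cw \<eta> s\<^sub>1 s\<^sub>2 g) \<longleftrightarrow> sq_integrable (hw \<eta> s\<^sub>1 g) \<and> sq_integrable (hw \<eta> s\<^sub>2 g)"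
    and "sq_integrable (cw \<eta> s\<^sub>1 s\<^sub>2 g) \<Longrightarrow> (l2n (cw \<eta> s\<^sub>1 s\<^sub>2 g))\<^sup>2 = (l2n (hw \<eta> s\<^sub>1 g))\<^sup>2 + (l2n (hw \<eta> s\<^sub>2 g))\<^sup>2"
proof -
  note [measurable] = \<eta>
  have m: "cw \<eta> s\<^sub>1 s\<^sub>2 g \<in> borel_measurable borel" unfolding cw_def[abs_def] by measurable
  have nn: "0 \<le> hweight \<eta> s \<xi>" for s and \<xi> :: "real^'n" by (rule hweight_nonneg[OF \<eta>])
  have sum: "(norm (cw \<eta> s\<^sub>1 s\<^sub>2 g \<xi>))\<^sup>2 = (norm (hw \<eta> s\<^sub>1 g \<xi>))\<^sup>2 + (norm (hw \<eta> s\<^sub>2 g \<xi>))\<^sup>2" for \<xi>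
    using nn[of s\<^sub>1 \<xi>] nn[of s\<^sub>2 \<xi>] by (simp add: cw_def hw_norm_square[OF \<eta>] power_mult_distrib distrib_right)
  have le: "norm (hw \<eta> s\<^sub>1 g \<xi>) \<le> norm (cw \<eta> s\<^sub>1 s\<^sub>2 g \<xi>)" "norm (hw \<eta> s\<^sub>2 g \<xi>) \<le> norm (cw \<eta> s\<^sub>1 s\<^sub>2 g \<xi>)" for \<xi>
    by (rule power2_le_imp_le, simp add: sum, simp)+
  show *: "sq_integrable (cw \<eta> s\<^sub>1 s\<^sub>2 g) \<longleftrightarrow> sq_integrable (hw \<eta> s\<^sub>1 g) \<and> sq_integrable (hw \<eta> s\<^sub>2 g)"
  proof
    assume c: "sq_integrable (cw \<eta> s\<^sub>1 s\<^sub>2 g)"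
    show "sq_integrable (hw \<eta> s\<^sub>1 g) \<and> sq_integrable (hw \<eta> s\<^sub>2 g)"
      by (intro conjI; rule sq_integrable_bound(1)[OF c]) (use le in auto)
  next
    assume "sq_integrable (hw \<eta> s\<^sub>1 g) \<and> sq_integrable (hw \<eta> s\<^sub>2 g)"
    then show "sq_integrable (cw \<eta> s\<^sub>1 s\<^sub>2 g)"
      unfolding sq_integrable_def sum using m by auto
  qed
  assume "sq_integrable (cw \<eta> s\<^sub>1 s\<^sub>2 g)"
  then show "(l2n (cw \<eta> s\<^sub>1 s\<^sub>2 g))\<^sup>2 = (l2n (hw \<eta> s\<^sub>1 g))\<^sup>2 + (l2n (hw \<eta> s\<^sub>2 g))\<^sup>2"
    unfolding * unfolding l2n_square sum by (auto simp: sq_integrable_def)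
qed

lemma cw_diff: "cw \<eta> s\<^sub>1 s\<^sub>2 (\<lambda>\<xi>. g \<xi> - g' \<xi>) = (\<lambda>\<xi>. cw \<eta> s\<^sub>1 s\<^sub>2 g \<xi> - cw \<eta> s\<^sub>1 s\<^sub>2 g' \<xi>)"
  by (simp add: cw_def[abs_def] scaleR_diff_right)

text \<open>
  The limit exists in $L^2$ after multiplication with the weight. As the weight vanishes only at the origin,
  it can be divided out.
\<close>

lemma cw_complete:
  fixes G :: "real \<Rightarrow> 'n::finite vfield"
  assumes \<eta>: "lp_cutoff \<eta>" and s: "0 \<le> s\<^sub>1" "0 \<le> s\<^sub>2"
    and sq: "\<And>t. sq_integrable (cw \<eta> s\<^sub>1 s\<^sub>2 (G t))"
    and Cauchy: "\<And>e. 0 < e \<Longrightarrow> \<exists>T. \<forall>t\<ge>T. \<forall>t'\<ge>T. l2n (cw \<eta> s\<^sub>1 s\<^sub>2 (\<lambda>\<xi>. G t \<xi> - G t' \<xi>)) < e"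
  obtains g where "g \<in> borel_measurable borel" "sq_integrable (cw \<eta> s\<^sub>1 s\<^sub>2 g)"
    "((\<lambda>t. l2n (cw \<eta> s\<^sub>1 s\<^sub>2 (\<lambda>\<xi>. G t \<xi> - g \<xi>))) \<longlongrightarrow> 0) at_top"
proof -
  note [measurable] = \<eta>
  have C: "\<exists>N. \<forall>i\<ge>N. \<forall>j\<ge>N. l2n (\<lambda>\<xi>. cw \<eta> s\<^sub>1 s\<^sub>2 (G (real i)) \<xi> - cw \<eta> s\<^sub>1 s\<^sub>2 (G (real j)) \<xi>) < e" if e: "0 < e" for e
  proof -
    obtain T where T: "\<forall>t\<ge>T. \<forall>t'\<ge>T. l2n (cw \<eta> s\<^sub>1 s\<^sub>2 (\<lambda>\<xi>. G t \<xi> - G t' \<xi>)) < e"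
      using Cauchy[OF e] by blast
    obtain N where N: "T \<le> real N" using real_arch_simple by blast
    show ?thesis
    proof (intro exI[of _ N] allI impI)
      fix i j assume "N \<le> i" "N \<le> j"
      then have "T \<le> real i" "T \<le> real j" using N by linarith+
      then show "l2n (\<lambda>\<xi>. cw \<eta> s\<^sub>1 s\<^sub>2 (G (real i)) \<xi> - cw \<eta> s\<^sub>1 s\<^sub>2 (G (real j)) \<xi>) < e"
        using T unfolding cw_diff by blast
    qed
  qed
  obtain Y where Y: "sq_integrable Y" and lim: "(\<lambda>n. l2n (\<lambda>\<xi>. cw \<eta> s\<^sub>1 s\<^sub>2 (G (real n)) \<xi> - Y \<xi>)) \<longlonglongrightarrow> 0"
    by (rule sq_integrable_complete[of "\<lambda>n. cw \<eta> s\<^sub>1 s\<^sub>2 (G (real n))", OF sq C]) blast+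
  have [measurable]: "Y \<in> borel_measurable borel" using Y by auto
  define g where "g \<xi> = (1 / sqrt (hweight \<eta> s\<^sub>1 \<xi> + hweight \<eta> s\<^sub>2 \<xi>)) *\<^sub>R Y \<xi>" for \<xi>
  have gm: "g \<in> borel_measurable borel" unfolding g_def by measurable
  have cm: "cw \<eta> s\<^sub>1 s\<^sub>2 g \<in> borel_measurable borel" unfolding cw_def[abs_def] using gm by measurable
  have ae: "AE \<xi> in lborel. cw \<eta> s\<^sub>1 s\<^sub>2 g \<xi> = Y \<xi>"
    using AE_lborel_singleton[of 0]
  proof eventually_elim
    fix \<xi> :: "real^'n" assume "\<xi> \<noteq> 0"
    then have "0 < hweight \<eta> s\<^sub>1 \<xi> + hweight \<eta> s\<^sub>2 \<xi>"
      using hweight_pos[OF \<eta>] s by (intro add_pos_pos) auto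
    then show "cw \<eta> s\<^sub>1 s\<^sub>2 g \<xi> = Y \<xi>" by (simp add: cw_def g_def)
  qed
  have sg: "sq_integrable (cw \<eta> s\<^sub>1 s\<^sub>2 g)"
    using sq_integrable_cong_AE(1)[OF ae cm] Y by simp
  have lim': "(\<lambda>n. l2n (\<lambda>\<xi>. cw \<eta> s\<^sub>1 s\<^sub>2 (G (real n)) \<xi> - cw \<eta> s\<^sub>1 s\<^sub>2 g \<xi>)) \<longlonglongrightarrow> 0"
  proof -
    have "l2n (\<lambda>\<xi>. cw \<eta> s\<^sub>1 s\<^sub>2 (G (real n)) \<xi> - cw \<eta> s\<^sub>1 s\<^sub>2 g \<xi>) = l2n (\<lambda>\<xi>. cw \<eta> s\<^sub>1 s\<^sub>2 (G (real n)) \<xi> - Y \<xi>)" for n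
    proof (rule sq_integrable_cong_AE(2))
      show "AE \<xi> in lborel. cw \<eta> s\<^sub>1 s\<^sub>2 (G (real n)) \<xi> - cw \<eta> s\<^sub>1 s\<^sub>2 g \<xi> = cw \<eta> s\<^sub>1 s\<^sub>2 (G (real n)) \<xi> - Y \<xi>"
        using ae by eventually_elim simp
    qed (use sq_integrable_measurable[OF sq] cm in measurable)
    then show ?thesis using lim by simp
  qed
  have "((\<lambda>t. l2n (cw \<eta> s\<^sub>1 s\<^sub>2 (\<lambda>\<xi>. G t \<xi> - g \<xi>))) \<longlongrightarrow> 0) at_top"
  proof (rule tendstoI)
    fix e :: real assume e: "0 < e"
    obtain T where T: "\<forall>t\<ge>T. \<forall>t'\<ge>T. l2n (cw \<eta> s\<^sub>1 s\<^sub>2 (\<lambda>\<xi>. G t \<xi> - G t' \<xi>)) < e / 2"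
      using Cauchy[of "e / 2"] e by auto
    have "\<forall>\<^sub>F n in sequentially. l2n (\<lambda>\<xi>. cw \<eta> s\<^sub>1 s\<^sub>2 (G (real n)) \<xi> - cw \<eta> s\<^sub>1 s\<^sub>2 g \<xi>) < e / 2"
      using order_tendstoD(2)[OF lim', of "e / 2"] e by simp
    moreover have "\<forall>\<^sub>F n in sequentially. T \<le> real n"
      using eventually_ge_at_top[of "nat \<lceil>T\<rceil>"] by eventually_elim linarith
    ultimately have "\<forall>\<^sub>F n in sequentially. l2n (\<lambda>\<xi>. cw \<eta> s\<^sub>1 s\<^sub>2 (G (real n)) \<xi> - cw \<eta> s\<^sub>1 s\<^sub>2 g \<xi>) < e / 2 \<and> T \<le> real n"
      by eventually_elim simp
    then obtain n where n: "l2n (\<lambda>\<xi>. cw \<eta> s\<^sub>1 s\<^sub>2 (G (real n)) \<xi> - cw \<eta> s\<^sub>1 s\<^sub>2 g \<xi>) < e / 2" "T \<le> real n"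
      by (auto simp: eventually_sequentially)
    have "dist (l2n (cw \<eta> s\<^sub>1 s\<^sub>2 (\<lambda>\<xi>. G t \<xi> - g \<xi>))) 0 < e" if "T \<le> t" for t
    proof -
      have "l2n (\<lambda>\<xi>. cw \<eta> s\<^sub>1 s\<^sub>2 (G t) \<xi> - cw \<eta> s\<^sub>1 s\<^sub>2 g \<xi>) \<le>
         l2n (\<lambda>\<xi>. cw \<eta> s\<^sub>1 s\<^sub>2 (G t) \<xi> - cw \<eta> s\<^sub>1 s\<^sub>2 (G (real n)) \<xi>) + l2n (\<lambda>\<xi>. cw \<eta> s\<^sub>1 s\<^sub>2 (G (real n)) \<xi> - cw \<eta> s\<^sub>1 s\<^sub>2 g \<xi>)"
        by (rule l2n_triangle3[OF sq sq sg])
      moreover have "l2n (\<lambda>\<xi>. cw \<eta> s\<^sub>1 s\<^sub>2 (G t) \<xi> - cw \<eta> s\<^sub>1 s\<^sub>2 (G (real n)) \<xi>) < e / 2"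
        using T that n(2) unfolding cw_diff by blast
      ultimately show ?thesis using n(1) unfolding cw_diff by (simp add: dist_real_def)
    qed
    then show "\<forall>\<^sub>F t in at_top. dist (l2n (cw \<eta> s\<^sub>1 s\<^sub>2 (\<lambda>\<xi>. G t \<xi> - g \<xi>))) 0 < e"
      by (auto simp: eventually_at_top_linorder)
  qed
  then show ?thesis using that gm sg by blast
qed

text \<open>
  Let $G_t=e^{it\sigma|\xi|^2}\hat v(t)$ be the profile on the Fourier side. By Plancherel's theorem
  $\psi_N(G_t-G_{t'})$ tends to zero as $t,t'\to\infty$ for each $N$, since the profile of $P_Nv$ is in
  $U^2$. It is bounded by a multiple of the $U^2$ norm, and the weighted squares of these norms are summable. So
  Tannery's theorem gives the Cauchy property of $G_t$ in the weighted space. The inverse Fourier transform of the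
  limit is the scattering state; undoing the phase does not change norms.
\<close>

theorem Z_scattering:
  fixes v :: "'n::finite traj"
  assumes \<eta>: "lp_cutoff \<eta>" and s\<^sub>1: "0 \<le> s\<^sub>1" "s\<^sub>1 < real CARD('n) / 2" and s\<^sub>2: "0 \<le> s\<^sub>2"
    and mem: "\<And>t. v t \<in> Hdot \<eta> s\<^sub>1 \<inter> Hdot \<eta> s\<^sub>2"
    and U2: "\<And>N. N \<in> dyadic \<Longrightarrow> (\<lambda>t. LP \<eta> N (v t)) \<in> U2\<sigma> \<sigma>"
    and fin: "Zdot_finite \<eta> s\<^sub>1 \<sigma> v" "Zdot_finite \<eta> s\<^sub>2 \<sigma> v"
  obtains f where "f \<in> Hdot \<eta> s\<^sub>1 \<inter> Hdot \<eta> s\<^sub>2"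
    "\<And>t. (\<lambda>x. v t x - propagator \<sigma> t f x) \<in> Hdot \<eta> s\<^sub>1 \<inter> Hdot \<eta> s\<^sub>2"
    "\<And>s. s \<in> {s\<^sub>1, s\<^sub>2} \<Longrightarrow> ((\<lambda>t. Hdot_norm \<eta> s (\<lambda>x. v t x - propagator \<sigma> t f x)) \<longlongrightarrow> 0) at_top"
proof -
  note [measurable] = \<eta>
  let ?T = "gauss_mass TYPE('n)"
  have "\<forall>t. \<exists>g. vhas_fourier (v t) g"
    using mem Hdot_imp_vhas_fourier by blast
  then obtain g where g: "\<And>t. vhas_fourier (v t) (g t)" by metis
  have [measurable]: "g t \<in> borel_measurable borel" for t by (rule vhas_fourier_measurable[OF g])
  define G where "G t \<xi> = cis (t * \<sigma> * (norm \<xi>)\<^sup>2) *s g t \<xi>" for t \<xi>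
  have [measurable]: "G t \<in> borel_measurable borel" for t unfolding G_def by measurable
  have hwg: "sq_integrable (hw \<eta> s (g t))" if "s \<in> {s\<^sub>1, s\<^sub>2}" for s t
    using mem[of t] that Hdot_iff_weighted(1)[OF \<eta> g] by auto
  have hwG: "sq_integrable (hw \<eta> s (G t))" if "s \<in> {s\<^sub>1, s\<^sub>2}" for s t
    unfolding G_def using hwg[OF that] by (subst hw_phase(1)[OF \<eta>]) auto
  let ?p = "\<lambda>n k \<xi>. complex_of_real (psi \<eta> n \<xi>) *s k \<xi>"
  \<comment> \<open>The profile of a dyadic piece, whose transform is the corresponding piece of \<open>G t\<close>.\<close>
  define U where "U n t = propagator \<sigma> (- t) (LP \<eta> (dy n) (v t))" for n t
  have FU: "vhas_fourier (U n t) (?p n (G t))" for n t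
  proof -
    have "sq_integrable (?p n (g t))"
      using hwg[of s\<^sub>1 t] hw_dyadic(1)[OF \<eta>, of "g t" s\<^sub>1] by auto
    from propagator_vhas_fourier_L2[OF LP_vhas_fourier[OF \<eta> g dy_pos] this, of \<sigma> "- t"]
    show ?thesis by (simp add: U_def G_def mult.commute)
  qed
  have UU2: "U n \<in> U2" for n
    using U2[OF dy_in, of n] by (simp add: U2\<sigma>_def U_def[abs_def])
  define A where "A n = U2_norm (U n)" for n
  have UA: "l2n (U n t) \<le> A n" "sq_integrable (U n t)" for n t
    unfolding A_def by (auto intro: U2_bounded[OF UU2])
  have FD: "vhas_fourier (\<lambda>x. U n t x - U n t' x) (?p n (\<lambda>\<xi>. G t \<xi> - G t' \<xi>))" for n t t'
    using vhas_fourier_diff[OF FU FU, of n t n t'] by (simp add: vector_ssub_ldistrib)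
  define D where "D n = (\<lambda>(t, t'). l2n (?p n (\<lambda>\<xi>. G t \<xi> - G t' \<xi>)))" for n
  have D: "D n (t, t') = ?T * l2n (\<lambda>x. U n t x - U n t' x)" for n t t'
  proof -
    have "sq_integrable (?p n (\<lambda>\<xi>. G t \<xi> - G t' \<xi>))"
      using vector_Plancherel(1)[OF FD] sq_integrable_diff[OF UA(2) UA(2)] by blast
    from vector_Plancherel(2)[OF FD this] show ?thesis by (simp add: D_def)
  qed
  have Dbound: "\<bar>D n p\<bar> \<le> 2 * ?T * A n" for n p
  proof (cases p)
    case (Pair t t')
    have "l2n (\<lambda>x. U n t x - U n t' x) \<le> 2 * A n"
      using l2n_triangle_diff[OF UA(2) UA(2), of n t n t'] UA(1)[of n t] UA(1)[of n t'] by linarith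
    then have "?T * l2n (\<lambda>x. U n t x - U n t' x) \<le> ?T * (2 * A n)"
      by (intro mult_left_mono) (auto simp: less_imp_le)
    then show ?thesis by (simp add: Pair D less_imp_le)
  qed
  \<comment> \<open>The Cauchy property in the form of a limit in two time variables, to which dominated convergence applies.\<close>
  have Dlim: "(D n \<longlongrightarrow> 0) (at_top \<times>\<^sub>F at_top)" for n
  proof (rule tendstoI)
    fix e :: real assume e: "0 < e"
    obtain T0 where T0: "\<forall>t\<ge>T0. \<forall>t'\<ge>T0. l2n (\<lambda>x. U n t x - U n t' x) < e / ?T"
      using U2_Cauchy_at_infinity[OF UU2, of "e / ?T" n] e by auto
    have "dist (D n (t, t')) 0 < e" if "T0 \<le> t" "T0 \<le> t'" for t t'
      using T0 that by (auto simp: D dist_real_def pos_less_divide_eq mult.commute less_imp_le abs_of_nonneg)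
    then show "\<forall>\<^sub>F p in at_top \<times>\<^sub>F at_top. dist (D n p) 0 < e"
      unfolding eventually_prod_filter
      by (intro exI[of _ "\<lambda>t. T0 \<le> t"]) (auto simp: eventually_ge_at_top)
  qed
  have Asum: "summable (\<lambda>n. dy n powr (2 * s) * (A n)\<^sup>2)" if "s \<in> {s\<^sub>1, s\<^sub>2}" for s
  proof -
    have "Zdot_finite \<eta> s \<sigma> v" using that fin by auto
    then show ?thesis
      unfolding Zdot_finite_def by (subst (asm) dyadic_sum(1)) (auto simp: A_def U_def[abs_def] U2\<sigma>_norm_def)
  qed
  have Hlim: "((\<lambda>p. (l2n (hw \<eta> s (\<lambda>\<xi>. G (fst p) \<xi> - G (snd p) \<xi>)))\<^sup>2) \<longlongrightarrow> 0) (at_top \<times>\<^sub>F at_top)"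
    if s: "s \<in> {s\<^sub>1, s\<^sub>2}" for s
  proof -
    have eq: "(l2n (hw \<eta> s (\<lambda>\<xi>. G (fst p) \<xi> - G (snd p) \<xi>)))\<^sup>2 = (\<Sum>n. dy n powr (2 * s) * (D n p)\<^sup>2)" for p
    proof -
      have "sq_integrable (hw \<eta> s (\<lambda>\<xi>. G (fst p) \<xi> - G (snd p) \<xi>))"
        unfolding hw_diff by (intro sq_integrable_diff hwG s)
      from hw_dyadic(2)[OF \<eta> _ this] show ?thesis by (simp add: D_def split_beta)
    qed
    have "((\<lambda>p. \<Sum>n. dy n powr (2 * s) * (D n p)\<^sup>2) \<longlongrightarrow> (\<Sum>n. 0 :: real)) (at_top \<times>\<^sub>F at_top)"
    proof (rule tannerys_theorem[THEN conjunct2, THEN conjunct2])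
      show "((\<lambda>p. dy n powr (2 * s) * (D n p)\<^sup>2) \<longlongrightarrow> 0) (at_top \<times>\<^sub>F at_top)" for n
        using tendsto_mult[OF tendsto_const tendsto_power[OF Dlim, of _ 2]] by fastforce
      show "summable (\<lambda>n. (2 * ?T)\<^sup>2 * (dy n powr (2 * s) * (A n)\<^sup>2))"
        by (rule summable_mult[OF Asum[OF s]])
      have "norm (dy n powr (2 * s) * (D n p)\<^sup>2) \<le> (2 * ?T)\<^sup>2 * (dy n powr (2 * s) * (A n)\<^sup>2)" for n p
      proof -
        have "\<bar>D n p\<bar>\<^sup>2 \<le> (2 * ?T * A n)\<^sup>2" by (intro power_mono Dbound) simp
        then have "dy n powr (2 * s) * (D n p)\<^sup>2 \<le> dy n powr (2 * s) * (2 * ?T * A n)\<^sup>2"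
          by (intro mult_left_mono) auto
        then show ?thesis by (simp add: power_mult_distrib mult_ac)
      qed
      then show "\<forall>\<^sub>F (n, p) in at_top \<times>\<^sub>F (at_top \<times>\<^sub>F at_top). norm (dy n powr (2 * s) * (D n p)\<^sup>2) \<le> (2 * ?T)\<^sup>2 * (dy n powr (2 * s) * (A n)\<^sup>2)"
        by (intro always_eventually) auto
    qed (simp add: prod_filter_eq_bot)
    then show ?thesis by (simp add: eq)
  qed
  have cwG: "sq_integrable (cw \<eta> s\<^sub>1 s\<^sub>2 (G t))" for t
    using hwG by (subst cw_facts(1)[OF \<eta>]) auto
  have Cauchy: "\<exists>T. \<forall>t\<ge>T. \<forall>t'\<ge>T. l2n (cw \<eta> s\<^sub>1 s\<^sub>2 (\<lambda>\<xi>. G t \<xi> - G t' \<xi>)) < e" if e: "0 < e" for e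
  proof -
    have sq: "(l2n (cw \<eta> s\<^sub>1 s\<^sub>2 (\<lambda>\<xi>. G t \<xi> - G t' \<xi>)))\<^sup>2 =
       (l2n (hw \<eta> s\<^sub>1 (\<lambda>\<xi>. G t \<xi> - G t' \<xi>)))\<^sup>2 + (l2n (hw \<eta> s\<^sub>2 (\<lambda>\<xi>. G t \<xi> - G t' \<xi>)))\<^sup>2" for t t'
    proof (rule cw_facts(2)[OF \<eta>])
      show "sq_integrable (cw \<eta> s\<^sub>1 s\<^sub>2 (\<lambda>\<xi>. G t \<xi> - G t' \<xi>))"
        unfolding cw_diff by (rule sq_integrable_diff[OF cwG cwG])
    qed measurable
    have "((\<lambda>p. (l2n (hw \<eta> s\<^sub>1 (\<lambda>\<xi>. G (fst p) \<xi> - G (snd p) \<xi>)))\<^sup>2 + (l2n (hw \<eta> s\<^sub>2 (\<lambda>\<xi>. G (fst p) \<xi> - G (snd p) \<xi>)))\<^sup>2) \<longlongrightarrow> 0 + 0) (at_top \<times>\<^sub>F at_top)"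
      by (intro tendsto_add Hlim) auto
    then have "\<forall>\<^sub>F p in at_top \<times>\<^sub>F at_top. (l2n (hw \<eta> s\<^sub>1 (\<lambda>\<xi>. G (fst p) \<xi> - G (snd p) \<xi>)))\<^sup>2 + (l2n (hw \<eta> s\<^sub>2 (\<lambda>\<xi>. G (fst p) \<xi> - G (snd p) \<xi>)))\<^sup>2 < e\<^sup>2"
      using e by (auto dest!: order_tendstoD(2)[where a="e\<^sup>2"])
    then obtain P Q where PQ: "\<forall>\<^sub>F t in at_top. P t" "\<forall>\<^sub>F t in at_top. Q t"
      and lt: "\<And>t t'. P t \<Longrightarrow> Q t' \<Longrightarrow> (l2n (cw \<eta> s\<^sub>1 s\<^sub>2 (\<lambda>\<xi>. G t \<xi> - G t' \<xi>)))\<^sup>2 < e\<^sup>2"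
      unfolding eventually_prod_filter sq by auto
    have "\<forall>\<^sub>F t in at_top. P t \<and> Q t" using PQ by eventually_elim simp
    then obtain T where "\<And>t. T \<le> t \<Longrightarrow> P t \<and> Q t" by (auto simp: eventually_at_top_linorder)
    then have "l2n (cw \<eta> s\<^sub>1 s\<^sub>2 (\<lambda>\<xi>. G t \<xi> - G t' \<xi>)) < e" if "T \<le> t" "T \<le> t'" for t t'
      using lt[of t t'] that e by (auto intro: power2_less_imp_less)
    then show ?thesis by blast
  qed
  obtain h where hm[measurable]: "h \<in> borel_measurable borel" and ch: "sq_integrable (cw \<eta> s\<^sub>1 s\<^sub>2 h)"
    and lim: "((\<lambda>t. l2n (cw \<eta> s\<^sub>1 s\<^sub>2 (\<lambda>\<xi>. G t \<xi> - h \<xi>))) \<longlongrightarrow> 0) at_top"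
    by (rule cw_complete[of \<eta> s\<^sub>1 s\<^sub>2 G, OF \<eta> s\<^sub>1(1) s\<^sub>2 cwG Cauchy]) blast+
  have hh: "sq_integrable (hw \<eta> s h)" if "s \<in> {s\<^sub>1, s\<^sub>2}" for s
    using ch that cw_facts(1)[OF \<eta> hm] by auto
  obtain f where f: "vhas_fourier f h"
    by (rule weighted_inv_fourier_exists[OF \<eta> s\<^sub>1 hm hh]) auto
  have fH: "f \<in> Hdot \<eta> s\<^sub>1 \<inter> Hdot \<eta> s\<^sub>2"
    using hh Hdot_iff_weighted(1)[OF \<eta> f] by auto
  have FP: "vhas_fourier (propagator \<sigma> t f) (\<lambda>\<xi>. cis (- (t * \<sigma> * (norm \<xi>)\<^sup>2)) *s h \<xi>)" for t
    by (rule propagator_vhas_fourier[OF \<eta> s\<^sub>1 f hh]) simp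
  have Fdiff: "vhas_fourier (\<lambda>x. v t x - propagator \<sigma> t f x) (\<lambda>\<xi>. cis (- (t * \<sigma> * (norm \<xi>)\<^sup>2)) *s (G t \<xi> - h \<xi>))" for t
  proof -
    have "g t \<xi> - cis (- (t * \<sigma> * (norm \<xi>)\<^sup>2)) *s h \<xi> = cis (- (t * \<sigma> * (norm \<xi>)\<^sup>2)) *s (G t \<xi> - h \<xi>)" for \<xi>
      unfolding G_def by (simp add: vec_eq_iff right_diff_distrib mult.assoc[symmetric] cis_mult)
    then show ?thesis using vhas_fourier_diff[OF g FP, of t t] by simp
  qed
  have cd: "sq_integrable (cw \<eta> s\<^sub>1 s\<^sub>2 (\<lambda>\<xi>. G t \<xi> - h \<xi>))" for t
    unfolding cw_diff by (rule sq_integrable_diff[OF cwG ch])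
  have hd: "sq_integrable (hw \<eta> s (\<lambda>\<xi>. G t \<xi> - h \<xi>))" if "s \<in> {s\<^sub>1, s\<^sub>2}" for s t
    unfolding hw_diff by (rule sq_integrable_diff[OF hwG[OF that] hh[OF that]])
  have memd: "(\<lambda>x. v t x - propagator \<sigma> t f x) \<in> Hdot \<eta> s" if "s \<in> {s\<^sub>1, s\<^sub>2}" for s t
    unfolding Hdot_iff_weighted(1)[OF \<eta> Fdiff] using hd[OF that] by (subst hw_phase(1)[OF \<eta>]) auto
  have nrm: "Hdot_norm \<eta> s (\<lambda>x. v t x - propagator \<sigma> t f x) = l2n (hw \<eta> s (\<lambda>\<xi>. G t \<xi> - h \<xi>)) / ?T" if "s \<in> {s\<^sub>1, s\<^sub>2}" for s t
    unfolding Hdot_iff_weighted(2)[OF \<eta> Fdiff memd[OF that]] by (subst hw_phase(2)[OF \<eta>]) auto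
  show ?thesis
  proof (rule that[of f])
    show "f \<in> Hdot \<eta> s\<^sub>1 \<inter> Hdot \<eta> s\<^sub>2" by (rule fH)
    show "(\<lambda>x. v t x - propagator \<sigma> t f x) \<in> Hdot \<eta> s\<^sub>1 \<inter> Hdot \<eta> s\<^sub>2" for t
      using memd by auto
    fix s assume s: "s \<in> {s\<^sub>1, s\<^sub>2}"
    show "((\<lambda>t. Hdot_norm \<eta> s (\<lambda>x. v t x - propagator \<sigma> t f x)) \<longlongrightarrow> 0) at_top"
    proof (rule Lim_null_comparison)
      show "\<forall>\<^sub>F t in at_top. norm (Hdot_norm \<eta> s (\<lambda>x. v t x - propagator \<sigma> t f x)) \<le> l2n (cw \<eta> s\<^sub>1 s\<^sub>2 (\<lambda>\<xi>. G t \<xi> - h \<xi>)) / ?T"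
      proof (intro always_eventually allI)
        fix t
        have "(l2n (hw \<eta> s (\<lambda>\<xi>. G t \<xi> - h \<xi>)))\<^sup>2 \<le> (l2n (cw \<eta> s\<^sub>1 s\<^sub>2 (\<lambda>\<xi>. G t \<xi> - h \<xi>)))\<^sup>2"
          using s by (subst cw_facts(2)[OF \<eta> _ cd]) auto
        then have "l2n (hw \<eta> s (\<lambda>\<xi>. G t \<xi> - h \<xi>)) \<le> l2n (cw \<eta> s\<^sub>1 s\<^sub>2 (\<lambda>\<xi>. G t \<xi> - h \<xi>))"
          by (rule power2_le_imp_le) simp
        then show "norm (Hdot_norm \<eta> s (\<lambda>x. v t x - propagator \<sigma> t f x)) \<le> l2n (cw \<eta> s\<^sub>1 s\<^sub>2 (\<lambda>\<xi>. G t \<xi> - h \<xi>)) / ?T"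
          unfolding nrm[OF s] by (simp add: divide_right_mono less_imp_le)
      qed
      show "((\<lambda>t. l2n (cw \<eta> s\<^sub>1 s\<^sub>2 (\<lambda>\<xi>. G t \<xi> - h \<xi>)) / ?T) \<longlongrightarrow> 0) at_top"
        using tendsto_divide[OF lim tendsto_const[of ?T]] by simp
    qed
  qed
qed

lemma restr_scattering:
  fixes u :: "'n::finite traj"
  assumes \<eta>: "lp_cutoff \<eta>" and s\<^sub>1: "0 \<le> s\<^sub>1" "s\<^sub>1 < real CARD('n) / 2" and s\<^sub>2: "0 \<le> s\<^sub>2"
    and u: "u \<in> restr {0..} Z"
    and Z: "\<And>v. v \<in> Z \<Longrightarrow> (\<forall>t. v t \<in> Hdot \<eta> s\<^sub>1 \<inter> Hdot \<eta> s\<^sub>2) \<and> (\<forall>N\<in>dyadic. (\<lambda>t. LP \<eta> N (v t)) \<in> U2\<sigma> \<sigma>)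
      \<and> Zdot_finite \<eta> s\<^sub>1 \<sigma> v \<and> Zdot_finite \<eta> s\<^sub>2 \<sigma> v"
  obtains f where "f \<in> Hdot \<eta> s\<^sub>1 \<inter> Hdot \<eta> s\<^sub>2"
    "\<And>t. 0 \<le> t \<Longrightarrow> (\<lambda>x. u t x - propagator \<sigma> t f x) \<in> Hdot \<eta> s\<^sub>1 \<inter> Hdot \<eta> s\<^sub>2"
    "\<And>s. s \<in> {s\<^sub>1, s\<^sub>2} \<Longrightarrow> ((\<lambda>t. Hdot_norm \<eta> s (\<lambda>x. u t x - propagator \<sigma> t f x)) \<longlongrightarrow> 0) at_top"
proof -
  obtain v where v: "v \<in> Z" "agree_on {0..} u v" and um: "\<And>t. 0 \<le> t \<Longrightarrow> u t \<in> borel_measurable borel"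
    using u by (auto simp: restr_def)
  note Zv = Z[OF v(1)]
  obtain f where f: "f \<in> Hdot \<eta> s\<^sub>1 \<inter> Hdot \<eta> s\<^sub>2"
    and mem: "\<And>t. (\<lambda>x. v t x - propagator \<sigma> t f x) \<in> Hdot \<eta> s\<^sub>1 \<inter> Hdot \<eta> s\<^sub>2"
    and lim: "\<And>s. s \<in> {s\<^sub>1, s\<^sub>2} \<Longrightarrow> ((\<lambda>t. Hdot_norm \<eta> s (\<lambda>x. v t x - propagator \<sigma> t f x)) \<longlongrightarrow> 0) at_top"
    by (rule Z_scattering[OF \<eta> s\<^sub>1 s\<^sub>2, of v \<sigma>]) (use Zv in blast)+
  have Hm: "k \<in> borel_measurable borel" if "k \<in> Hdot \<eta> s\<^sub>1 \<inter> Hdot \<eta> s\<^sub>2" for k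
    using that Hdot_imp_vhas_fourier[of k \<eta> s\<^sub>1] vhas_fourier_measurable(1) by blast
  have pm: "propagator \<sigma> t f \<in> borel_measurable borel" for t
  proof -
    have "(\<lambda>x. v t x - (v t x - propagator \<sigma> t f x)) \<in> borel_measurable borel"
      using Zv by (intro borel_measurable_diff Hm mem) blast
    then show ?thesis by simp
  qed
  have ae: "AE x in lborel. v t x - propagator \<sigma> t f x = u t x - propagator \<sigma> t f x" if t: "0 \<le> t" for t
  proof -
    have "AE x in lborel. u t x = v t x" using v(2) t by (simp add: agree_on_def)
    then show ?thesis by eventually_elim simp
  qed
  have dm: "(\<lambda>x. u t x - propagator \<sigma> t f x) \<in> borel_measurable borel" if "0 \<le> t" for t
    by (intro borel_measurable_diff um pm that)
  have mem': "(\<lambda>x. v t x - propagator \<sigma> t f x) \<in> Hdot \<eta> s" if "s \<in> {s\<^sub>1, s\<^sub>2}" for s t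
    using mem[of t] that by auto
  show ?thesis
  proof (rule that[OF f])
    show "(\<lambda>x. u t x - propagator \<sigma> t f x) \<in> Hdot \<eta> s\<^sub>1 \<inter> Hdot \<eta> s\<^sub>2" if "0 \<le> t" for t
      using Hdot_cong_AE(1)[OF \<eta> mem' ae[OF that] dm[OF that]] by auto
    fix s assume s: "s \<in> {s\<^sub>1, s\<^sub>2}"
    have "\<forall>\<^sub>F t in at_top. Hdot_norm \<eta> s (\<lambda>x. v t x - propagator \<sigma> t f x) = Hdot_norm \<eta> s (\<lambda>x. u t x - propagator \<sigma> t f x)"
      using eventually_ge_at_top[of 0]
      by eventually_elim (rule Hdot_cong_AE(2)[OF \<eta> mem'[OF s] ae dm, symmetric])
    from tendsto_cong[OF this] lim[OF s]
    show "((\<lambda>t. Hdot_norm \<eta> s (\<lambda>x. u t x - propagator \<sigma> t f x)) \<longlongrightarrow> 0) at_top" by blast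
  qed
qed

section \<open>Time reversal\<close>

lemma norm_vcnj: "norm (vcnj f x) = norm (f x)"
  by (simp add: vcnj_def norm_vec_def)

lemma Hdot_vcnj:
  fixes f :: "'n::finite vfield"
  assumes \<eta>: "lp_cutoff \<eta>" and f: "f \<in> Hdot \<eta> s"
  shows "vcnj f \<in> Hdot \<eta> s" "Hdot_norm \<eta> s (vcnj f) = Hdot_norm \<eta> s f"
proof -
  note [measurable] = \<eta>
  obtain g where g: "vhas_fourier f g" by (rule Hdot_imp_vhas_fourier[OF f])
  note g' = vhas_fourier_vcnj[OF g]
  let ?g = "vcnj (\<lambda>\<xi>. g (- \<xi>))"
  have [measurable]: "g \<in> borel_measurable borel" "?g \<in> borel_measurable borel"
    using vhas_fourier_measurable(2)[OF g] vhas_fourier_measurable(2)[OF g'] by auto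
  have m: "hw \<eta> s g \<in> borel_measurable borel" "hw \<eta> s ?g \<in> borel_measurable borel" by measurable
  have n: "norm (hw \<eta> s ?g \<xi>) = norm (hw \<eta> s g (- \<xi>))" for \<xi>
    by (simp add: hw_def norm_vcnj)
  have sq: "sq_integrable (hw \<eta> s g)" using f Hdot_iff_weighted(1)[OF \<eta> g] by simp
  then have "integrable lborel (\<lambda>\<xi>. (norm (hw \<eta> s g (- \<xi>)))\<^sup>2)"
    unfolding sq_integrable_def by (intro integrable_lborel_uminus[of "\<lambda>\<xi>. (norm (hw \<eta> s g \<xi>))\<^sup>2"]) simp
  then have sq': "sq_integrable (hw \<eta> s ?g)" using m(2) by (simp add: sq_integrable_def n)
  have l: "l2n (hw \<eta> s ?g) = l2n (hw \<eta> s g)"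
    unfolding l2n_def n using integral_lborel_uminus[of "\<lambda>\<xi>. (norm (hw \<eta> s g \<xi>))\<^sup>2"] m(1) by simp
  show *: "vcnj f \<in> Hdot \<eta> s" using sq' Hdot_iff_weighted(1)[OF \<eta> g'] by simp
  show "Hdot_norm \<eta> s (vcnj f) = Hdot_norm \<eta> s f"
    unfolding Hdot_iff_weighted(2)[OF \<eta> g f] Hdot_iff_weighted(2)[OF \<eta> g' *] l ..
qed

text \<open>
  Conjugation of a function conjugates and reflects its transform. The symbol is even in $\xi$ and its conjugate
  is the symbol at the reversed time.
\<close>

lemma propagator_vcnj:
  fixes f :: "'n::finite vfield"
  assumes \<eta>: "lp_cutoff \<eta>" and s: "0 \<le> s" "s < real CARD('n) / 2" and f: "f \<in> Hdot \<eta> s"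
  shows "AE x in lborel. vcnj (propagator \<sigma> (- t) f) x = propagator \<sigma> t (vcnj f) x"
    and "propagator \<sigma> t f \<in> borel_measurable borel"
proof -
  obtain g where g: "vhas_fourier f g" by (rule Hdot_imp_vhas_fourier[OF f])
  have sg: "sq_integrable (hw \<eta> s g)" using f Hdot_iff_weighted(1)[OF \<eta> g] by simp
  have gc: "vhas_fourier (vcnj f) (vcnj (\<lambda>\<xi>. g (- \<xi>)))" by (rule vhas_fourier_vcnj[OF g])
  have sgc: "sq_integrable (hw \<eta> s (vcnj (\<lambda>\<xi>. g (- \<xi>))))"
    using Hdot_vcnj(1)[OF \<eta> f] Hdot_iff_weighted(1)[OF \<eta> gc] by simp
  have 1: "vhas_fourier (propagator \<sigma> t f) (\<lambda>\<xi>. cis (- (t * \<sigma> * (norm \<xi>)\<^sup>2)) *s g \<xi>)" for t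
    by (rule propagator_vhas_fourier[OF \<eta> s g sg])
  show "propagator \<sigma> t f \<in> borel_measurable borel" by (rule vhas_fourier_measurable[OF 1])
  have 2: "vhas_fourier (propagator \<sigma> t (vcnj f)) (\<lambda>\<xi>. cis (- (t * \<sigma> * (norm \<xi>)\<^sup>2)) *s vcnj (\<lambda>\<xi>. g (- \<xi>)) \<xi>)"
    by (rule propagator_vhas_fourier[OF \<eta> s gc sgc])
  have "vcnj (\<lambda>\<xi>. cis (- (- t * \<sigma> * (norm (- \<xi>))\<^sup>2)) *s g (- \<xi>)) = (\<lambda>\<xi>. cis (- (t * \<sigma> * (norm \<xi>)\<^sup>2)) *s vcnj (\<lambda>\<xi>. g (- \<xi>)) \<xi>)"
    by (simp add: vcnj_def fun_eq_iff vec_eq_iff cis_cnj)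
  with vhas_fourier_vcnj[OF 1[of "- t"]]
  have "vhas_fourier (vcnj (propagator \<sigma> (- t) f)) (\<lambda>\<xi>. cis (- (t * \<sigma> * (norm \<xi>)\<^sup>2)) *s vcnj (\<lambda>\<xi>. g (- \<xi>)) \<xi>)"
    by simp
  then show "AE x in lborel. vcnj (propagator \<sigma> (- t) f) x = propagator \<sigma> t (vcnj f) x"
    by (rule vhas_fourier_unique_left[OF _ 2])
qed

lemma vcnj_scattering:
  fixes f F :: "'n::finite vfield"
  assumes \<eta>: "lp_cutoff \<eta>" and s: "0 \<le> s" "s < real CARD('n) / 2" and f: "f \<in> Hdot \<eta> s"
    and F: "(\<lambda>x. F x - propagator \<sigma> (- t) f x) \<in> Hdot \<eta> s'"
  shows "(\<lambda>x. vcnj F x - propagator \<sigma> t (vcnj f) x) \<in> Hdot \<eta> s'"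
    and "Hdot_norm \<eta> s' (\<lambda>x. vcnj F x - propagator \<sigma> t (vcnj f) x) = Hdot_norm \<eta> s' (\<lambda>x. F x - propagator \<sigma> (- t) f x)"
proof -
  let ?D = "\<lambda>x. F x - propagator \<sigma> (- t) f x"
  have ae: "AE x in lborel. vcnj ?D x = vcnj F x - propagator \<sigma> t (vcnj f) x"
    using propagator_vcnj(1)[OF \<eta> s f, of \<sigma> t]
    by eventually_elim (simp add: vcnj_def vec_eq_iff)
  have Dm: "vcnj ?D \<in> borel_measurable borel"
    using Hdot_imp_vhas_fourier[OF Hdot_vcnj(1)[OF \<eta> F]] vhas_fourier_measurable(1) by blast
  have pm: "vcnj (propagator \<sigma> (- t) f) \<in> borel_measurable borel"
    unfolding borel_measurable_vec_iff vcnj_def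
    using propagator_vcnj(2)[OF \<eta> s f, of \<sigma> "- t"] by auto
  have "vcnj F = (\<lambda>x. vcnj ?D x + vcnj (propagator \<sigma> (- t) f) x)"
    by (simp add: vcnj_def fun_eq_iff vec_eq_iff)
  then have "vcnj F \<in> borel_measurable borel" using Dm pm by simp
  then have m: "(\<lambda>x. vcnj F x - propagator \<sigma> t (vcnj f) x) \<in> borel_measurable borel"
    by (intro borel_measurable_diff propagator_vcnj(2)[OF \<eta> s Hdot_vcnj(1)[OF \<eta> f]])
  note c = Hdot_cong_AE[OF \<eta> Hdot_vcnj(1)[OF \<eta> F] ae m]
  show "(\<lambda>x. vcnj F x - propagator \<sigma> t (vcnj f) x) \<in> Hdot \<eta> s'" by (rule c(1))
  show "Hdot_norm \<eta> s' (\<lambda>x. vcnj F x - propagator \<sigma> t (vcnj f) x) = Hdot_norm \<eta> s' ?D"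
    using c(2) Hdot_vcnj(2)[OF \<eta> F] by simp
qed

text \<open>
  The factor \<open>c\<close> is 0 for the homogeneous norm with $s_1=s_2$ and 1 for the sum of the two norms.
  The state at $-\infty$ is the conjugate of the state at $+\infty$ for the conjugate data.
\<close>

lemma flow_scattering:
  fixes S :: "'n::finite data \<Rightarrow> 'n sol" and D :: "'n data"
  assumes \<eta>: "lp_cutoff \<eta>" and s\<^sub>1: "0 \<le> s\<^sub>1" "s\<^sub>1 < real CARD('n) / 2" and s\<^sub>2: "0 \<le> s\<^sub>2"
    and H: "H = Hdot \<eta> s\<^sub>1 \<inter> Hdot \<eta> s\<^sub>2"
    and nrm: "\<And>f. nrm f = c * Hdot_norm \<eta> s\<^sub>1 f + Hdot_norm \<eta> s\<^sub>2 f"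
    and Z: "\<And>\<sigma> v. v \<in> Z \<sigma> \<Longrightarrow> (\<forall>t. v t \<in> H) \<and> (\<forall>N\<in>dyadic. (\<lambda>t. LP \<eta> N (v t)) \<in> U2\<sigma> \<sigma>)
      \<and> Zdot_finite \<eta> s\<^sub>1 \<sigma> v \<and> Zdot_finite \<eta> s\<^sub>2 \<sigma> v"
    and flow: "flow_map \<eta> H nrm Z znorm \<alpha> \<beta> \<gamma> r S" and D: "D \<in> ball3 H nrm r"
  shows "\<exists>D\<^sub>p\<in>prod3 H. \<exists>D\<^sub>m\<in>prod3 H.
     tends_to_zero3 H nrm (\<lambda>t. diff3 (S_plus S D t) (free_evolution \<alpha> \<beta> \<gamma> D\<^sub>p t)) at_top \<and>
     tends_to_zero3 H nrm (\<lambda>t. diff3 (S_minus S D t) (free_evolution \<alpha> \<beta> \<gamma> D\<^sub>m t)) at_bot"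
proof -
  have comp: "\<exists>f\<in>H. (\<forall>t\<ge>0. (\<lambda>x. u t x - propagator \<sigma> t f x) \<in> H) \<and>
      ((\<lambda>t. nrm (\<lambda>x. u t x - propagator \<sigma> t f x)) \<longlongrightarrow> 0) at_top"
    if u: "u \<in> restr {0..} (Z \<sigma>)" for u \<sigma>
  proof -
    obtain f where f: "f \<in> Hdot \<eta> s\<^sub>1 \<inter> Hdot \<eta> s\<^sub>2"
      and mem: "\<And>t. 0 \<le> t \<Longrightarrow> (\<lambda>x. u t x - propagator \<sigma> t f x) \<in> Hdot \<eta> s\<^sub>1 \<inter> Hdot \<eta> s\<^sub>2"
      and lim: "\<And>s. s \<in> {s\<^sub>1, s\<^sub>2} \<Longrightarrow> ((\<lambda>t. Hdot_norm \<eta> s (\<lambda>x. u t x - propagator \<sigma> t f x)) \<longlongrightarrow> 0) at_top"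
      by (rule restr_scattering[OF \<eta> s\<^sub>1 s\<^sub>2 u Z[unfolded H]]) blast+
    have "((\<lambda>t. c * Hdot_norm \<eta> s\<^sub>1 (\<lambda>x. u t x - propagator \<sigma> t f x) + Hdot_norm \<eta> s\<^sub>2 (\<lambda>x. u t x - propagator \<sigma> t f x))
        \<longlongrightarrow> c * 0 + 0) at_top"
      by (intro tendsto_add tendsto_mult tendsto_const lim) auto
    then show ?thesis using f mem by (intro bexI[of _ f]) (auto simp: H nrm)
  qed
  have plus: "\<exists>D\<^sub>p\<in>prod3 H. (\<forall>t\<ge>0. diff3 (S_plus S D t) (free_evolution \<alpha> \<beta> \<gamma> D\<^sub>p t) \<in> prod3 H) \<and>
     ((\<lambda>t. norm3 nrm (diff3 (S_plus S D t) (free_evolution \<alpha> \<beta> \<gamma> D\<^sub>p t))) \<longlongrightarrow> 0) at_top"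
    if D: "D \<in> ball3 H nrm r" for D
  proof -
    obtain u v w where SD: "S D = (u, v, w)" by (cases "S D")
    have "S D \<in> Xball Z znorm \<alpha> \<beta> \<gamma> r {0..}"
      using flow D by (auto simp: flow_map_def)
    then have uvw: "u \<in> restr {0..} (Z \<alpha>)" "v \<in> restr {0..} (Z \<beta>)" "w \<in> restr {0..} (Z \<gamma>)"
      by (auto simp: SD Xball_def Xspace_def)
    obtain f where f: "f \<in> H" "\<forall>t\<ge>0. (\<lambda>x. u t x - propagator \<alpha> t f x) \<in> H"
      "((\<lambda>t. nrm (\<lambda>x. u t x - propagator \<alpha> t f x)) \<longlongrightarrow> 0) at_top"
      using comp[OF uvw(1)] by blast
    obtain g where g: "g \<in> H" "\<forall>t\<ge>0. (\<lambda>x. v t x - propagator \<beta> t g x) \<in> H"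
      "((\<lambda>t. nrm (\<lambda>x. v t x - propagator \<beta> t g x)) \<longlongrightarrow> 0) at_top"
      using comp[OF uvw(2)] by blast
    obtain h where h: "h \<in> H" "\<forall>t\<ge>0. (\<lambda>x. w t x - propagator \<gamma> t h x) \<in> H"
      "((\<lambda>t. nrm (\<lambda>x. w t x - propagator \<gamma> t h x)) \<longlongrightarrow> 0) at_top"
      using comp[OF uvw(3)] by blast
    have "((\<lambda>t. max (nrm (\<lambda>x. u t x - propagator \<alpha> t f x)) (max (nrm (\<lambda>x. v t x - propagator \<beta> t g x)) (nrm (\<lambda>x. w t x - propagator \<gamma> t h x))))
        \<longlongrightarrow> max 0 (max 0 0)) at_top"
      by (intro tendsto_max f g h)
    then show ?thesis
      using f g h by (intro bexI[of _ "(f, g, h)"])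
        (auto simp: prod3_def diff3_def norm3_def S_plus_def eval_sol_def free_evolution_def SD)
  qed
  \<comment> \<open>Limit at \<open>-\<infinity>\<close>: apply the previous step to the conjugate data.\<close>
  have Hc: "vcnj f \<in> H \<and> nrm (vcnj f) = nrm f" if "f \<in> H" for f
    using that by (auto simp: H nrm Hdot_vcnj[OF \<eta>])
  have cD: "cnj3 D \<in> ball3 H nrm r"
    using D Hc by (cases D) (auto simp: cnj3_def ball3_def prod3_def norm3_def)
  obtain D\<^sub>p where Dp: "D\<^sub>p \<in> prod3 H" "\<forall>t\<ge>0. diff3 (S_plus S D t) (free_evolution \<alpha> \<beta> \<gamma> D\<^sub>p t) \<in> prod3 H"
    "((\<lambda>t. norm3 nrm (diff3 (S_plus S D t) (free_evolution \<alpha> \<beta> \<gamma> D\<^sub>p t))) \<longlongrightarrow> 0) at_top"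
    using plus[OF D] by blast
  obtain E where E: "E \<in> prod3 H" "\<forall>t\<ge>0. diff3 (S_plus S (cnj3 D) t) (free_evolution \<alpha> \<beta> \<gamma> E t) \<in> prod3 H"
    "((\<lambda>t. norm3 nrm (diff3 (S_plus S (cnj3 D) t) (free_evolution \<alpha> \<beta> \<gamma> E t))) \<longlongrightarrow> 0) at_top"
    using plus[OF cD] by blast
  have Em: "cnj3 E \<in> prod3 H" using E(1) Hc by (cases E) (auto simp: cnj3_def prod3_def)
  have key: "(\<lambda>x. vcnj F x - propagator \<sigma> t (vcnj f) x) \<in> H \<and>
     nrm (\<lambda>x. vcnj F x - propagator \<sigma> t (vcnj f) x) = nrm (\<lambda>x. F x - propagator \<sigma> (- t) f x)"
    if "f \<in> H" "(\<lambda>x. F x - propagator \<sigma> (- t) f x) \<in> H" for F f \<sigma> t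
    using that vcnj_scattering[OF \<eta> s\<^sub>1, of f F \<sigma> t] by (auto simp: H nrm)
  have minus: "diff3 (S_minus S D t) (free_evolution \<alpha> \<beta> \<gamma> (cnj3 E) t) \<in> prod3 H \<and>
     norm3 nrm (diff3 (S_minus S D t) (free_evolution \<alpha> \<beta> \<gamma> (cnj3 E) t)) =
       norm3 nrm (diff3 (S_plus S (cnj3 D) (- t)) (free_evolution \<alpha> \<beta> \<gamma> E (- t)))" if t: "t \<le> 0" for t
  proof -
    obtain F G K where FGK: "S_plus S (cnj3 D) (- t) = (F, G, K)" by (cases "S_plus S (cnj3 D) (- t)")
    obtain f g k where fgk: "E = (f, g, k)" by (cases E)
    have d: "diff3 (S_plus S (cnj3 D) (- t)) (free_evolution \<alpha> \<beta> \<gamma> E (- t)) \<in> prod3 H"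
      using E(2) t by simp
    have mem: "f \<in> H" "g \<in> H" "k \<in> H" using E(1) by (auto simp: fgk prod3_def)
    have memd: "(\<lambda>x. F x - propagator \<alpha> (- t) f x) \<in> H" "(\<lambda>x. G x - propagator \<beta> (- t) g x) \<in> H"
       "(\<lambda>x. K x - propagator \<gamma> (- t) k x) \<in> H"
      using d by (auto simp: FGK fgk diff3_def free_evolution_def prod3_def)
    show ?thesis
      using key[OF mem(1) memd(1)] key[OF mem(2) memd(2)] key[OF mem(3) memd(3)]
      unfolding S_minus_def FGK fgk
      by (simp add: cnj3_def diff3_def free_evolution_def prod3_def norm3_def)
  qed
  have "tends_to_zero3 H nrm (\<lambda>t. diff3 (S_plus S D t) (free_evolution \<alpha> \<beta> \<gamma> D\<^sub>p t)) at_top"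
    unfolding tends_to_zero3_def
  proof
    show "\<forall>\<^sub>F t in at_top. diff3 (S_plus S D t) (free_evolution \<alpha> \<beta> \<gamma> D\<^sub>p t) \<in> prod3 H"
      using eventually_ge_at_top[of "0::real"] by eventually_elim (use Dp(2) in blast)
  qed (rule Dp(3))
  moreover have "tends_to_zero3 H nrm (\<lambda>t. diff3 (S_minus S D t) (free_evolution \<alpha> \<beta> \<gamma> (cnj3 E) t)) at_bot"
    unfolding tends_to_zero3_def
  proof
    have ev: "\<forall>\<^sub>F t::real in at_bot. t \<le> 0" by (rule eventually_le_at_bot)
    then show "\<forall>\<^sub>F t in at_bot. diff3 (S_minus S D t) (free_evolution \<alpha> \<beta> \<gamma> (cnj3 E) t) \<in> prod3 H"
      by eventually_elim (use minus in blast)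
    have "((\<lambda>t. norm3 nrm (diff3 (S_plus S (cnj3 D) (- t)) (free_evolution \<alpha> \<beta> \<gamma> E (- t)))) \<longlongrightarrow> 0) at_bot"
      by (rule filterlim_compose[OF E(3) filterlim_uminus_at_top_at_bot])
    moreover have "\<forall>\<^sub>F t in at_bot. norm3 nrm (diff3 (S_plus S (cnj3 D) (- t)) (free_evolution \<alpha> \<beta> \<gamma> E (- t))) =
       norm3 nrm (diff3 (S_minus S D t) (free_evolution \<alpha> \<beta> \<gamma> (cnj3 E) t))"
      using ev by eventually_elim (use minus in simp)
    ultimately show "((\<lambda>t. norm3 nrm (diff3 (S_minus S D t) (free_evolution \<alpha> \<beta> \<gamma> (cnj3 E) t))) \<longlongrightarrow> 0) at_bot"
      using tendsto_cong by fast
  qed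
  ultimately show ?thesis using Dp(1) Em by blast
qed

theorem corollary1p2:
  fixes \<eta> :: "real \<Rightarrow> real" and \<alpha> \<beta> \<gamma> \<theta> \<kappa> s\<^sub>c :: real
  assumes cutoff: "lp_cutoff \<eta>"
    and dim: "CARD('n::finite) \<ge> 2"
    and sc: "s\<^sub>c = real CARD('n) / 2 - 1"
    and nonzero: "\<alpha> \<noteq> 0" "\<beta> \<noteq> 0" "\<gamma> \<noteq> 0"
    and theta: "\<theta> = \<alpha> * \<beta> * \<gamma> * (1 / \<alpha> - 1 / \<beta> - 1 / \<gamma>)"
    and kappa: "\<kappa> = (\<alpha> - \<beta>) * (\<alpha> - \<gamma>) * (\<beta> + \<gamma>)"
    and high_dim: "CARD('n) \<ge> 4 \<Longrightarrow> \<kappa> \<noteq> 0"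
    and low_dim: "CARD('n) = 2 \<or> CARD('n) = 3 \<Longrightarrow> \<theta> > 0"
  shows
    "(\<forall>r>0. \<forall>S::'n data \<Rightarrow> 'n sol. Hdot_flow_map \<eta> s\<^sub>c \<alpha> \<beta> \<gamma> r S \<longrightarrow>
        (\<forall>D\<in>ball3 (Hdot \<eta> s\<^sub>c) (Hdot_norm \<eta> s\<^sub>c) r.
           \<exists>D\<^sub>p\<in>prod3 (Hdot \<eta> s\<^sub>c). \<exists>D\<^sub>m\<in>prod3 (Hdot \<eta> s\<^sub>c).
             tends_to_zero3 (Hdot \<eta> s\<^sub>c) (Hdot_norm \<eta> s\<^sub>c)
               (\<lambda>t. diff3 (S_plus S D t) (free_evolution \<alpha> \<beta> \<gamma> D\<^sub>p t)) at_top \<and>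
             tends_to_zero3 (Hdot \<eta> s\<^sub>c) (Hdot_norm \<eta> s\<^sub>c)
               (\<lambda>t. diff3 (S_minus S D t) (free_evolution \<alpha> \<beta> \<gamma> D\<^sub>m t)) at_bot))
     \<and>
     (\<forall>s\<ge>s\<^sub>c. \<forall>r>0. \<forall>S::'n data \<Rightarrow> 'n sol. Hs_flow_map \<eta> s \<alpha> \<beta> \<gamma> r S \<longrightarrow>
        (\<forall>D\<in>ball3 (Hs \<eta> s) (Hs_norm \<eta> s) r.
           \<exists>D\<^sub>p\<in>prod3 (Hs \<eta> s). \<exists>D\<^sub>m\<in>prod3 (Hs \<eta> s).
             tends_to_zero3 (Hs \<eta> s) (Hs_norm \<eta> s)
               (\<lambda>t. diff3 (S_plus S D t) (free_evolution \<alpha> \<beta> \<gamma> D\<^sub>p t)) at_top \<and>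
             tends_to_zero3 (Hs \<eta> s) (Hs_norm \<eta> s)
               (\<lambda>t. diff3 (S_minus S D t) (free_evolution \<alpha> \<beta> \<gamma> D\<^sub>m t)) at_bot))"
proof (intro conjI allI impI ballI)
  have d: "0 \<le> s\<^sub>c" "s\<^sub>c < real CARD('n) / 2" using dim sc by auto
  fix r :: real and S :: "'n data \<Rightarrow> 'n sol" and D :: "'n data"
  assume S: "Hdot_flow_map \<eta> s\<^sub>c \<alpha> \<beta> \<gamma> r S" and D: "D \<in> ball3 (Hdot \<eta> s\<^sub>c) (Hdot_norm \<eta> s\<^sub>c) r"
  show "\<exists>D\<^sub>p\<in>prod3 (Hdot \<eta> s\<^sub>c). \<exists>D\<^sub>m\<in>prod3 (Hdot \<eta> s\<^sub>c).
     tends_to_zero3 (Hdot \<eta> s\<^sub>c) (Hdot_norm \<eta> s\<^sub>c) (\<lambda>t. diff3 (S_plus S D t) (free_evolution \<alpha> \<beta> \<gamma> D\<^sub>p t)) at_top \<and>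
     tends_to_zero3 (Hdot \<eta> s\<^sub>c) (Hdot_norm \<eta> s\<^sub>c) (\<lambda>t. diff3 (S_minus S D t) (free_evolution \<alpha> \<beta> \<gamma> D\<^sub>m t)) at_bot"
    by (rule flow_scattering[OF cutoff d d(1) _ _ _ S[unfolded Hdot_flow_map_def] D, of 0])
       (auto simp: Zdot_def cont_traj_def)
next
  fix s r :: real and S :: "'n data \<Rightarrow> 'n sol" and D :: "'n data"
  assume s: "s\<^sub>c \<le> s" and S: "Hs_flow_map \<eta> s \<alpha> \<beta> \<gamma> r S" and D: "D \<in> ball3 (Hs \<eta> s) (Hs_norm \<eta> s) r"
  have d: "(0::real) \<le> 0" "0 < real CARD('n) / 2" "0 \<le> s" using dim sc s by auto
  show "\<exists>D\<^sub>p\<in>prod3 (Hs \<eta> s). \<exists>D\<^sub>m\<in>prod3 (Hs \<eta> s).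
     tends_to_zero3 (Hs \<eta> s) (Hs_norm \<eta> s) (\<lambda>t. diff3 (S_plus S D t) (free_evolution \<alpha> \<beta> \<gamma> D\<^sub>p t)) at_top \<and>
     tends_to_zero3 (Hs \<eta> s) (Hs_norm \<eta> s) (\<lambda>t. diff3 (S_minus S D t) (free_evolution \<alpha> \<beta> \<gamma> D\<^sub>m t)) at_bot"
    by (rule flow_scattering[OF cutoff d _ _ _ S[unfolded Hs_flow_map_def] D, of 1])
       (auto simp: Zs_def Hs_def Hs_norm_def cont_traj_def)
qed

end
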